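(* Let $1\le k\le n$, let $M$ be a proper kernel, let $R(f)=\|M_f\|_{n-k}$, and let $I:\mathcal{G}'_k\cup\mathcal{S}(\mathbb{R}^n)\to\mathbb{R}^+$ be such that for any sequence $\{f_i\}\subseteq\mathcal{S}(\mathbb{R}^n)$ with $T_{f_i}\to^* f\in\mathcal{G}'_k$ one has $\lim_{i\to\infty}I(f_i)=I(f)$. Then $$\operatorname{rsol}(I,R)\subseteq\operatorname{Arg}\min_{f\in\mathcal{G}'_k}I(f).$$
   Context: $\mathcal{S}(\mathbb{R}^n)$ is the (complex) Schwartz space, $\mathcal{S}'(\mathbb{R}^n)$ the tempered distributions with the weak topology; $\to^*$ is weak convergence of sequences. A Schwartz function $f$ is identified with the distribution $T_f:\phi\mapsto\int f\phi$. $\mathbb{R}^+$ is the set of nonnegative reals. For $g\in\mathcal{S}'(\mathbb{R}^k)$, $g\otimes\delta^{n-k}$ is its tensor product with the $(n-k)$-dimensional Dirac delta at the origin. For $h\in\mathcal{S}'(\mathbb{R}^n)$ and orthogonal $U$, $\langle h_U,\phi\rangle=\langle h,\psi\rangle$ with $\psi(\mathbf{x})=\phi(U^T\mathbf{x})$. $\mathcal{G}'_k=\{(g\otimes\delta^{n-k})_U: g\in\mathcal{S}'(\mathbb{R}^k),\ U\in\mathbb{R}^{n\times n},\ U^TU=I_n\}$. Proper kernel: for $M:\mathbb{R}^n\times\mathbb{R}^n\to\mathbb{C}$ let $\mathrm{O}_M[f](\mathbf{x})=\int M(\mathbf{x},\mathbf{y})f(\mathbf{y})\,d\mathbf{y}$.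 $M$ is a proper kernel if (1) $\mathrm{O}_M:L_2(\mathbb{R}^n)\to L_2(\mathbb{R}^n)$ is a properly defined, strictly positive, self-adjoint operator (strictly positive: $\langle f,\mathrm{O}_M[f]\rangle_{L_2}>0$ for $f\ne0$); (2) $M$ is bounded; (3) $\operatorname{Range}[\mathrm{O}_M]\cap\mathcal{S}(\mathbb{R}^n)$ is dense in $\mathcal{S}(\mathbb{R}^n)$ with its standard topology. For $f,g\in L_1(\mathbb{R}^n)$, $\langle f|M|g\rangle=\iint f(\mathbf{x})^*M(\mathbf{x},\mathbf{y})g(\mathbf{y})\,d\mathbf{x}\,d\mathbf{y}$. For $f\in\mathcal{S}(\mathbb{R}^n)$, $M_f=[\operatorname{Re}\langle x_if|M|x_jf\rangle]_{1\le i,j\le n}$. For a positive semidefinite $A\in\mathbb{R}^{n\times n}$ with eigenvalues $\lambda_1\ge\dots\ge\lambda_n$ (with multiplicities), the Ky Fan $m$-anti-norm is $\|A\|_m=\sum_{i=1}^m\lambda_{n+1-i}$; thus $\|M_f\|_{n-k}$ is the sum of the $n-k$ smallest eigenvalues of $M_f$. A sequence $\{f_i\}_{i\ge1}\subseteq\mathcal{S}(\mathbb{R}^n)$ regularly solves the penalized problem if there are $\epsilon_i\to+0$ and $\lambda_i\to+\infty$ with $I(f_i)+\lambda_iR(f_i)\le\inf_{f\in\mathcal{S}(\mathbb{R}^n)}\big(I(f)+\lambda_iR(f)\big)+\epsilon_i$ for all $i$, and $\operatorname{Tr}(M_{f_i})$ is bounded. For a sequence of distributions, $\operatorname{Lim}_{i\to\infty}h_i$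 is the set of weak limits of its subsequences. $\operatorname{rsol}(I,R)=\bigcup\operatorname{Lim}_{i\to\infty}T_{f_i}$, the union being over all sequences $\{f_i\}$ that regularly solve the penalized problem. $\operatorname{Arg}\min$ denotes the set of all minimizers. *)

theory Defs
  imports "HOL-Analysis.Analysis" "HOL-Computational_Algebra.Polynomial"
begin

subsection \<open>The Schwartz space\<close>

definition partial_derivative :: "'n::finite \<Rightarrow> (real^'n \<Rightarrow> complex) \<Rightarrow> real^'n \<Rightarrow> complex" where
  "partial_derivative i f x = frechet_derivative f (at x) (axis i 1)"

text \<open>Mixed partial derivatives are indexed by the list of differentiation directions.  Partial
  derivatives of a smooth function commute, so the lists and the multi-indices give the same
  derivatives.\<close>

primrec iterated_partial :: "'n::finite list \<Rightarrow> (real^'n \<Rightarrow> complex) \<Rightarrow> real^'n \<Rightarrow> complex" where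
  "iterated_partial [] f = f"
| "iterated_partial (i # is) f = partial_derivative i (iterated_partial is f)"

definition monomial_fun :: "('n::finite \<Rightarrow> nat) \<Rightarrow> real^'n \<Rightarrow> real" where
  "monomial_fun \<alpha> x = (\<Prod>i\<in>UNIV. (x $ i) ^ \<alpha> i)"

definition schwartz :: "(real^'n::finite \<Rightarrow> complex) set" where
  "schwartz = {f. (\<forall>is x. iterated_partial is f differentiable (at x)) \<and>
                  (\<forall>\<alpha> is. bounded (range (\<lambda>x. monomial_fun \<alpha> x *\<^sub>R iterated_partial is f x)))}"

definition schwartz_seminorm ::
  "('n::finite \<Rightarrow> nat) \<Rightarrow> 'n list \<Rightarrow> (real^'n \<Rightarrow> complex) \<Rightarrow> real" where
  "schwartz_seminorm \<alpha> is f = (SUP x. norm (monomial_fun \<alpha> x *\<^sub>R iterated_partial is f x))"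

definition schwartz_topology :: "(real^'n::finite \<Rightarrow> complex) topology" where
  "schwartz_topology = topology_generated_by
     {{g \<in> schwartz. schwartz_seminorm \<alpha> is (\<lambda>x. g x - f x) < e} | f \<alpha> is e. f \<in> schwartz \<and> e > 0}"


subsection \<open>Tempered distributions\<close>

type_synonym 'n distrib = "(real^'n \<Rightarrow> complex) \<Rightarrow> complex"

text \<open>Distributions are functionals on the Schwartz space only; extensionality makes equality of
  HOL functions the equality of functionals.\<close>

definition tempered :: "'n::finite distrib set" where
  "tempered = {T \<in> extensional schwartz.
     (\<forall>f\<in>schwartz. \<forall>g\<in>schwartz. T (\<lambda>x. f x + g x) = T f + T g) \<and>
     (\<forall>c. \<forall>f\<in>schwartz. T (\<lambda>x. c * f x) = c * T f) \<and>
     continuous_map schwartz_topology euclidean T}"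

definition weakly_converges :: "(nat \<Rightarrow> 'n::finite distrib) \<Rightarrow> 'n distrib \<Rightarrow> bool" where
  "weakly_converges h T \<longleftrightarrow> (\<forall>\<phi>\<in>schwartz. (\<lambda>i. h i \<phi>) \<longlonglongrightarrow> T \<phi>)"

definition distrib_of :: "(real^'n::finite \<Rightarrow> complex) \<Rightarrow> 'n distrib" where
  "distrib_of f = (\<lambda>\<phi>\<in>schwartz. integral\<^sup>L lebesgue (\<lambda>x. f x * \<phi> x))"

text \<open>An injection \<open>\<iota>\<close> of the index type of \<open>\<real>\<^sup>k\<close> into that of \<open>\<real>\<^sup>n\<close> names the coordinates that play
  the role of the first \<open>k\<close> ones; the others are set to zero.\<close>

definition embed_coords :: "('k::finite \<Rightarrow> 'n::finite) \<Rightarrow> real^'k \<Rightarrow> real^'n" where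
  "embed_coords \<iota> y = (\<chi> j. if j \<in> range \<iota> then y $ inv \<iota> j else 0)"

text \<open>\<open>g \<otimes> \<delta>\<close>: applying the Dirac delta in the coordinates outside \<open>range \<iota>\<close> evaluates the
  test function at zero in these coordinates.\<close>

definition tensor_delta :: "('k::finite \<Rightarrow> 'n::finite) \<Rightarrow> 'k distrib \<Rightarrow> 'n distrib" where
  "tensor_delta \<iota> g = (\<lambda>\<phi>\<in>schwartz. g (\<lambda>y. \<phi> (embed_coords \<iota> y)))"

definition rotate_distrib :: "real^'n^'n \<Rightarrow> 'n::finite distrib \<Rightarrow> 'n distrib" where
  "rotate_distrib U h = (\<lambda>\<phi>\<in>schwartz. h (\<lambda>x. \<phi> (transpose U *v x)))"

definition low_dim_distribs :: "('k::finite \<Rightarrow> 'n::finite) \<Rightarrow> 'n distrib set" where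
  "low_dim_distribs \<iota> =
     {rotate_distrib U (tensor_delta \<iota> g) | g U. g \<in> tempered \<and> transpose U ** U = mat 1}"


subsection \<open>Proper kernels\<close>

definition L2_funs :: "(real^'n::finite \<Rightarrow> complex) set" where
  "L2_funs = {f \<in> borel_measurable lebesgue. integrable lebesgue (\<lambda>x. (cmod (f x))\<^sup>2)}"

definition L2_inner :: "(real^'n::finite \<Rightarrow> complex) \<Rightarrow> (real^'n \<Rightarrow> complex) \<Rightarrow> complex" where
  "L2_inner f g = integral\<^sup>L lebesgue (\<lambda>x. cnj (f x) * g x)"

definition kernel_op ::
  "(real^'n::finite \<Rightarrow> real^'n \<Rightarrow> complex) \<Rightarrow> (real^'n \<Rightarrow> complex) \<Rightarrow> real^'n \<Rightarrow> complex" where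
  "kernel_op M f x = integral\<^sup>L lebesgue (\<lambda>y. M x y * f y)"

text \<open>Elements of \<open>L\<^sub>2\<close> are represented by functions, so \<open>f \<noteq> 0\<close> and membership in the range are
  understood almost everywhere.  The operator is defined on all of \<open>L\<^sub>2\<close>, hence self-adjointness
  is symmetry with respect to the inner product.\<close>

definition proper_kernel :: "(real^'n::finite \<Rightarrow> real^'n \<Rightarrow> complex) \<Rightarrow> bool" where
  "proper_kernel M \<longleftrightarrow>
     (\<forall>f\<in>L2_funs. (AE x in lebesgue. integrable lebesgue (\<lambda>y. M x y * f y)) \<and>
                  kernel_op M f \<in> L2_funs) \<and>
     (\<forall>f\<in>L2_funs. \<not> (AE x in lebesgue. f x = 0) \<longrightarrow>
        Im (L2_inner f (kernel_op M f)) = 0 \<and> Re (L2_inner f (kernel_op M f)) > 0) \<and>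
     (\<forall>f\<in>L2_funs. \<forall>g\<in>L2_funs. L2_inner f (kernel_op M g) = L2_inner (kernel_op M f) g) \<and>
     (\<exists>B. \<forall>x y. cmod (M x y) \<le> B) \<and>
     schwartz_topology closure_of
       {\<phi> \<in> schwartz. \<exists>f\<in>L2_funs. AE x in lebesgue. \<phi> x = kernel_op M f x} = schwartz"

text \<open>The iterated integral equals the double integral for bounded, jointly measurable kernels and
  integrable functions; in this order it also makes sense for every proper kernel.\<close>

definition kernel_form ::
  "(real^'n::finite \<Rightarrow> complex) \<Rightarrow> (real^'n \<Rightarrow> real^'n \<Rightarrow> complex) \<Rightarrow> (real^'n \<Rightarrow> complex) \<Rightarrow> complex" where
  "kernel_form f M g =
     integral\<^sup>L lebesgue (\<lambda>x. integral\<^sup>L lebesgue (\<lambda>y. cnj (f x) * M x y * g y))"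

definition moment_matrix ::
  "(real^'n::finite \<Rightarrow> real^'n \<Rightarrow> complex) \<Rightarrow> (real^'n \<Rightarrow> complex) \<Rightarrow> real^'n^'n" where
  "moment_matrix M f = (\<chi> i j. Re (kernel_form (\<lambda>x. x $ i *\<^sub>R f x) M (\<lambda>x. x $ j *\<^sub>R f x)))"


subsection \<open>The Ky Fan anti-norm\<close>

text \<open>Eigenvalues are listed in increasing order with multiplicity as roots of the characteristic
  polynomial, so the first \<open>m\<close> entries are the \<open>m\<close> smallest eigenvalues.\<close>

definition charpoly :: "real^'n^'n::finite \<Rightarrow> real poly" where
  "charpoly A = det (\<chi> i j. (if i = j then [:0, 1:] else 0) - [:A $ i $ j:])"

definition sorted_eigenvalues :: "real^'n^'n::finite \<Rightarrow> real list" where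
  "sorted_eigenvalues A = sorted_list_of_multiset (proots (charpoly A))"

definition ky_fan_antinorm :: "nat \<Rightarrow> real^'n^'n::finite \<Rightarrow> real" where
  "ky_fan_antinorm m A = sum_list (take m (sorted_eigenvalues A))"


subsection \<open>Regular solutions of the penalized problem\<close>

definition regularly_solves ::
  "(real^'n::finite \<Rightarrow> real^'n \<Rightarrow> complex) \<Rightarrow> ((real^'n \<Rightarrow> complex) \<Rightarrow> real) \<Rightarrow>
   ((real^'n \<Rightarrow> complex) \<Rightarrow> real) \<Rightarrow> (nat \<Rightarrow> real^'n \<Rightarrow> complex) \<Rightarrow> bool" where
  "regularly_solves M I R f \<longleftrightarrow>
     range f \<subseteq> schwartz \<and>
     (\<exists>\<epsilon> \<Lambda>. filterlim \<epsilon> (at_right 0) sequentially \<and> filterlim \<Lambda> at_top sequentially \<and>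
        (\<forall>i. ereal (I (f i) + \<Lambda> i * R (f i)) \<le>
               (INF g\<in>schwartz. ereal (I g + \<Lambda> i * R g)) + ereal (\<epsilon> i))) \<and>
     bounded (range (\<lambda>i. trace (moment_matrix M (f i))))"

definition weak_limit_points :: "(nat \<Rightarrow> 'n::finite distrib) \<Rightarrow> 'n distrib set" where
  "weak_limit_points h = {T \<in> tempered. \<exists>r. strict_mono r \<and> weakly_converges (h \<circ> r) T}"

definition rsol ::
  "(real^'n::finite \<Rightarrow> real^'n \<Rightarrow> complex) \<Rightarrow> ((real^'n \<Rightarrow> complex) \<Rightarrow> real) \<Rightarrow>
   ((real^'n \<Rightarrow> complex) \<Rightarrow> real) \<Rightarrow> 'n distrib set" where
  "rsol M I R = (\<Union>f\<in>{f. regularly_solves M I R f}. weak_limit_points (\<lambda>i. distrib_of (f i)))"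

end

theory Submission
  imports Defs
begin

text \<open>
  Write \<open>J\<close> for the complement of \<open>range \<iota>\<close>, so that \<open>R(f)\<close> is the sum of the \<open>card J\<close> smallest
  eigenvalues of \<open>M\<^sub>f\<close>, and \<open>B(f, g) = \<langle>f, O\<^sub>M g\<rangle>\<close>.  The quadratic form of \<open>M\<^sub>f\<close> is
  \<open>u \<bullet> M\<^sub>f u = B((u \<bullet> x) f, (u \<bullet> x) f)\<close>, and by Ky Fan's variational principle \<open>R(f)\<close> is the minimum of
  \<open>\<Sum>\<^sub>j\<^sub>\<in>\<^sub>J u\<^sub>j \<bullet> M\<^sub>f u\<^sub>j\<close> over orthonormal frames.  So \<open>R(f)\<close> is small exactly if \<open>f\<close> is nearly annihilated,
  in the sense of \<open>B\<close>, by \<open>card J\<close> orthonormal linear forms, and the theorem is the usual statement about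
  penalty methods once two facts are known.

  \<^item> Low-dimensional distributions cost nothing (\<open>low_dim_recovery_sequence\<close>): each of them is the weak limit of Schwartz
    functions \<open>g\<^sub>j\<close> with \<open>R(g\<^sub>j) \<rightarrow> 0\<close>.  Hence the infimum of \<open>I + \<lambda>\<^sub>i R\<close> is at most \<open>I(h)\<close> for every
    low-dimensional \<open>h\<close>, and a regular sequence satisfies \<open>I(f\<^sub>i) + \<lambda>\<^sub>i R(f\<^sub>i) \<le> I(h) + \<epsilon>\<^sub>i\<close>.
    In particular \<open>R(f\<^sub>i) \<rightarrow> 0\<close> because \<open>I \<ge> 0\<close>.

  \<^item> Zero cost forces low dimension (\<open>weak_limit_low_dim\<close>): a weak limit \<open>T\<close> of functions with \<open>R(f\<^sub>i) \<rightarrow> 0\<close> and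
    bounded traces of the moment matrices is low-dimensional.  Then \<open>I(f\<^sub>i) \<rightarrow> I(T)\<close> along the subsequence, and the inequality above gives
    \<open>I(T) \<le> I(h)\<close>.

  For the second fact take frames that attain \<open>R(f\<^sub>i)\<close> and a limit \<open>(u\<^sub>j)\<close> of them.  The bound on the trace makes
  \<open>B((u\<^sub>j \<bullet> x) f\<^sub>i, (u\<^sub>j \<bullet> x) f\<^sub>i) \<rightarrow> 0\<close>; by Cauchy--Schwarz \<open>(u\<^sub>j \<bullet> x) T\<close> vanishes on the
  range of \<open>O\<^sub>M\<close>, which is dense, and so \<open>(u\<^sub>j \<bullet> x) T = 0\<close> for \<open>j \<in> J\<close>.  That such a \<open>T\<close> has the form
  \<open>(g \<otimes> \<delta>)\<^sub>U\<close> (\<open>tempered_annihilated_by_rows\<close>) follows by division: a Schwartz function minus the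
  Gaussian extension of its restriction to the subspace is a combination \<open>\<Sum> (u\<^sub>j \<bullet> x) \<psi>\<^sub>j\<close> with Schwartz
  functions \<open>\<psi>\<^sub>j\<close> (\<open>schwartz_hadamard\<close>).

  For the first fact a tempered distribution on the subspace is approximated by finite combinations of
  point masses (\<open>tempered_point_mass_approximation\<close>), which avoids convolution and the exchange of distributions
  with integrals.  A continuous seminorm is at most \<open>\<epsilon>\<close> times another one plus a multiple of finitely
  many point values, by compactness and interpolation of derivatives, and the Hahn--Banach extension step turns such a
  bound for a functional into an approximation by point evaluations.  The point masses are then smeared out to
  narrow Gaussians on the whole space; since the kernel is bounded, \<open>R\<close> sees only the first moments of the
  normal coordinates, and these are as small as the width.
\<close>

section \<open>Schwartz functions and their seminorms\<close>

lemma partial_derivative_eqI: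
  assumes "(f has_derivative f') (at x)"
  shows "partial_derivative i f x = f' (axis i 1)"
  unfolding partial_derivative_def using frechet_derivative_at[OF assms] by simp

lemma has_derivative_partials:
  fixes f :: "real^'n::finite \<Rightarrow> complex"
  assumes "f differentiable (at x)"
  shows "(f has_derivative (\<lambda>h. \<Sum>i\<in>UNIV. h $ i *\<^sub>R partial_derivative i f x)) (at x)"
proof -
  let ?D = "frechet_derivative f (at x)"
  have D: "(f has_derivative ?D) (at x)"
    using assms frechet_derivative_works by blast
  then have lin: "linear ?D" by (simp add: has_derivative_linear)
  have "?D h = (\<Sum>i\<in>UNIV. h $ i *\<^sub>R partial_derivative i f x)" for h
  proof -
    have "h = (\<Sum>i\<in>UNIV. h $ i *\<^sub>R axis i 1)"
      using basis_expansion[of h] by (simp add: scalar_mult_eq_scaleR)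
    then have "?D h = ?D (\<Sum>i\<in>UNIV. h $ i *\<^sub>R axis i 1)" by simp
    also have "\<dots> = (\<Sum>i\<in>UNIV. h $ i *\<^sub>R ?D (axis i 1))"
      by (simp add: linear_sum[OF lin] linear_scale[OF lin])
    finally show ?thesis by (simp add: partial_derivative_def)
  qed
  then have "?D = (\<lambda>h. \<Sum>i\<in>UNIV. h $ i *\<^sub>R partial_derivative i f x)" by blast
  with D show ?thesis by simp
qed

lemma partial_derivative_add:
  assumes "f differentiable (at x)" "g differentiable (at x)"
  shows "partial_derivative i (\<lambda>x. f x + g x) x = partial_derivative i f x + partial_derivative i g x"
proof -
  have "((\<lambda>x. f x + g x) has_derivative
      (\<lambda>h. (\<Sum>i\<in>UNIV. h $ i *\<^sub>R partial_derivative i f x) + (\<Sum>i\<in>UNIV. h $ i *\<^sub>R partial_derivative i g x))) (at x)"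
    by (intro has_derivative_add has_derivative_partials assms)
  from partial_derivative_eqI[OF this] show ?thesis
    by (simp add: axis_def if_distrib[of "\<lambda>c. c *\<^sub>R _"] cong: if_cong)
qed

lemma partial_derivative_bounded_linear:
  assumes "f differentiable (at x)" "bounded_linear L"
  shows "partial_derivative i (\<lambda>x. L (f x)) x = L (partial_derivative i f x)"
    and "(\<lambda>x. L (f x)) differentiable (at x)"
proof -
  have 1: "((\<lambda>x. L (f x)) has_derivative (\<lambda>h. L (\<Sum>i\<in>UNIV. h $ i *\<^sub>R partial_derivative i f x))) (at x)"
    by (intro bounded_linear.has_derivative[OF assms(2)] has_derivative_partials assms(1))
  from partial_derivative_eqI[OF this]
  show "partial_derivative i (\<lambda>x. L (f x)) x = L (partial_derivative i f x)"
    by (simp add: axis_def if_distrib[of "\<lambda>c. c *\<^sub>R _"] cong: if_cong)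
  from 1 show "(\<lambda>x. L (f x)) differentiable (at x)" by (auto simp: differentiable_def)
qed

lemma iterated_partial_append:
  "iterated_partial (is @ js) f = iterated_partial is (iterated_partial js f)"
  by (induction "is") auto

lemma schwartz_differentiable:
  "f \<in> schwartz \<Longrightarrow> iterated_partial is f differentiable (at x)"
  by (simp add: schwartz_def)

lemma schwartz_differentiable':
  "f \<in> schwartz \<Longrightarrow> f differentiable (at x)"
  using schwartz_differentiable[of f "[]"] by simp

lemma schwartz_iterated_partial:
  assumes "f \<in> schwartz" shows "iterated_partial js f \<in> schwartz"
  using assms unfolding schwartz_def
  by (auto simp flip: iterated_partial_append)

lemma schwartz_partial:
  "f \<in> schwartz \<Longrightarrow> partial_derivative i f \<in> schwartz"
  using schwartz_iterated_partial[of f "[i]"] by simp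

text \<open>Iterated derivatives are awkward to compute.  A set of rapidly decreasing functions that is closed under
  partial differentiation consists of Schwartz functions, so that it suffices to find such a set, as for
  the polynomial multiples of a Gaussian below.\<close>

lemma schwartz_coinduct [consumes 1, case_names differentiable partial decay]:
  assumes "f \<in> C"
    and diff: "\<And>f x. f \<in> C \<Longrightarrow> f differentiable (at x)"
    and partial: "\<And>f i. f \<in> C \<Longrightarrow> partial_derivative i f \<in> C"
    and decay: "\<And>f \<alpha>. f \<in> C \<Longrightarrow> \<exists>B. \<forall>x. \<bar>monomial_fun \<alpha> x\<bar> * norm (f x) \<le> B"
  shows "f \<in> schwartz"
proof -
  have "iterated_partial is f \<in> C" for "is"
    by (induction "is") (auto simp: assms(1) partial)
  then show ?thesis
    unfolding schwartz_def using diff decay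
    by (fastforce simp: bounded_iff)
qed

lemma schwartz_continuous_on: "f \<in> schwartz \<Longrightarrow> continuous_on S f"
  by (meson continuous_at_imp_continuous_on differentiable_imp_continuous_within schwartz_differentiable')

lemma iterated_partial_add:
  assumes "f \<in> schwartz" "g \<in> schwartz"
  shows "iterated_partial is (\<lambda>x. f x + g x) = (\<lambda>x. iterated_partial is f x + iterated_partial is g x)"
  by (induction "is") (simp_all add: partial_derivative_add schwartz_differentiable assms fun_eq_iff[of "partial_derivative _ _"])

lemma iterated_partial_bounded_linear:
  assumes "f \<in> schwartz" "bounded_linear L"
  shows "iterated_partial is (\<lambda>x. L (f x)) = (\<lambda>x. L (iterated_partial is f x))"
  by (induction "is") (simp_all add: partial_derivative_bounded_linear schwartz_differentiable assms fun_eq_iff[of "partial_derivative _ _"])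

lemma schwartz_decay:
  assumes "f \<in> schwartz"
  obtains B where "\<And>x. \<bar>monomial_fun \<alpha> x\<bar> * norm (iterated_partial is f x) \<le> B"
  using assms unfolding schwartz_def bounded_iff by force

lemma schwartz_add:
  assumes "f \<in> schwartz" "g \<in> schwartz"
  shows "(\<lambda>x. f x + g x) \<in> schwartz"
proof -
  have "bounded (range (\<lambda>x. monomial_fun \<alpha> x *\<^sub>R (iterated_partial is f x + iterated_partial is g x)))"
    for \<alpha> "is"
    using assms bounded_plus_comp[of "\<lambda>x. monomial_fun \<alpha> x *\<^sub>R iterated_partial is f x" UNIV
        "\<lambda>x. monomial_fun \<alpha> x *\<^sub>R iterated_partial is g x"]
    by (simp add: schwartz_def scaleR_add_right)
  then show ?thesis
    using assms by (simp add: schwartz_def iterated_partial_add[OF assms])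
qed

lemma schwartz_bounded_linear:
  assumes "f \<in> schwartz" "bounded_linear L"
  shows "(\<lambda>x. L (f x)) \<in> schwartz"
proof -
  have "bounded (range (\<lambda>x. monomial_fun \<alpha> x *\<^sub>R L (iterated_partial is f x)))" for \<alpha> "is"
  proof -
    have "bounded (L ` range (\<lambda>x. monomial_fun \<alpha> x *\<^sub>R iterated_partial is f x))"
      using assms(1) by (intro bounded_linear_image[OF _ assms(2)]) (simp add: schwartz_def)
    then show ?thesis
      by (simp add: image_image linear_scale[OF bounded_linear.linear[OF assms(2)]])
  qed
  then show ?thesis
    using assms by (simp add: schwartz_def iterated_partial_bounded_linear[OF assms]
        partial_derivative_bounded_linear)
qed

lemma schwartz_cmult: "f \<in> schwartz \<Longrightarrow> (\<lambda>x. c * f x) \<in> schwartz"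
  by (rule schwartz_bounded_linear) (auto intro: bounded_linear_mult_right)

lemma schwartz_cnj: "f \<in> schwartz \<Longrightarrow> (\<lambda>x. cnj (f x)) \<in> schwartz"
  by (rule schwartz_bounded_linear) (auto intro: bounded_linear_cnj)

lemma schwartz_zero: "(\<lambda>x. 0) \<in> schwartz"
proof (rule schwartz_coinduct[where C="{\<lambda>x. 0}"])
  show "partial_derivative i f \<in> {\<lambda>x. 0}" if "f \<in> {\<lambda>x. 0}" for f :: "real^'a \<Rightarrow> complex" and i
    using that partial_derivative_eqI[of "\<lambda>_. 0" "\<lambda>_. 0"] by auto
qed auto

lemma schwartz_sum:
  assumes "\<And>a. a \<in> A \<Longrightarrow> f a \<in> schwartz"
  shows "(\<lambda>x. \<Sum>a\<in>A. f a x) \<in> schwartz"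
  using assms by (induction A rule: infinite_finite_induct) (auto simp: schwartz_zero schwartz_add)

lemma schwartz_diff:
  "f \<in> schwartz \<Longrightarrow> g \<in> schwartz \<Longrightarrow> (\<lambda>x. f x - g x) \<in> schwartz"
  using schwartz_add[of f "\<lambda>x. (-1) * g x"] schwartz_cmult[of g "-1"] by simp

lemma schwartz_seminorm_bound:
  assumes "f \<in> schwartz"
  shows "norm (monomial_fun \<alpha> x *\<^sub>R iterated_partial is f x) \<le> schwartz_seminorm \<alpha> is f"
  unfolding schwartz_seminorm_def
proof (rule cSUP_upper)
  obtain B where "\<And>x. \<bar>monomial_fun \<alpha> x\<bar> * norm (iterated_partial is f x) \<le> B"
    using schwartz_decay[OF assms] by blast
  then show "bdd_above (range (\<lambda>x. norm (monomial_fun \<alpha> x *\<^sub>R iterated_partial is f x)))"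
    by (auto intro!: bdd_aboveI2[where M=B])
qed simp

lemma schwartz_seminorm_leI:
  assumes "\<And>x. \<bar>monomial_fun \<alpha> x\<bar> * norm (iterated_partial is f x) \<le> B"
  shows "schwartz_seminorm \<alpha> is f \<le> B"
  unfolding schwartz_seminorm_def using assms by (intro cSUP_least) auto

lemma schwartz_seminorm_nonneg: "f \<in> schwartz \<Longrightarrow> 0 \<le> schwartz_seminorm \<alpha> is f"
  using schwartz_seminorm_bound norm_ge_zero order_trans by blast

lemma schwartz_seminorm_add:
  assumes "f \<in> schwartz" "g \<in> schwartz"
  shows "schwartz_seminorm \<alpha> is (\<lambda>x. f x + g x) \<le> schwartz_seminorm \<alpha> is f + schwartz_seminorm \<alpha> is g"
proof (rule schwartz_seminorm_leI)
  fix x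
  have "\<bar>monomial_fun \<alpha> x\<bar> * norm (iterated_partial is (\<lambda>x. f x + g x) x)
      \<le> norm (monomial_fun \<alpha> x *\<^sub>R iterated_partial is f x) + norm (monomial_fun \<alpha> x *\<^sub>R iterated_partial is g x)"
    using norm_triangle_ineq[of "monomial_fun \<alpha> x *\<^sub>R iterated_partial is f x" "monomial_fun \<alpha> x *\<^sub>R iterated_partial is g x"]
    by (simp add: iterated_partial_add[OF assms] flip: scaleR_add_right)
  also have "\<dots> \<le> schwartz_seminorm \<alpha> is f + schwartz_seminorm \<alpha> is g"
    by (intro add_mono schwartz_seminorm_bound assms)
  finally show "\<bar>monomial_fun \<alpha> x\<bar> * norm (iterated_partial is (\<lambda>x. f x + g x) x) \<le> \<dots>" .
qed

lemma schwartz_seminorm_cmult_le: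
  assumes "f \<in> schwartz"
  shows "schwartz_seminorm \<alpha> is (\<lambda>x. c * f x) \<le> cmod c * schwartz_seminorm \<alpha> is f"
proof (rule schwartz_seminorm_leI)
  fix x
  have "iterated_partial is (\<lambda>x. c * f x) x = c * iterated_partial is f x"
    using iterated_partial_bounded_linear[OF assms bounded_linear_mult_right[of c]] by metis
  then show "\<bar>monomial_fun \<alpha> x\<bar> * norm (iterated_partial is (\<lambda>x. c * f x) x) \<le> cmod c * schwartz_seminorm \<alpha> is f"
    using mult_left_mono[OF schwartz_seminorm_bound[OF assms, of \<alpha> x "is"], of "cmod c"]
    by (simp add: norm_mult mult_ac)
qed

lemma schwartz_seminorm_zero [simp]: "schwartz_seminorm \<alpha> is (\<lambda>x. 0) = 0"
  using schwartz_seminorm_cmult_le[OF schwartz_zero, of \<alpha> "is" 0]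
    schwartz_seminorm_nonneg[OF schwartz_zero, of \<alpha> "is"] by simp

lemma schwartz_seminorm_cnj:
  "f \<in> schwartz \<Longrightarrow> schwartz_seminorm \<alpha> is (\<lambda>x. cnj (f x)) = schwartz_seminorm \<alpha> is f"
  by (simp add: schwartz_seminorm_def iterated_partial_bounded_linear[OF _ bounded_linear_cnj])

definition seminorm_sum :: "(('n::finite \<Rightarrow> nat) \<times> 'n list) set \<Rightarrow> (real^'n \<Rightarrow> complex) \<Rightarrow> real" where
  "seminorm_sum K f = (\<Sum>(\<alpha>, is)\<in>K. schwartz_seminorm \<alpha> is f)"

lemma seminorm_sum_nonneg: "f \<in> schwartz \<Longrightarrow> 0 \<le> seminorm_sum K f"
  unfolding seminorm_sum_def by (intro sum_nonneg) (auto intro: schwartz_seminorm_nonneg)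

lemma seminorm_sum_add:
  assumes "f \<in> schwartz" "g \<in> schwartz"
  shows "seminorm_sum K (\<lambda>x. f x + g x) \<le> seminorm_sum K f + seminorm_sum K g"
  unfolding seminorm_sum_def sum.distrib[symmetric]
  by (intro sum_mono) (auto intro: schwartz_seminorm_add assms)

lemma seminorm_sum_cmult_le:
  assumes "f \<in> schwartz"
  shows "seminorm_sum K (\<lambda>x. c * f x) \<le> cmod c * seminorm_sum K f"
  unfolding seminorm_sum_def sum_distrib_left
  by (intro sum_mono) (auto intro: schwartz_seminorm_cmult_le assms)

lemma seminorm_sum_mono:
  assumes "finite K'" "K \<subseteq> K'" "f \<in> schwartz"
  shows "seminorm_sum K f \<le> seminorm_sum K' f"
  unfolding seminorm_sum_def using assms
  by (intro sum_mono2) (auto intro: schwartz_seminorm_nonneg)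

lemma schwartz_seminorm_le_sum:
  assumes "finite K" "(\<alpha>, is) \<in> K" "f \<in> schwartz"
  shows "schwartz_seminorm \<alpha> is f \<le> seminorm_sum K f"
  using seminorm_sum_mono[of K "{(\<alpha>, is)}" f] assms by (simp add: seminorm_sum_def)

subsection \<open>Topology\<close>

lemma topspace_schwartz [simp]: "topspace schwartz_topology = schwartz"
proof -
  have "f \<in> \<Union> {{g \<in> schwartz. schwartz_seminorm \<alpha> is (\<lambda>x. g x - f x) < e} |f \<alpha> is e. f \<in> schwartz \<and> e > 0}"
    if "f \<in> schwartz" for f :: "real^'a::finite \<Rightarrow> complex"
    using that by (intro UnionI[of "{g \<in> schwartz. schwartz_seminorm (\<lambda>_. 0) [] (\<lambda>x. g x - f x) < 1}"]) (simp_all, blast intro: zero_less_one)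
  then show ?thesis
    unfolding schwartz_topology_def topology_generated_by_topspace by auto
qed

text \<open>The subbasic sets constrain one seminorm at a time and are centred anywhere; this lemma and
  \<open>schwartz_open_contains_ball\<close> replace them by neighbourhoods that are balls of finite sums of seminorms
  around the point itself.\<close>

lemma openin_schwartz_ball:
  assumes "f \<in> schwartz" "finite K" "e > 0"
  shows "\<exists>W. openin schwartz_topology W \<and> f \<in> W \<and>
           W \<subseteq> {g \<in> schwartz. seminorm_sum K (\<lambda>x. g x - f x) < e}"
proof (cases "K = {}")
  case True
  then show ?thesis
    using assms openin_topspace[of schwartz_topology]
    by (intro exI[of _ schwartz]) (auto simp: seminorm_sum_def)
next
  case False
  define d where "d = e / card K"
  have d: "d > 0" using False assms by (simp add: d_def card_gt_0_iff)
  let ?B = "\<lambda>(\<alpha>, is). {g \<in> schwartz. schwartz_seminorm \<alpha> is (\<lambda>x. g x - f x) < d}"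
  have "openin schwartz_topology (\<Inter> (?B ` K))"
  proof (rule openin_Inter)
    fix X assume "X \<in> ?B ` K"
    then obtain \<alpha> "is" where "X = {g \<in> schwartz. schwartz_seminorm \<alpha> is (\<lambda>x. g x - f x) < d}" by auto
    then show "openin schwartz_topology X"
      unfolding schwartz_topology_def using assms(1) d
      by (intro topology_generated_by_Basis) blast
  qed (use False assms in auto)
  moreover have "f \<in> \<Inter> (?B ` K)" using d assms by auto
  moreover have "\<Inter> (?B ` K) \<subseteq> {g \<in> schwartz. seminorm_sum K (\<lambda>x. g x - f x) < e}"
  proof
    fix g assume g: "g \<in> \<Inter> (?B ` K)"
    have "seminorm_sum K (\<lambda>x. g x - f x) < (\<Sum>i\<in>K. d)"
      unfolding seminorm_sum_def by (rule sum_strict_mono) (use g False assms in auto)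
    also have "\<dots> = e" using False assms by (simp add: d_def)
    finally show "g \<in> {g \<in> schwartz. seminorm_sum K (\<lambda>x. g x - f x) < e}" using g False by auto
  qed
  ultimately show ?thesis by blast
qed

lemma schwartz_open_contains_ball:
  assumes "openin schwartz_topology W" "f \<in> W"
  shows "\<exists>K e. finite K \<and> e > 0 \<and> {g \<in> schwartz. seminorm_sum K (\<lambda>x. g x - f x) < e} \<subseteq> W"
proof -
  from assms(1) have "generate_topology_on
     {{g \<in> schwartz. schwartz_seminorm \<alpha> is (\<lambda>x. g x - f x) < e} | f \<alpha> is e. f \<in> schwartz \<and> e > 0} W"
    unfolding schwartz_topology_def by (rule openin_topology_generated_by)
  then show ?thesis using assms(2)
  proof (induction rule: generate_topology_on.induct)
    case Empty
    then show ?case by simp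
  next
    case (Int a b)
    then obtain K e K' e' where *: "finite K" "e > 0" "{g \<in> schwartz. seminorm_sum K (\<lambda>x. g x - f x) < e} \<subseteq> a"
      "finite K'" "e' > 0" "{g \<in> schwartz. seminorm_sum K' (\<lambda>x. g x - f x) < e'} \<subseteq> b" by blast
    have "f \<in> schwartz"
      using Int openin_subset[of schwartz_topology a]
      by (auto simp: schwartz_topology_def openin_topology_generated_by_iff[symmetric])
    have "g \<in> a \<inter> b" if "g \<in> schwartz" "seminorm_sum (K \<union> K') (\<lambda>x. g x - f x) < min e e'" for g
    proof -
      have "(\<lambda>x. g x - f x) \<in> schwartz" using that \<open>f \<in> schwartz\<close> by (simp add: schwartz_diff)
      from seminorm_sum_mono[of "K \<union> K'" K, OF _ _ this] seminorm_sum_mono[of "K \<union> K'" K', OF _ _ this]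
      have "seminorm_sum K (\<lambda>x. g x - f x) < e" "seminorm_sum K' (\<lambda>x. g x - f x) < e'"
        using that * by auto
      then show ?thesis using * that by blast
    qed
    then show ?case
      using * by (intro exI[of _ "K \<union> K'"] exI[of _ "min e e'"]) auto
  next
    case (UN KK)
    then show ?case by (meson Union_iff subset_trans Union_upper)
  next
    case (Basis s)
    then obtain h \<alpha> "is" e where s: "s = {g \<in> schwartz. schwartz_seminorm \<alpha> is (\<lambda>x. g x - h x) < e}"
      "h \<in> schwartz" "e > 0" by auto
    let ?d = "e - schwartz_seminorm \<alpha> is (\<lambda>x. f x - h x)"
    have f: "f \<in> schwartz" "?d > 0" using Basis s by auto
    have "g \<in> s" if "g \<in> schwartz" "seminorm_sum {(\<alpha>, is)} (\<lambda>x. g x - f x) < ?d" for g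
      using that schwartz_seminorm_add[OF schwartz_diff[OF that(1) f(1)] schwartz_diff[OF f(1) s(2)], of \<alpha> "is"]
      by (simp add: s(1) seminorm_sum_def)
    then show ?case using f by (intro exI[of _ "{(\<alpha>, is)}"] exI[of _ ?d]) auto
  qed
qed

lemma schwartz_continuous_map_into:
  assumes maps: "\<And>f. f \<in> schwartz \<Longrightarrow> L f \<in> schwartz"
    and add: "\<And>f g. f \<in> schwartz \<Longrightarrow> g \<in> schwartz \<Longrightarrow> L (\<lambda>x. f x - g x) = (\<lambda>x. L f x - L g x)"
    and bound: "\<And>\<alpha> is. \<exists>K C. finite K \<and> (\<forall>f\<in>schwartz. schwartz_seminorm \<alpha> is (L f) \<le> C * seminorm_sum K f)"
  shows "continuous_map schwartz_topology schwartz_topology L"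
proof -
  have "openin schwartz_topology (L -` U \<inter> schwartz)"
    if U: "U = {g \<in> schwartz. schwartz_seminorm \<alpha> is (\<lambda>x. g x - h x) < e}" and h: "h \<in> schwartz" "e > 0" for U h \<alpha> "is" e
  proof (subst openin_subopen, intro ballI)
    fix f assume f: "f \<in> L -` U \<inter> schwartz"
    obtain K C where K: "finite K" "\<And>f. f \<in> schwartz \<Longrightarrow> schwartz_seminorm \<alpha> is (L f) \<le> C * seminorm_sum K f"
      using bound[of \<alpha> "is"] by blast
    define d where "d = e - schwartz_seminorm \<alpha> is (\<lambda>x. L f x - h x)"
    have d: "d > 0" using f U by (auto simp: d_def)
    obtain W where W: "openin schwartz_topology W" "f \<in> W"
      "W \<subseteq> {g \<in> schwartz. seminorm_sum K (\<lambda>x. g x - f x) < d / (\<bar>C\<bar> + 1)}"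
      using openin_schwartz_ball[of f K "d / (\<bar>C\<bar> + 1)"] f d K by auto
    have "W \<subseteq> L -` U \<inter> schwartz"
    proof
      fix g assume "g \<in> W"
      with W have g: "g \<in> schwartz" "seminorm_sum K (\<lambda>x. g x - f x) < d / (\<bar>C\<bar> + 1)" by auto
      have gf: "(\<lambda>x. g x - f x) \<in> schwartz" using f g by (auto intro: schwartz_diff)
      have "schwartz_seminorm \<alpha> is (\<lambda>x. L g x - L f x) \<le> C * seminorm_sum K (\<lambda>x. g x - f x)"
        using K(2)[OF gf] f g add[of g f] by auto
      also have "\<dots> \<le> (\<bar>C\<bar> + 1) * seminorm_sum K (\<lambda>x. g x - f x)"
        using seminorm_sum_nonneg[OF gf] by (intro mult_right_mono) auto
      also have "\<dots> < d" using g(2) by (simp add: field_simps)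
      finally have "schwartz_seminorm \<alpha> is (\<lambda>x. L g x - L f x) < d" .
      with schwartz_seminorm_add[OF schwartz_diff[OF maps[OF g(1)] maps[of f]] schwartz_diff[OF maps[of f] h(1)], of \<alpha> "is"]
      have "schwartz_seminorm \<alpha> is (\<lambda>x. L g x - h x) < e" using f by (simp add: d_def)
      then show "g \<in> L -` U \<inter> schwartz" using g maps by (simp add: U)
    qed
    with W show "\<exists>T. openin schwartz_topology T \<and> f \<in> T \<and> T \<subseteq> L -` U \<inter> schwartz" by blast
  qed
  moreover have "L ` schwartz \<subseteq> topspace schwartz_topology" using maps by auto
  ultimately show ?thesis
    unfolding schwartz_topology_def continuous_on_generated_topo_iff
    unfolding topology_generated_by_topspace[symmetric] schwartz_topology_def[symmetric] topspace_schwartz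
    by auto
qed

text \<open>The usual scaling argument: a ball on which \<open>\<bar>T\<bar> < 1\<close> gives a bound by the seminorms that define it.\<close>

lemma tempered_bound:
  assumes "T \<in> tempered"
  shows "\<exists>K C. finite K \<and> C \<ge> 0 \<and> (\<forall>f\<in>schwartz. cmod (T f) \<le> C * seminorm_sum K f)"
proof -
  have cont: "continuous_map schwartz_topology euclidean T"
    and scal: "\<And>c f. f \<in> schwartz \<Longrightarrow> T (\<lambda>x. c * f x) = c * T f"
    using assms by (auto simp: tempered_def)
  have T0: "T (\<lambda>x. 0) = 0" using scal[OF schwartz_zero, of 0] by simp
  let ?W = "{f \<in> schwartz. T f \<in> ball 0 1}"
  have "openin schwartz_topology ?W"
    using openin_continuous_map_preimage[OF cont, of "ball 0 1"] by simp
  moreover have "(\<lambda>x. 0) \<in> ?W" using T0 schwartz_zero by simp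
  ultimately obtain K e where K: "finite K" "e > 0" "{g \<in> schwartz. seminorm_sum K (\<lambda>x. g x - 0) < e} \<subseteq> ?W"
    using schwartz_open_contains_ball by blast
  have "cmod (T f) \<le> (2 / e) * seminorm_sum K f" if f: "f \<in> schwartz" for f
  proof (rule field_le_epsilon)
    fix d :: real assume d: "d > 0"
    define m where "m = seminorm_sum K f + d * e / 2"
    have m: "m > 0" using seminorm_sum_nonneg[OF f, of K] d K by (simp add: m_def add_nonneg_pos)
    let ?c = "complex_of_real (e / (2 * m))"
    have "seminorm_sum K (\<lambda>x. ?c * f x) \<le> e / (2 * m) * seminorm_sum K f"
      using seminorm_sum_cmult_le[OF f, of K ?c] m K by (simp add: norm_mult norm_divide)
    also have "\<dots> \<le> e / (2 * m) * m" using m K d by (intro mult_left_mono) (auto simp: m_def)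
    also have "\<dots> < e" using m K by simp
    finally have "cmod (T (\<lambda>x. ?c * f x)) < 1"
      using K schwartz_cmult[OF f, of ?c] by auto
    then have "e / (2 * m) * cmod (T f) < 1"
      using scal[OF f, of ?c] m K by (simp add: norm_mult norm_divide)
    then have "cmod (T f) < 2 / e * m" using m K by (simp add: field_simps)
    also have "\<dots> = 2 / e * seminorm_sum K f + d" using K by (simp add: m_def field_simps)
    finally show "cmod (T f) \<le> 2 / e * seminorm_sum K f + d" by simp
  qed
  then show ?thesis using K by (intro exI[of _ K] exI[of _ "2/e"]) auto
qed

section \<open>Decay, Lipschitz bounds and integrability\<close>

lemma power_add_le:
  fixes a b :: real
  assumes "0 \<le> a" "0 \<le> b"
  shows "(a + b) ^ N \<le> 2 ^ N * (a ^ N + b ^ N)"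
proof -
  have "(a + b) ^ N \<le> (2 * max a b) ^ N" using assms by (intro power_mono) auto
  also have "\<dots> = 2 ^ N * max a b ^ N" by (simp add: power_mult_distrib)
  also have "max a b ^ N \<le> a ^ N + b ^ N" using assms by (auto simp: max_def)
  finally show ?thesis by simp
qed

lemma monomial_fun_le_norm_power: "\<bar>monomial_fun \<alpha> x\<bar> \<le> norm x ^ (\<Sum>i\<in>UNIV. \<alpha> i)"
proof -
  have "\<bar>monomial_fun \<alpha> x\<bar> = (\<Prod>i\<in>UNIV. \<bar>x $ i\<bar> ^ \<alpha> i)"
    by (simp add: monomial_fun_def abs_prod power_abs)
  also have "\<dots> \<le> (\<Prod>i\<in>UNIV. norm x ^ \<alpha> i)"
    by (intro prod_mono) (auto intro: power_mono component_le_norm_cart)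
  finally show ?thesis by (simp add: power_sum)
qed

lemma norm_power_le_sum_components:
  fixes x :: "real^'n::finite"
  shows "norm x ^ N \<le> real CARD('n) ^ N * (\<Sum>i\<in>UNIV. \<bar>x $ i\<bar> ^ N)"
proof -
  obtain i where i: "\<And>j. \<bar>x $ j\<bar> \<le> \<bar>x $ i\<bar>"
  proof -
    have "Max (range (\<lambda>j. \<bar>x $ j\<bar>)) \<in> range (\<lambda>j. \<bar>x $ j\<bar>)" by (rule Max_in) auto
    then obtain i where "Max (range (\<lambda>j. \<bar>x $ j\<bar>)) = \<bar>x $ i\<bar>" by (rule rangeE)
    then have "\<bar>x $ j\<bar> \<le> \<bar>x $ i\<bar>" for j
      using Max_ge[of "range (\<lambda>j. \<bar>x $ j\<bar>)" "\<bar>x $ j\<bar>"] by simp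
    then show ?thesis by (rule that)
  qed
  have "norm x \<le> (\<Sum>j\<in>UNIV. \<bar>x $ j\<bar>)" by (rule norm_le_l1_cart)
  also have "\<dots> \<le> (\<Sum>j\<in>(UNIV::'n set). \<bar>x $ i\<bar>)" by (intro sum_mono i)
  finally have "norm x ^ N \<le> (real CARD('n) * \<bar>x $ i\<bar>) ^ N" by (intro power_mono) auto
  also have "\<dots> = real CARD('n) ^ N * \<bar>x $ i\<bar> ^ N" by (simp add: power_mult_distrib)
  also have "\<dots> \<le> real CARD('n) ^ N * (\<Sum>i\<in>UNIV. \<bar>x $ i\<bar> ^ N)"
    by (intro mult_left_mono member_le_sum) auto
  finally show ?thesis .
qed

lemma monomial_fun_zero [simp]: "monomial_fun (\<lambda>_. 0) x = 1"
  by (simp add: monomial_fun_def)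

lemma monomial_fun_single: "monomial_fun (\<lambda>j. if j = i then N else 0) x = (x $ i) ^ N"
  by (simp add: monomial_fun_def if_distrib[of "power _"] cong: if_cong)

text \<open>Weights \<open>(1 + \<bar>x\<bar>)\<^sup>N\<close> are easier to combine than monomials; every such weight is controlled by
  finitely many of the defining seminorms.\<close>

lemma schwartz_norm_decay:
  fixes js :: "'n::finite list"
  shows "\<exists>K C. finite K \<and> C \<ge> 0 \<and>
    (\<forall>f\<in>schwartz. \<forall>x. (1 + norm x) ^ N * norm (iterated_partial js f x) \<le> C * seminorm_sum K f)"
proof -
  define A where "A = (\<lambda>i j::'n. if j = i then N else 0)"
  define K where "K = insert (\<lambda>_. 0, js) (range (\<lambda>i. (A i, js)))"
  define n where "n = real CARD('n)"
  have [simp]: "finite K" by (simp add: K_def)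
  have n: "n \<ge> 0" by (simp add: n_def)
  have "(1 + norm x) ^ N * norm (iterated_partial js f x) \<le> 2 ^ N * (1 + n ^ N * n) * seminorm_sum K f"
    if f: "f \<in> schwartz" for f and x :: "real^'n"
  proof -
    let ?y = "norm (iterated_partial js f x)" and ?S = "seminorm_sum K f"
    have 0: "?y \<le> ?S"
      using schwartz_seminorm_bound[OF f, of "\<lambda>_. 0" x js] schwartz_seminorm_le_sum[of K "\<lambda>_. 0" js f] f
      by (simp add: K_def)
    have 1: "\<bar>x $ i\<bar> ^ N * ?y \<le> ?S" for i
      using schwartz_seminorm_bound[OF f, of "A i" x js] schwartz_seminorm_le_sum[of K "A i" js f] f
      by (simp add: K_def A_def monomial_fun_single power_abs)
    have "(1 + norm x) ^ N * ?y \<le> 2 ^ N * (1 ^ N + norm x ^ N) * ?y"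
      by (intro mult_right_mono power_add_le) auto
    also have "\<dots> \<le> 2 ^ N * (1 + n ^ N * (\<Sum>i\<in>UNIV. \<bar>x $ i\<bar> ^ N)) * ?y"
      unfolding n_def by (intro mult_right_mono mult_left_mono add_mono norm_power_le_sum_components) auto
    also have "\<dots> = 2 ^ N * (?y + n ^ N * (\<Sum>i\<in>UNIV. \<bar>x $ i\<bar> ^ N * ?y))"
      by (simp add: algebra_simps sum_distrib_left)
    also have "\<dots> \<le> 2 ^ N * (?S + n ^ N * (\<Sum>i\<in>(UNIV::'n set). ?S))"
      using n by (intro mult_left_mono add_mono sum_mono 0 1) auto
    also have "\<dots> = 2 ^ N * (1 + n ^ N * n) * ?S" by (simp add: n_def algebra_simps)
    finally show ?thesis .
  qed
  then show ?thesis using n by (intro exI[of _ K] exI[of _ "2 ^ N * (1 + n ^ N * n)"]) auto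
qed

lemma schwartz_norm_decay':
  fixes f :: "real^'n::finite \<Rightarrow> complex"
  assumes "f \<in> schwartz"
  obtains B where "B \<ge> 0" "\<And>x. (1 + norm x) ^ N * norm (f x) \<le> B"
proof -
  obtain K C where "finite K" "C \<ge> 0"
    and *: "\<forall>f\<in>schwartz. \<forall>x::real^'n. (1 + norm x) ^ N * norm (iterated_partial [] f x) \<le> C * seminorm_sum K f"
    using schwartz_norm_decay[of N "[]"] by blast
  then show ?thesis
    using *[rule_format, OF assms] seminorm_sum_nonneg[OF assms, of K] by (intro that[of "C * seminorm_sum K f"]) auto
qed

definition gradient_bound :: "(real^'n::finite \<Rightarrow> complex) \<Rightarrow> real" where
  "gradient_bound f = (\<Sum>i\<in>UNIV. schwartz_seminorm (\<lambda>_. 0) [i] f)"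

lemma gradient_bound_nonneg: "f \<in> schwartz \<Longrightarrow> 0 \<le> gradient_bound f"
  unfolding gradient_bound_def by (intro sum_nonneg schwartz_seminorm_nonneg)

lemma schwartz_lipschitz:
  fixes x y :: "real^'n::finite"
  assumes f: "f \<in> schwartz"
  shows "norm (f x - f y) \<le> gradient_bound f * norm (x - y)"
proof (rule differentiable_bound[of UNIV f "\<lambda>x h. \<Sum>i\<in>UNIV. h $ i *\<^sub>R partial_derivative i f x"])
  show "(f has_derivative (\<lambda>h. \<Sum>i\<in>UNIV. h $ i *\<^sub>R partial_derivative i f x)) (at x within UNIV)" for x
    using has_derivative_partials[OF schwartz_differentiable'[OF f]] by simp
  show "onorm (\<lambda>h. \<Sum>i\<in>UNIV. h $ i *\<^sub>R partial_derivative i f x) \<le> gradient_bound f" for x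
  proof (rule onorm_bound)
    show "norm (\<Sum>i\<in>UNIV. h $ i *\<^sub>R partial_derivative i f x) \<le> gradient_bound f * norm h" for h
    proof -
      have "norm (\<Sum>i\<in>UNIV. h $ i *\<^sub>R partial_derivative i f x)
          \<le> (\<Sum>i\<in>UNIV. norm h * schwartz_seminorm (\<lambda>_. 0) [i] f)"
      proof (rule sum_norm_le)
        fix i :: 'n
        have "norm (partial_derivative i f x) \<le> schwartz_seminorm (\<lambda>_. 0) [i] f"
          using schwartz_seminorm_bound[OF f, of "\<lambda>_. 0" x "[i]"] by simp
        then show "norm (h $ i *\<^sub>R partial_derivative i f x) \<le> norm h * schwartz_seminorm (\<lambda>_. 0) [i] f"
          unfolding norm_scaleR using component_le_norm_cart[of h i] by (intro mult_mono) auto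
      qed
      then show ?thesis by (simp add: gradient_bound_def sum_distrib_left mult.commute)
    qed
  qed (rule gradient_bound_nonneg[OF f])
qed auto

lemma nn_integral_inverse_one_plus_square:
  "(\<integral>\<^sup>+x. ennreal (1 / (1 + x\<^sup>2)) \<partial>lborel) < \<infinity>" (is "?I < _")
proof -
  let ?f = "\<lambda>x::real. ennreal (1 / (1 + x\<^sup>2))"
  have half: "(\<integral>\<^sup>+x. ?f x * indicator {0..} x \<partial>lborel) = pi / 2 - arctan 0"
  proof (rule nn_integral_FTC_atLeast[OF _ _ _ tendsto_arctan_at_top])
    show "DERIV arctan x :> 1 / (1 + x\<^sup>2)" for x
      using DERIV_arctan[of x] by (simp add: divide_inverse)
  qed auto
  have "(\<integral>\<^sup>+x. ?f x * indicator {..0} x \<partial>lborel) = (\<integral>\<^sup>+x. ?f x * indicator {0..} x \<partial>lborel)"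
    using nn_integral_real_affine[of "\<lambda>x. ?f x * indicator {..0} x" "-1" 0]
    by (auto intro!: nn_integral_cong simp: indicator_def)
  moreover have "?I \<le> (\<integral>\<^sup>+x. ?f x * indicator {0..} x + ?f x * indicator {..0} x \<partial>lborel)"
    by (intro nn_integral_mono) (auto simp: indicator_def)
  moreover have "\<dots> = (\<integral>\<^sup>+x. ?f x * indicator {0..} x \<partial>lborel) + (\<integral>\<^sup>+x. ?f x * indicator {..0} x \<partial>lborel)"
    by (intro nn_integral_add) auto
  ultimately have "?I \<le> ennreal (pi / 2) + ennreal (pi / 2)" using half by simp
  then show ?thesis by (simp add: le_less_trans)
qed

text \<open>The function is dominated by \<open>\<Prod>\<^sub>b 1 / (1 + x\<^sub>b\<^sup>2)\<close>, whose integral is a product of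
  one-dimensional ones.  Its multiples are integrable majorants for all Schwartz functions.\<close>

lemma integrable_inverse_norm_power:
  "integrable lebesgue (\<lambda>x::real^'n::finite. 1 / (1 + norm x) ^ (2 * CARD('n)))"
proof -
  let ?g = "\<lambda>x::real^'n. \<Prod>b\<in>Basis. 1 / (1 + (x \<bullet> b)\<^sup>2)"
  have "(\<integral>\<^sup>+x. ennreal (?g x) \<partial>lborel) = (\<Prod>b\<in>(Basis :: (real^'n) set). \<integral>\<^sup>+x. ennreal (1 / (1 + x\<^sup>2)) \<partial>lborel)"
    using nn_integral_lborel_prod[of "\<lambda>(_::real^'n) x. 1 / (1 + x\<^sup>2)"]
    by (simp add: prod_ennreal)
  also have "\<dots> < \<infinity>"
    using nn_integral_inverse_one_plus_square
    by (simp add: power_less_top_ennreal)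
  finally have I: "integrable lborel ?g"
    by (intro integrableI_nonneg) (auto intro!: prod_nonneg AE_I2)
  have bound: "norm (1 / (1 + norm x) ^ (2 * CARD('n))) \<le> norm (?g x)" for x :: "real^'n"
  proof -
    have "(\<Prod>b\<in>Basis. 1 + (x \<bullet> b)\<^sup>2) \<le> (\<Prod>b\<in>(Basis::(real^'n) set). (1 + norm x)\<^sup>2)"
    proof (intro prod_mono conjI)
      fix b :: "real^'n" assume "b \<in> Basis"
      then have "(x \<bullet> b)\<^sup>2 \<le> (norm x)\<^sup>2"
        using Basis_le_norm[of b x] by (metis abs_le_square_iff abs_norm_cancel)
      then show "1 + (x \<bullet> b)\<^sup>2 \<le> (1 + norm x)\<^sup>2" by (simp add: power2_sum add_increasing2)
    qed auto
    also have "\<dots> = (1 + norm x) ^ (2 * CARD('n))" by (simp add: power_mult)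
    finally have "1 / (1 + norm x) ^ (2 * CARD('n)) \<le> 1 / (\<Prod>b\<in>Basis. 1 + (x \<bullet> b)\<^sup>2)"
      by (intro divide_left_mono) (auto intro!: mult_pos_pos prod_pos simp: add_pos_nonneg)
    then show ?thesis
      by (simp add: prod_dividef prod_nonneg)
  qed
  have "(\<lambda>x::real^'n. 1 / (1 + norm x) ^ (2 * CARD('n))) \<in> borel_measurable lborel" by simp
  then have "integrable lborel (\<lambda>x::real^'n. 1 / (1 + norm x) ^ (2 * CARD('n)))"
    by (rule Bochner_Integration.integrable_bound[OF I]) (rule AE_I2, rule bound)
  then show ?thesis by (simp add: integrable_completion)
qed

lemma schwartz_measurable [measurable_dest]: "f \<in> schwartz \<Longrightarrow> f \<in> borel_measurable borel"
  by (rule borel_measurable_continuous_onI[OF schwartz_continuous_on])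

lemma schwartz_measurable_lebesgue: "f \<in> schwartz \<Longrightarrow> f \<in> borel_measurable lebesgue"
  using schwartz_measurable[of f] by (simp add: measurable_completion)

lemma schwartz_integrable_norm_power:
  fixes f :: "real^'n::finite \<Rightarrow> complex"
  assumes f: "f \<in> schwartz"
  shows "integrable lebesgue (\<lambda>x. norm x ^ N * norm (f x))"
proof -
  obtain B where B: "\<And>x. (1 + norm x) ^ (N + 2 * CARD('n)) * norm (f x) \<le> B"
    using schwartz_norm_decay'[OF f] by blast
  have "integrable lebesgue (\<lambda>x::real^'n. B * (1 / (1 + norm x) ^ (2 * CARD('n))))"
    by (intro integrable_mult_right integrable_inverse_norm_power)
  then show ?thesis
  proof (rule Bochner_Integration.integrable_bound)
    show "(\<lambda>x. norm x ^ N * norm (f x)) \<in> borel_measurable lebesgue"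
      using schwartz_measurable_lebesgue[OF f] measurable_completion[of norm lborel borel]
      by (intro borel_measurable_times borel_measurable_power borel_measurable_norm) simp_all
    show "AE x in lebesgue. norm (norm x ^ N * norm (f x)) \<le> norm (B * (1 / (1 + norm x) ^ (2 * CARD('n))))"
    proof (rule AE_I2)
      fix x :: "real^'n"
      have "norm x ^ N * norm (f x) * (1 + norm x) ^ (2 * CARD('n))
          \<le> (1 + norm x) ^ N * norm (f x) * (1 + norm x) ^ (2 * CARD('n))"
        by (intro mult_right_mono power_mono) auto
      also have "\<dots> \<le> B" using B[of x] by (simp add: power_add mult_ac)
      finally have "norm x ^ N * norm (f x) \<le> B * (1 / (1 + norm x) ^ (2 * CARD('n)))"
        by (simp add: field_simps add_pos_nonneg)
      then show "norm (norm x ^ N * norm (f x)) \<le> norm (B * (1 / (1 + norm x) ^ (2 * CARD('n))))"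
        by (smt (verit) norm_ge_zero real_norm_def zero_le_mult_iff zero_le_power)
    qed
  qed
qed

lemma schwartz_integrable: "f \<in> schwartz \<Longrightarrow> integrable lebesgue f"
  using schwartz_integrable_norm_power[of f 0] schwartz_measurable_lebesgue[of f]
  by (simp add: integrable_norm_iff)

lemma schwartz_bounded:
  assumes "f \<in> schwartz"
  obtains B where "B \<ge> 0" "\<And>x. norm (f x) \<le> B"
  using schwartz_norm_decay'[OF assms, of 0] by auto

lemma schwartz_L2: "f \<in> schwartz \<Longrightarrow> f \<in> L2_funs"
proof -
  assume f: "f \<in> schwartz"
  obtain B where B: "B \<ge> 0" "\<And>x. norm (f x) \<le> B" using schwartz_bounded[OF f] by blast
  have "integrable lebesgue (\<lambda>x. B * norm (f x))"
    using schwartz_integrable[OF f] by (intro integrable_mult_right integrable_norm)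
  then have "integrable lebesgue (\<lambda>x. (cmod (f x))\<^sup>2)"
    by (rule Bochner_Integration.integrable_bound)
       (use schwartz_measurable_lebesgue[OF f] B in \<open>auto simp: power2_eq_square mult_right_mono\<close>)
  then show ?thesis
    using schwartz_measurable_lebesgue[OF f] by (simp add: L2_funs_def)
qed

lemma schwartz_integrable_mult:
  assumes "f \<in> schwartz" "g \<in> schwartz"
  shows "integrable lebesgue (\<lambda>x. f x * g x)"
proof -
  obtain B where B: "B \<ge> 0" "\<And>x. norm (g x) \<le> B" using schwartz_bounded[OF assms(2)] by blast
  have "integrable lebesgue (\<lambda>x. B * norm (f x))"
    using schwartz_integrable[OF assms(1)] by (intro integrable_mult_right integrable_norm)
  then show ?thesis
    by (rule Bochner_Integration.integrable_bound)
       (use schwartz_measurable_lebesgue[OF assms(1)] schwartz_measurable_lebesgue[OF assms(2)] B in \<open>auto simp: norm_mult mult.commute[of B] mult_left_mono\<close>)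
qed

section \<open>Averaged substitution operators\<close>

lemmas real_polynomial_function_intros = real_polynomial_function.intros(2-4)
  real_polynomial_function_diff real_polynomial_function_power real_polynomial_function_sum

lemma real_polynomial_function_partial:
  fixes p :: "real \<times> (real^'n::finite) \<Rightarrow> real"
  assumes "real_polynomial_function p"
  shows "\<exists>p'. (\<forall>i. real_polynomial_function (p' i)) \<and>
    (\<forall>s x. ((\<lambda>x. p (s, x)) has_derivative (\<lambda>h. \<Sum>i\<in>UNIV. h $ i * p' i (s, x))) (at x))"
  using assms
proof (induction rule: real_polynomial_function.induct)
  case (linear f)
  interpret f: bounded_linear f by (rule linear)
  have "((\<lambda>x. f (s, x)) has_derivative (\<lambda>h. \<Sum>i\<in>UNIV. h $ i * f (0, axis i 1))) (at x)" for s and x :: "real^'n"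
  proof -
    have "f (0, h) = (\<Sum>i\<in>UNIV. h $ i * f (0, axis i 1))" for h
    proof -
      have "(0::real, h) = (\<Sum>i\<in>UNIV. h $ i *\<^sub>R (0, axis i 1))"
        using basis_expansion[of h]
        by (simp add: scalar_mult_eq_scaleR prod_eq_iff fst_sum snd_sum)
      then have "f (0, h) = f (\<Sum>i\<in>UNIV. h $ i *\<^sub>R (0, axis i 1))" by (rule arg_cong)
      then show ?thesis by (simp add: f.sum f.scaleR del: scaleR_Pair)
    qed
    then have eq: "(\<lambda>h. f (0, h)) = (\<lambda>h. \<Sum>i\<in>UNIV. h $ i * f (0, axis i 1))" by (rule ext)
    have "((\<lambda>x. f (s, x)) has_derivative (\<lambda>h. f (0, h))) (at x)"
      by (intro f.has_derivative has_derivative_Pair has_derivative_const has_derivative_ident)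
    then show ?thesis by (rule has_derivative_eq_rhs[OF _ eq])
  qed
  then show ?case by (intro exI[of _ "\<lambda>i _. f (0, axis i 1)"]) auto
next
  case (const c)
  show ?case by (intro exI[of _ "\<lambda>_ _. 0"]) auto
next
  case (add f g)
  then obtain f' g' where
    "\<forall>i. real_polynomial_function (f' i)" "\<forall>i. real_polynomial_function (g' i)"
    "\<And>s x. ((\<lambda>x. f (s, x)) has_derivative (\<lambda>h. \<Sum>i\<in>UNIV. h $ i * f' i (s, x))) (at x)"
    "\<And>s x. ((\<lambda>x. g (s, x)) has_derivative (\<lambda>h. \<Sum>i\<in>UNIV. h $ i * g' i (s, x))) (at x)" by blast
  then show ?case
    by (intro exI[of _ "\<lambda>i z. f' i z + g' i z"])
       (auto intro!: derivative_eq_intros simp: sum.distrib algebra_simps)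
next
  case (mult f g)
  then obtain f' g' where *:
    "\<forall>i. real_polynomial_function (f' i)" "\<forall>i. real_polynomial_function (g' i)"
    "\<And>s x. ((\<lambda>x. f (s, x)) has_derivative (\<lambda>h. \<Sum>i\<in>UNIV. h $ i * f' i (s, x))) (at x)"
    "\<And>s x. ((\<lambda>x. g (s, x)) has_derivative (\<lambda>h. \<Sum>i\<in>UNIV. h $ i * g' i (s, x))) (at x)" by blast
  have "((\<lambda>x. f (s, x) * g (s, x)) has_derivative
      (\<lambda>h. \<Sum>i\<in>UNIV. h $ i * (f (s, x) * g' i (s, x) + f' i (s, x) * g (s, x)))) (at x)" for s x
    using has_derivative_mult[OF *(3,4)]
    by (rule has_derivative_eq_rhs) (simp add: fun_eq_iff sum_distrib_left sum_distrib_right sum.distrib algebra_simps)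
  with *(1,2) mult(1,2) show ?case
    by (intro exI[of _ "\<lambda>i z. f z * g' i z + f' i z * g z"] conjI allI real_polynomial_function_intros) auto
qed

lemma real_polynomial_function_growth:
  assumes "real_polynomial_function p"
  shows "\<exists>C N. C \<ge> 0 \<and> (\<forall>z. \<bar>p z\<bar> \<le> C * (1 + norm z) ^ N)"
  using assms
proof (induction rule: real_polynomial_function.induct)
  case (linear f)
  then obtain K where K: "K > 0" "\<And>x. norm (f x) \<le> norm x * K"
    using bounded_linear.pos_bounded by blast
  have "\<bar>f z\<bar> \<le> K * (1 + norm z) ^ 1" for z
    using K(1) K(2)[of z] by (simp add: algebra_simps)
  with K show ?case by (intro exI[of _ K] exI[of _ 1]) auto
next
  case (const c)
  show ?case by (intro exI[of _ "\<bar>c\<bar>"] exI[of _ 0]) auto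
next
  case (add f g)
  then obtain C N D M where *: "C \<ge> 0" "D \<ge> 0" "\<And>z. \<bar>f z\<bar> \<le> C * (1 + norm z) ^ N" "\<And>z. \<bar>g z\<bar> \<le> D * (1 + norm z) ^ M"
    by blast
  have "\<bar>f z + g z\<bar> \<le> (C + D) * (1 + norm z) ^ (N + M)" for z
  proof -
    have "\<bar>f z + g z\<bar> \<le> C * (1 + norm z) ^ N + D * (1 + norm z) ^ M"
      using *(3,4)[of z] by linarith
    also have "\<dots> \<le> C * (1 + norm z) ^ (N + M) + D * (1 + norm z) ^ (N + M)"
      using * by (intro add_mono mult_left_mono power_increasing) auto
    finally show ?thesis by (simp add: algebra_simps)
  qed
  with * show ?case by (intro exI[of _ "C + D"] exI[of _ "N + M"]) auto
next
  case (mult f g)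
  then obtain C N D M where *: "C \<ge> 0" "D \<ge> 0" "\<And>z. \<bar>f z\<bar> \<le> C * (1 + norm z) ^ N" "\<And>z. \<bar>g z\<bar> \<le> D * (1 + norm z) ^ M"
    by blast
  have "\<bar>f z * g z\<bar> \<le> (C * D) * (1 + norm z) ^ (N + M)" for z
  proof -
    have "\<bar>f z\<bar> * \<bar>g z\<bar> \<le> (C * (1 + norm z) ^ N) * (D * (1 + norm z) ^ M)"
      using * by (intro mult_mono) auto
    then show ?thesis by (simp add: abs_mult power_add mult_ac)
  qed
  with * show ?case by (intro exI[of _ "C * D"] exI[of _ "N + M"]) auto
qed

lemma real_polynomial_function_growth_parameter:
  fixes p :: "real \<times> (real^'n::finite) \<Rightarrow> real"
  assumes "real_polynomial_function p"
  shows "\<exists>C N. C \<ge> 0 \<and> (\<forall>s\<in>{0..1}. \<forall>x. \<bar>p (s, x)\<bar> \<le> C * (1 + norm x) ^ N)"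
proof -
  obtain C N where C: "C \<ge> 0" "\<And>z. \<bar>p z\<bar> \<le> C * (1 + norm z) ^ N"
    using real_polynomial_function_growth[OF assms] by blast
  have "\<bar>p (s, x)\<bar> \<le> (C * 2 ^ N) * (1 + norm x) ^ N" if "s \<in> {0..1}" for s x
  proof -
    have "norm (s, x) \<le> 1 + norm x"
      using norm_triangle_ineq[of "(s, 0)" "(0, x)"] that by (simp add: norm_Pair)
    then have "(1 + norm (s, x)) ^ N \<le> (2 * (1 + norm x)) ^ N"
      using norm_ge_zero[of x] norm_ge_zero[of "(s, x)"] by (intro power_mono) (simp_all del: norm_ge_zero)
    then have "C * (1 + norm (s, x)) ^ N \<le> C * (2 * (1 + norm x)) ^ N"
      using C(1) by (rule mult_left_mono)
    also have "\<dots> = (C * 2 ^ N) * (1 + norm x) ^ N" unfolding power_mult_distrib by simp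
    finally show ?thesis using C(2)[of "(s, x)"] by linarith
  qed
  with C show ?thesis by (intro exI[of _ "C * 2 ^ N"] exI[of _ N]) auto
qed

text \<open>The last condition says that \<open>x\<close> can only be large if the point \<open>A (s, x)\<close> at which the test
  function is read off is far away or if the Gaussian factor is small.\<close>

definition confining_substitution ::
  "(real \<times> (real^'n::finite) \<Rightarrow> real^'k::finite) \<Rightarrow> (real \<times> (real^'n) \<Rightarrow> real) \<Rightarrow> bool" where
  "confining_substitution A b \<longleftrightarrow>
     (\<forall>j. real_polynomial_function (\<lambda>z. A z $ j)) \<and> real_polynomial_function b \<and>
     (\<forall>s\<in>{0..1}. \<forall>x. 0 \<le> b (s, x) \<and> norm x \<le> norm (A (s, x)) + sqrt (b (s, x)))"

text \<open>The operators \<open>\<eta> \<mapsto> p \<cdot> e\<^sup>-\<^sup>b \<cdot> (\<partial>\<eta> \<circ> A)\<close> with polynomial \<open>p\<close>, and their sums.  The family is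
  closed under partial differentiation of the result, so that each estimate below has to be proved for
  the functions themselves only and not for their derivatives.\<close>

inductive substitution_op ::
  "(real \<times> (real^'n::finite) \<Rightarrow> real^'k::finite) \<Rightarrow> (real \<times> (real^'n) \<Rightarrow> real) \<Rightarrow>
   ((real^'k \<Rightarrow> complex) \<Rightarrow> real \<times> (real^'n) \<Rightarrow> complex) \<Rightarrow> bool"
  for A b where
  atom: "real_polynomial_function p \<Longrightarrow>
    substitution_op A b (\<lambda>\<eta> z. (p z * exp (- b z)) *\<^sub>R iterated_partial is \<eta> (A z))"
| add: "substitution_op A b L \<Longrightarrow> substitution_op A b L' \<Longrightarrow> substitution_op A b (\<lambda>\<eta> z. L \<eta> z + L' \<eta> z)"

lemma substitution_op_sum:
  assumes "finite J" "\<And>j. j \<in> J \<Longrightarrow> substitution_op A b (L j)"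
  shows "substitution_op A b (\<lambda>\<eta> z. \<Sum>j\<in>J. L j \<eta> z)"
  using assms
proof (induction J rule: finite_induct)
  case empty
  show ?case
    using substitution_op.atom[of "\<lambda>_. 0" A b "[]"] by (simp add: real_polynomial_function_intros)
qed (auto intro: substitution_op.add)

lemma confining_substitution_derivative:
  fixes A :: "real \<times> (real^'n::finite) \<Rightarrow> real^'k::finite"
  assumes "\<forall>j. real_polynomial_function (\<lambda>z. A z $ j)"
  shows "\<exists>a. (\<forall>i j. real_polynomial_function (a i j)) \<and>
    (\<forall>s x. ((\<lambda>x. A (s, x)) has_derivative (\<lambda>h. \<chi> j. \<Sum>i\<in>UNIV. h $ i * a i j (s, x))) (at x))"
proof -
  have "\<forall>j. \<exists>p'. (\<forall>i. real_polynomial_function (p' i)) \<and>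
    (\<forall>s x. ((\<lambda>x. A (s, x) $ j) has_derivative (\<lambda>h. \<Sum>i\<in>UNIV. h $ i * p' i (s, x))) (at x))"
    by (intro allI real_polynomial_function_partial) (use assms in auto)
  from choice[OF this] obtain a where "\<forall>j. (\<forall>i. real_polynomial_function (a j i)) \<and>
    (\<forall>s x. ((\<lambda>x. A (s, x) $ j) has_derivative (\<lambda>h. \<Sum>i\<in>UNIV. h $ i * a j i (s, x))) (at x))" ..
  then have a: "\<And>i j. real_polynomial_function (a j i)"
    "\<And>j s x. ((\<lambda>x. A (s, x) $ j) has_derivative (\<lambda>h. \<Sum>i\<in>UNIV. h $ i * a j i (s, x))) (at x)"
    by blast+
  have "((\<lambda>x. A (s, x)) has_derivative (\<lambda>h. \<chi> j. \<Sum>i\<in>UNIV. h $ i * a j i (s, x))) (at x)" for s x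
    using has_derivative_componentwise_within[of "\<lambda>x. A (s, x)" "\<lambda>h. \<chi> j. \<Sum>i\<in>UNIV. h $ i * a j i (s, x)" x UNIV] a(2)
    by (auto simp: Basis_vec_def inner_axis)
  with a(1) show ?thesis by (intro exI[of _ "\<lambda>i j. a j i"]) auto
qed

lemma substitution_op_derivative:
  fixes A :: "real \<times> (real^'n::finite) \<Rightarrow> real^'k::finite"
  assumes "substitution_op A b L" and conf: "confining_substitution A b"
  shows "\<exists>L'. (\<forall>i. substitution_op A b (L' i)) \<and>
    (\<forall>\<eta>\<in>schwartz. \<forall>s x. ((\<lambda>x. L \<eta> (s, x)) has_derivative (\<lambda>h. \<Sum>i\<in>UNIV. h $ i *\<^sub>R L' i \<eta> (s, x))) (at x))"
  using assms(1)
proof (induction rule: substitution_op.induct)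
  case (atom p "is")
  obtain p' where p': "\<And>i. real_polynomial_function (p' i)"
    "\<And>s x. ((\<lambda>x. p (s, x)) has_derivative (\<lambda>h. \<Sum>i\<in>UNIV. h $ i * p' i (s, x))) (at x)"
    using real_polynomial_function_partial[OF atom] by blast
  obtain b' where b': "\<And>i. real_polynomial_function (b' i)"
    "\<And>s x. ((\<lambda>x. b (s, x)) has_derivative (\<lambda>h. \<Sum>i\<in>UNIV. h $ i * b' i (s, x))) (at x)"
    using real_polynomial_function_partial[of b] conf unfolding confining_substitution_def by blast
  obtain a where a: "\<And>i j. real_polynomial_function (a i j)"
    "\<And>s x. ((\<lambda>x. A (s, x)) has_derivative (\<lambda>h. \<chi> j. \<Sum>i\<in>UNIV. h $ i * a i j (s, x))) (at x)"
    using confining_substitution_derivative[of A] conf unfolding confining_substitution_def by blast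
  define L' where "L' i \<eta> z = ((p' i z - p z * b' i z) * exp (- b z)) *\<^sub>R iterated_partial is \<eta> (A z)
      + (\<Sum>j\<in>UNIV. ((p z * a i j z) * exp (- b z)) *\<^sub>R iterated_partial (j # is) \<eta> (A z))" for i \<eta> z
  have "substitution_op A b (L' i)" for i
    unfolding L'_def[abs_def]
    by (intro substitution_op.add substitution_op_sum substitution_op.atom finite
        real_polynomial_function_intros p'(1) b'(1) a(1) atom)
  moreover have "((\<lambda>x. (p (s, x) * exp (- b (s, x))) *\<^sub>R iterated_partial is \<eta> (A (s, x))) has_derivative
      (\<lambda>h. \<Sum>i\<in>UNIV. h $ i *\<^sub>R L' i \<eta> (s, x))) (at x)" if "\<eta> \<in> schwartz" for \<eta> s x
  proof -
    let ?\<eta> = "iterated_partial is \<eta>" and ?e = "exp (- b (s, x))"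
    have "(?\<eta> has_derivative (\<lambda>h. \<Sum>j\<in>UNIV. h $ j *\<^sub>R partial_derivative j ?\<eta> (A (s, x)))) (at (A (s, x)))"
      by (intro has_derivative_partials schwartz_differentiable that)
    from has_derivative_compose[OF a(2) this]
    have 1: "((\<lambda>x. ?\<eta> (A (s, x))) has_derivative
       (\<lambda>h. \<Sum>j\<in>UNIV. (\<Sum>i\<in>UNIV. h $ i * a i j (s, x)) *\<^sub>R partial_derivative j ?\<eta> (A (s, x)))) (at x)"
      by simp
    have 2: "((\<lambda>x. p (s, x) * exp (- b (s, x))) has_derivative
       (\<lambda>h. p (s, x) * (?e * - (\<Sum>i\<in>UNIV. h $ i * b' i (s, x))) + (\<Sum>i\<in>UNIV. h $ i * p' i (s, x)) * ?e)) (at x)"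
      by (rule has_derivative_mult[OF p'(2)]) (auto intro!: derivative_eq_intros b'(2))
    show ?thesis
    proof (rule has_derivative_eq_rhs[OF has_derivative_scaleR[OF 2 1]], rule ext)
      fix h :: "real^'n"
      let ?q = "\<lambda>j. partial_derivative j ?\<eta> (A (s, x))"
      have "(\<Sum>j\<in>UNIV. (\<Sum>i\<in>UNIV. h $ i * a i j (s, x)) *\<^sub>R ?q j)
          = (\<Sum>i\<in>UNIV. h $ i *\<^sub>R (\<Sum>j\<in>UNIV. a i j (s, x) *\<^sub>R ?q j))"
        unfolding scaleR_sum_left scaleR_sum_right by (subst sum.swap) simp
      moreover have "p (s, x) * (?e * - (\<Sum>i\<in>UNIV. h $ i * b' i (s, x))) + (\<Sum>i\<in>UNIV. h $ i * p' i (s, x)) * ?e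
          = (\<Sum>i\<in>UNIV. h $ i * ((p' i (s, x) - p (s, x) * b' i (s, x)) * ?e))"
        by (simp add: sum_distrib_left sum_distrib_right sum_subtractf algebra_simps flip: sum.distrib sum_negf)
      ultimately show "(p (s, x) * ?e) *\<^sub>R (\<Sum>j\<in>UNIV. (\<Sum>i\<in>UNIV. h $ i * a i j (s, x)) *\<^sub>R ?q j) +
          (p (s, x) * (?e * - (\<Sum>i\<in>UNIV. h $ i * b' i (s, x))) + (\<Sum>i\<in>UNIV. h $ i * p' i (s, x)) * ?e) *\<^sub>R ?\<eta> (A (s, x))
          = (\<Sum>i\<in>UNIV. h $ i *\<^sub>R L' i \<eta> (s, x))"
        by (simp add: L'_def scaleR_sum_left scaleR_sum_right sum.distrib scaleR_add_right mult_ac)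
    qed
  qed
  ultimately show ?case by (intro exI[of _ L']) auto
next
  case (add L1 L2)
  then obtain L1' L2' where
    "\<And>i. substitution_op A b (L1' i)" "\<And>i. substitution_op A b (L2' i)"
    "\<And>\<eta> s x. \<eta> \<in> schwartz \<Longrightarrow> ((\<lambda>x. L1 \<eta> (s, x)) has_derivative (\<lambda>h. \<Sum>i\<in>UNIV. h $ i *\<^sub>R L1' i \<eta> (s, x))) (at x)"
    "\<And>\<eta> s x. \<eta> \<in> schwartz \<Longrightarrow> ((\<lambda>x. L2 \<eta> (s, x)) has_derivative (\<lambda>h. \<Sum>i\<in>UNIV. h $ i *\<^sub>R L2' i \<eta> (s, x))) (at x)"
    by blast
  then show ?case
    by (intro exI[of _ "\<lambda>i \<eta> z. L1' i \<eta> z + L2' i \<eta> z"])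
       (auto intro!: substitution_op.add derivative_eq_intros simp: scaleR_add_right sum.distrib)
qed

lemma substitution_op_diff:
  assumes "substitution_op A b L" "f \<in> schwartz" "g \<in> schwartz"
  shows "L (\<lambda>x. f x - g x) z = L f z - L g z"
  using assms(1)
proof (induction arbitrary: z rule: substitution_op.induct)
  case (atom p "is")
  have "(\<lambda>x. - g x) \<in> schwartz" using schwartz_cmult[OF assms(3), of "-1"] by simp
  with iterated_partial_add[OF assms(2) this, of "is"] iterated_partial_bounded_linear[OF assms(3), of uminus "is"]
  have "iterated_partial is (\<lambda>x. f x - g x) (A z) = iterated_partial is f (A z) - iterated_partial is g (A z)"
    by (simp add: bounded_linear_minus[OF bounded_linear_ident])
  then show ?case by (simp add: scaleR_diff_right)
qed simp

lemma continuous_on_real_polynomial_function: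
  "real_polynomial_function p \<Longrightarrow> continuous_on S p"
  using continuous_on_polymonial_function real_polynomial_function_eq by blast

lemma substitution_op_continuous:
  assumes "substitution_op A b L" "confining_substitution A b" "\<eta> \<in> schwartz"
  shows "continuous_on UNIV (L \<eta>)"
  using assms(1)
proof (induction rule: substitution_op.induct)
  case (atom p "is")
  have "continuous_on UNIV (\<lambda>z. \<chi> j. A z $ j)"
    using assms(2) by (intro continuous_on_vec_lambda continuous_on_real_polynomial_function)
       (auto simp: confining_substitution_def)
  then have "continuous_on UNIV A" by simp
  then have "continuous_on UNIV (\<lambda>z. iterated_partial is \<eta> (A z))"
    using continuous_on_compose2[OF schwartz_continuous_on[OF schwartz_iterated_partial[OF assms(3)], of UNIV]] by auto
  then show ?case
    using atom assms(2) unfolding confining_substitution_def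
    by (intro continuous_intros continuous_on_real_polynomial_function) auto
qed (auto intro: continuous_on_add)

lemma power_times_exp_bounded:
  shows "\<exists>D\<ge>0. \<forall>y\<ge>0::real. sqrt y ^ N * exp (- y) \<le> D"
proof -
  define M where "M = real (Suc N)"
  have M: "M \<ge> 1" by (simp add: M_def)
  have "sqrt y ^ N * exp (- y) \<le> M ^ N" if y: "y \<ge> 0" for y
  proof -
    have "sqrt y \<le> 1 + y"
      using y by (intro real_le_lsqrt) (auto simp: power2_eq_square algebra_simps)
    also have "\<dots> \<le> M * (1 + y / M)" using M y by (simp add: algebra_simps)
    finally have "sqrt y ^ N \<le> (M * (1 + y / M)) ^ N" using y by (intro power_mono) auto
    also have "\<dots> = M ^ N * (1 + y / M) ^ N" by (simp add: power_mult_distrib)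
    also have "\<dots> \<le> M ^ N * (1 + y / M) ^ Suc N"
      using M y by (intro mult_left_mono power_increasing) auto
    also have "\<dots> \<le> M ^ N * exp (y / M) ^ Suc N"
      using M y by (intro mult_left_mono power_mono) (auto simp: exp_ge_add_one_self)
    also have "exp (y / M) ^ Suc N = exp (M * (y / M))"
      unfolding M_def by (rule exp_of_nat_mult[symmetric])
    also have "\<dots> = exp y" using M by simp
    finally show ?thesis by (simp add: exp_minus field_simps)
  qed
  then show ?thesis using M by (intro exI[of _ "M ^ N"]) auto
qed


text \<open>On the one hand \<open>\<bar>x\<bar>\<^sup>N\<close> is at most a multiple of \<open>\<bar>A\<bar>\<^sup>N + b\<^bsup>N/2\<^esup>\<close> by confinement, on the other
  hand \<open>\<eta>\<close> absorbs powers of \<open>A\<close> and \<open>e\<^sup>-\<^sup>b\<close> absorbs powers of \<open>b\<close>.\<close>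

lemma substitution_op_decay:
  fixes A :: "real \<times> (real^'n::finite) \<Rightarrow> real^'k::finite"
  assumes "substitution_op A b L" and conf: "confining_substitution A b"
  shows "\<exists>K C. finite K \<and> C \<ge> 0 \<and>
    (\<forall>\<eta>\<in>schwartz. \<forall>s\<in>{0..1}. \<forall>x. norm x ^ N * norm (L \<eta> (s, x)) \<le> C * seminorm_sum K \<eta>)"
  using assms(1)
proof (induction rule: substitution_op.induct)
  case (atom p "is")
  obtain C1 M where C1: "C1 \<ge> 0" "\<And>s x. s \<in> {0..1} \<Longrightarrow> \<bar>p (s, x)\<bar> \<le> C1 * (1 + norm x) ^ M"
    using real_polynomial_function_growth_parameter[OF atom] by blast
  define m where "m = N + M"
  obtain D where D: "D \<ge> 0" "\<And>y. y \<ge> 0 \<Longrightarrow> sqrt y ^ m * exp (- y) \<le> D"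
    using power_times_exp_bounded[of m] by blast
  obtain K C2 where K: "finite K" "C2 \<ge> 0"
    "\<forall>\<eta>\<in>schwartz. \<forall>y::real^'k. (1 + norm y) ^ m * norm (iterated_partial is \<eta> y) \<le> C2 * seminorm_sum K \<eta>"
    using schwartz_norm_decay[of m "is"] by blast
  have "norm x ^ N * norm ((p (s, x) * exp (- b (s, x))) *\<^sub>R iterated_partial is \<eta> (A (s, x)))
      \<le> (C1 * (2 ^ m * ((1 + D) * C2))) * seminorm_sum K \<eta>" if \<eta>: "\<eta> \<in> schwartz" and s: "s \<in> {0..1}" for \<eta> s x
  proof -
    let ?b = "b (s, x)" and ?A = "A (s, x)"
    let ?v = "norm (iterated_partial is \<eta> ?A)"
    have b: "?b \<ge> 0" "norm x \<le> norm ?A + sqrt ?b"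
      using conf s by (auto simp: confining_substitution_def)
    have "norm x ^ N * \<bar>p (s, x)\<bar> \<le> (1 + norm x) ^ N * (C1 * (1 + norm x) ^ M)"
      using C1 s by (intro mult_mono power_mono) auto
    also have "\<dots> = C1 * (1 + norm x) ^ m" by (simp add: m_def power_add)
    also have "\<dots> \<le> C1 * ((1 + norm ?A) + sqrt ?b) ^ m"
      using b C1 by (intro mult_left_mono power_mono) auto
    also have "\<dots> \<le> C1 * (2 ^ m * ((1 + norm ?A) ^ m + sqrt ?b ^ m))"
      using b C1 by (intro mult_left_mono power_add_le) auto
    finally have 1: "norm x ^ N * \<bar>p (s, x)\<bar> \<le> C1 * (2 ^ m * ((1 + norm ?A) ^ m + sqrt ?b ^ m))" .
    have "((1 + norm ?A) ^ m + sqrt ?b ^ m) * exp (- ?b) \<le> (1 + norm ?A) ^ m * 1 + D"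
      unfolding distrib_right using b D(2)[OF b(1)] by (intro add_mono mult_left_mono) auto
    also have "\<dots> \<le> (1 + D) * (1 + norm ?A) ^ m"
    proof -
      have "1 \<le> (1 + norm ?A) ^ m" by (intro one_le_power) auto
      from mult_left_mono[OF this D(1)] show ?thesis by (simp add: algebra_simps)
    qed
    finally have 2: "((1 + norm ?A) ^ m + sqrt ?b ^ m) * exp (- ?b) \<le> (1 + D) * (1 + norm ?A) ^ m" .
    have 3: "(1 + norm ?A) ^ m * ?v \<le> C2 * seminorm_sum K \<eta>"
      using K(3) \<eta> by blast
    have "norm x ^ N * norm ((p (s, x) * exp (- ?b)) *\<^sub>R iterated_partial is \<eta> ?A)
        = (norm x ^ N * \<bar>p (s, x)\<bar>) * (exp (- ?b) * ?v)" by (simp add: abs_mult mult_ac)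
    also have "\<dots> \<le> (C1 * (2 ^ m * ((1 + norm ?A) ^ m + sqrt ?b ^ m))) * (exp (- ?b) * ?v)"
      by (intro mult_right_mono 1) auto
    also have "\<dots> = C1 * (2 ^ m * ((((1 + norm ?A) ^ m + sqrt ?b ^ m) * exp (- ?b)) * ?v))"
      by (simp add: mult_ac)
    also have "\<dots> \<le> C1 * (2 ^ m * (((1 + D) * (1 + norm ?A) ^ m) * ?v))"
      using C1 by (intro mult_left_mono mult_right_mono 2) auto
    also have "\<dots> = C1 * (2 ^ m * ((1 + D) * ((1 + norm ?A) ^ m * ?v)))" by (simp add: mult_ac)
    also have "\<dots> \<le> C1 * (2 ^ m * ((1 + D) * (C2 * seminorm_sum K \<eta>)))"
      using C1 D by (intro mult_left_mono 3) auto
    finally show ?thesis by (simp add: mult_ac)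
  qed
  then show ?case
    using C1 D K by (intro exI[of _ K] exI[of _ "C1 * (2 ^ m * ((1 + D) * C2))"]) auto
next
  case (add L1 L2)
  then obtain K1 C1 K2 C2 where *: "finite K1" "finite K2" "C1 \<ge> 0" "C2 \<ge> 0"
    "\<forall>\<eta>\<in>schwartz. \<forall>s\<in>{0..1}. \<forall>x. norm x ^ N * norm (L1 \<eta> (s, x)) \<le> C1 * seminorm_sum K1 \<eta>"
    "\<forall>\<eta>\<in>schwartz. \<forall>s\<in>{0..1}. \<forall>x. norm x ^ N * norm (L2 \<eta> (s, x)) \<le> C2 * seminorm_sum K2 \<eta>"
    by blast
  have "norm x ^ N * norm (L1 \<eta> (s, x) + L2 \<eta> (s, x)) \<le> (C1 + C2) * seminorm_sum (K1 \<union> K2) \<eta>"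
    if "\<eta> \<in> schwartz" "s \<in> {0..1}" for \<eta> s x
  proof -
    have "norm x ^ N * norm (L1 \<eta> (s, x) + L2 \<eta> (s, x))
        \<le> norm x ^ N * norm (L1 \<eta> (s, x)) + norm x ^ N * norm (L2 \<eta> (s, x))"
      by (simp add: norm_triangle_ineq mult_left_mono flip: distrib_left)
    also have "\<dots> \<le> C1 * seminorm_sum K1 \<eta> + C2 * seminorm_sum K2 \<eta>"
      using *(5,6) that by (intro add_mono) auto
    also have "\<dots> \<le> C1 * seminorm_sum (K1 \<union> K2) \<eta> + C2 * seminorm_sum (K1 \<union> K2) \<eta>"
      using * that by (intro add_mono mult_left_mono seminorm_sum_mono) auto
    finally show ?thesis by (simp add: algebra_simps)
  qed
  with * show ?case by (intro exI[of _ "K1 \<union> K2"] exI[of _ "C1 + C2"]) auto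
qed

text \<open>For operators that do not depend on \<open>s\<close> this is a plain substitution operator; the average over \<open>s\<close>
  is what the remainder term of Taylor's formula requires.\<close>

definition parameter_average :: "((real^'k::finite \<Rightarrow> complex) \<Rightarrow> real \<times> (real^'n::finite) \<Rightarrow> complex) \<Rightarrow>
    (real^'k \<Rightarrow> complex) \<Rightarrow> real^'n \<Rightarrow> complex" where
  "parameter_average L \<eta> x = integral {0..1} (\<lambda>s. L \<eta> (s, x))"

lemma parameter_average_const:
  "(\<And>s. s \<in> {0..1} \<Longrightarrow> L \<eta> (s, x) = c) \<Longrightarrow> parameter_average L \<eta> x = c"
  unfolding parameter_average_def
  by (subst integral_cong[of _ _ "\<lambda>_. c"]) auto

lemma substitution_op_integrable:
  assumes "substitution_op A b L" "confining_substitution A b" "\<eta> \<in> schwartz"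
  shows "(\<lambda>s. L \<eta> (s, x)) integrable_on {0..1}"
  by (intro integrable_continuous_interval continuous_on_compose2[OF substitution_op_continuous[OF assms]]
      continuous_intros) auto

lemma parameter_average_derivative:
  fixes A :: "real \<times> (real^'n::finite) \<Rightarrow> real^'k::finite"
  assumes op: "substitution_op A b L" and conf: "confining_substitution A b"
  shows "\<exists>L'. (\<forall>i. substitution_op A b (L' i)) \<and>
    (\<forall>\<eta>\<in>schwartz. \<forall>x. (parameter_average L \<eta> has_derivative
       (\<lambda>h. \<Sum>i\<in>UNIV. h $ i *\<^sub>R parameter_average (L' i) \<eta> x)) (at x))"
proof -
  obtain L' where L': "\<And>i. substitution_op A b (L' i)"
    "\<And>\<eta> s x. \<eta> \<in> schwartz \<Longrightarrow> ((\<lambda>x. L \<eta> (s, x)) has_derivative (\<lambda>h. \<Sum>i\<in>UNIV. h $ i *\<^sub>R L' i \<eta> (s, x))) (at x)"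
    using substitution_op_derivative[OF op conf] by blast
  have "(parameter_average L \<eta> has_derivative (\<lambda>h. \<Sum>i\<in>UNIV. h $ i *\<^sub>R parameter_average (L' i) \<eta> x)) (at x)"
    if \<eta>: "\<eta> \<in> schwartz" for \<eta> x
  proof -
    define D :: "real^'n \<Rightarrow> real \<Rightarrow> (real^'n) \<Rightarrow>\<^sub>L complex" where "D x s = (\<Sum>i\<in>UNIV. blinfun_scaleR_left (L' i \<eta> (s, x)) o\<^sub>L blinfun_inner_left (axis i 1))" for x s
    have D: "blinfun_apply (D x s) = (\<lambda>h. \<Sum>i\<in>UNIV. h $ i *\<^sub>R L' i \<eta> (s, x))" for x s
      by (simp add: D_def fun_eq_iff blinfun.sum_left inner_axis)
    have cont: "continuous_on (UNIV \<times> cbox 0 1) (\<lambda>(x, s). D x s)"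
      unfolding D_def split_def
      by (intro continuous_intros bounded_linear.continuous_on[OF bounded_linear_blinfun_scaleR_left]
          continuous_on_compose2[OF substitution_op_continuous[OF L'(1) conf \<eta>]]) auto
    have "((\<lambda>x. integral (cbox 0 1) (\<lambda>s. L \<eta> (s, x))) has_derivative blinfun_apply (integral (cbox 0 1) (D x))) (at x within UNIV)"
    proof (rule leibniz_rule[OF _ _ cont])
      show "((\<lambda>x. L \<eta> (s, x)) has_derivative blinfun_apply (D x s)) (at x within UNIV)" for x s
        unfolding D using L'(2)[OF \<eta>] by simp
      show "(\<lambda>s. L \<eta> (s, x)) integrable_on cbox 0 1" for x
        using substitution_op_integrable[OF op conf \<eta>] by simp
    qed auto
    moreover have "blinfun_apply (integral (cbox 0 1) (D x)) h = (\<Sum>i\<in>UNIV. h $ i *\<^sub>R parameter_average (L' i) \<eta> x)" for h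
    proof -
      have "D x integrable_on cbox 0 1"
        using continuous_on_compose2[OF cont continuous_on_Pair[OF continuous_on_const continuous_on_id], of x "cbox 0 1"]
        by (intro integrable_continuous) auto
      then have "blinfun_apply (integral (cbox 0 1) (D x)) h = integral (cbox 0 1) (\<lambda>s. blinfun_apply (D x s) h)"
        by (rule blinfun_apply_integral)
      also have "\<dots> = integral {0..1} (\<lambda>s. \<Sum>i\<in>UNIV. h $ i *\<^sub>R L' i \<eta> (s, x))" by (simp add: D)
      also have "\<dots> = (\<Sum>i\<in>UNIV. integral {0..1} (\<lambda>s. h $ i *\<^sub>R L' i \<eta> (s, x)))"
        by (rule integral_sum) (auto intro!: integrable_cmul substitution_op_integrable[OF L'(1) conf \<eta>])
      finally show ?thesis by (simp add: parameter_average_def)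
    qed
    ultimately show ?thesis
      by (auto simp: parameter_average_def[abs_def] fun_eq_iff elim!: has_derivative_eq_rhs)
  qed
  with L'(1) show ?thesis by blast
qed

lemma parameter_average_iterated_partial:
  fixes A :: "real \<times> (real^'n::finite) \<Rightarrow> real^'k::finite"
  assumes op: "substitution_op A b L" and conf: "confining_substitution A b"
  shows "\<exists>L'. substitution_op A b L' \<and>
    (\<forall>\<eta>\<in>schwartz. iterated_partial is (parameter_average L \<eta>) = parameter_average L' \<eta>)"
proof (induction "is")
  case Nil
  then show ?case using op by auto
next
  case (Cons i "is")
  then obtain L1 where L1: "substitution_op A b L1"
    "\<forall>\<eta>\<in>schwartz. iterated_partial is (parameter_average L \<eta>) = parameter_average L1 \<eta>" by blast
  obtain L' where L': "\<And>i. substitution_op A b (L' i)"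
    "\<And>\<eta> x. \<eta> \<in> schwartz \<Longrightarrow> (parameter_average L1 \<eta> has_derivative
       (\<lambda>h. \<Sum>i\<in>UNIV. h $ i *\<^sub>R parameter_average (L' i) \<eta> x)) (at x)"
    using parameter_average_derivative[OF L1(1) conf] by blast
  have "partial_derivative i (parameter_average L1 \<eta>) = parameter_average (L' i) \<eta>" if "\<eta> \<in> schwartz" for \<eta>
    using partial_derivative_eqI[OF L'(2)[OF that]]
    by (simp add: fun_eq_iff axis_def if_distrib[of "\<lambda>c. c *\<^sub>R _"] cong: if_cong)
  with L' L1 show ?case by (intro exI[of _ "L' i"]) auto
qed

text \<open>The operators needed below are all of this kind: pull-backs along isometries, multiplication by
  linear forms, extension from a subspace by a Gaussian, and the remainder integrals of Hadamard type.\<close>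

theorem parameter_average_schwartz:
  fixes A :: "real \<times> (real^'n::finite) \<Rightarrow> real^'k::finite"
  assumes op: "substitution_op A b L" and conf: "confining_substitution A b"
  shows "\<eta> \<in> schwartz \<Longrightarrow> parameter_average L \<eta> \<in> schwartz"
    and "continuous_map schwartz_topology schwartz_topology (parameter_average L)"
proof -
  have bound: "\<exists>K C. finite K \<and> C \<ge> 0 \<and> (\<forall>\<eta>\<in>schwartz. \<forall>x.
      \<bar>monomial_fun \<alpha> x\<bar> * norm (iterated_partial is (parameter_average L \<eta>) x) \<le> C * seminorm_sum K \<eta>)" for \<alpha> "is"
  proof -
    obtain L' where L': "substitution_op A b L'"
      "\<And>\<eta>. \<eta> \<in> schwartz \<Longrightarrow> iterated_partial is (parameter_average L \<eta>) = parameter_average L' \<eta>"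
      using parameter_average_iterated_partial[OF op conf] by blast
    define N where "N = (\<Sum>i\<in>UNIV. \<alpha> i)"
    obtain K C where K: "finite K" "C \<ge> 0"
      "\<forall>\<eta>\<in>schwartz. \<forall>s\<in>{0..1}. \<forall>x. norm x ^ N * norm (L' \<eta> (s, x)) \<le> C * seminorm_sum K \<eta>"
      using substitution_op_decay[OF L'(1) conf] by blast
    have "\<bar>monomial_fun \<alpha> x\<bar> * norm (parameter_average L' \<eta> x) \<le> C * seminorm_sum K \<eta>"
      if \<eta>: "\<eta> \<in> schwartz" for \<eta> x
    proof -
      have "norm (integral {0..1} (\<lambda>s. norm x ^ N *\<^sub>R L' \<eta> (s, x))) \<le> (C * seminorm_sum K \<eta>) * (1 - 0)"
      proof (rule integral_bound)
        show "continuous_on {0..1} (\<lambda>s. norm x ^ N *\<^sub>R L' \<eta> (s, x))"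
          by (intro continuous_on_compose2[OF substitution_op_continuous[OF L'(1) conf \<eta>]] continuous_intros) auto
        show "norm (norm x ^ N *\<^sub>R L' \<eta> (s, x)) \<le> C * seminorm_sum K \<eta>" if "s \<in> {0..1}" for s
          using K(3) \<eta> that by (auto simp: abs_mult)
      qed auto
      then have "norm x ^ N * norm (parameter_average L' \<eta> x) \<le> C * seminorm_sum K \<eta>"
        by (simp add: parameter_average_def)
      moreover have "\<bar>monomial_fun \<alpha> x\<bar> * norm (parameter_average L' \<eta> x) \<le> norm x ^ N * norm (parameter_average L' \<eta> x)"
        unfolding N_def by (intro mult_right_mono monomial_fun_le_norm_power) auto
      ultimately show ?thesis by linarith
    qed
    with K L' show ?thesis by (intro exI[of _ K] exI[of _ C]) auto
  qed
  have mem: "parameter_average L \<eta> \<in> schwartz" if "\<eta> \<in> schwartz" for \<eta>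
  proof -
    have "iterated_partial is (parameter_average L \<eta>) differentiable (at x)" for "is" x
    proof -
      obtain L' where L': "substitution_op A b L'"
        "\<And>\<eta>. \<eta> \<in> schwartz \<Longrightarrow> iterated_partial is (parameter_average L \<eta>) = parameter_average L' \<eta>"
        using parameter_average_iterated_partial[OF op conf] by blast
      with parameter_average_derivative[OF L'(1) conf] that show ?thesis
        unfolding differentiable_def L'(2)[OF that] by blast
    qed
    moreover have "bounded (range (\<lambda>x. monomial_fun \<alpha> x *\<^sub>R iterated_partial is (parameter_average L \<eta>) x))" for \<alpha> "is"
    proof -
      obtain K C where "\<forall>\<eta>\<in>schwartz. \<forall>x.
        \<bar>monomial_fun \<alpha> x\<bar> * norm (iterated_partial is (parameter_average L \<eta>) x) \<le> C * seminorm_sum K \<eta>"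
        using bound[of \<alpha> "is"] by blast
      with that show ?thesis by (auto simp: bounded_iff)
    qed
    ultimately show ?thesis by (simp add: schwartz_def)
  qed
  show "\<eta> \<in> schwartz \<Longrightarrow> parameter_average L \<eta> \<in> schwartz" by (rule mem)
  show "continuous_map schwartz_topology schwartz_topology (parameter_average L)"
  proof (rule schwartz_continuous_map_into[OF mem])
    show "parameter_average L (\<lambda>x. f x - g x) = (\<lambda>x. parameter_average L f x - parameter_average L g x)"
      if "f \<in> schwartz" "g \<in> schwartz" for f g
      using substitution_op_integrable[OF op conf that(1)] substitution_op_integrable[OF op conf that(2)]
      by (simp add: fun_eq_iff parameter_average_def substitution_op_diff[OF op that] integral_diff)
    show "\<exists>K C. finite K \<and> (\<forall>f\<in>schwartz. schwartz_seminorm \<alpha> is (parameter_average L f) \<le> C * seminorm_sum K f)" for \<alpha> "is"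
    proof -
      obtain K C where "finite K" "\<forall>\<eta>\<in>schwartz. \<forall>x.
        \<bar>monomial_fun \<alpha> x\<bar> * norm (iterated_partial is (parameter_average L \<eta>) x) \<le> C * seminorm_sum K \<eta>"
        using bound[of \<alpha> "is"] by blast
      then show ?thesis by (intro exI[of _ K] exI[of _ C]) (auto intro: schwartz_seminorm_leI)
    qed
  qed
qed

section \<open>Distributions annihilated by coordinates\<close>

lemma bounded_linear_snd_component: "bounded_linear (\<lambda>z::real \<times> (real^'n::finite). snd z $ j)"
  using bounded_linear_compose[OF bounded_linear_vec_nth bounded_linear_snd] .

lemma real_polynomial_function_coordinates:
  "real_polynomial_function (\<lambda>z::real \<times> (real^'n::finite). snd z $ j)"
  "real_polynomial_function (\<lambda>z::real \<times> (real^'n::finite). fst z)"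
  "real_polynomial_function (\<lambda>z::real \<times> (real^'n::finite). u \<bullet> snd z)"
  by (auto intro!: real_polynomial_function.intros(1) bounded_linear_snd_component bounded_linear_fst
      bounded_linear_compose[OF bounded_linear_inner_right bounded_linear_snd])

lemma schwartz_pullback_isometry:
  fixes V :: "real^'k::finite \<Rightarrow> real^'n::finite"
  assumes "linear V" "\<And>y. norm (V y) = norm y"
  shows "\<phi> \<in> schwartz \<Longrightarrow> (\<lambda>y. \<phi> (V y)) \<in> schwartz"
    and "continuous_map schwartz_topology schwartz_topology (\<lambda>\<phi> y. \<phi> (V y))"
proof -
  let ?A = "\<lambda>z::real \<times> (real^'k). V (snd z)" and ?b = "\<lambda>z::real \<times> (real^'k). 0::real"
  have "bounded_linear (\<lambda>z. ?A z $ j)" for j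
    using bounded_linear_compose[OF bounded_linear_vec_nth
        bounded_linear_compose[OF linear_conv_bounded_linear[THEN iffD1, OF assms(1)] bounded_linear_snd]] .
  then have conf: "confining_substitution ?A ?b"
    unfolding confining_substitution_def
    by (auto simp: assms(2) intro: real_polynomial_function_intros real_polynomial_function.intros(1))
  have op: "substitution_op ?A ?b (\<lambda>\<eta> z. (1 * exp (- ?b z)) *\<^sub>R iterated_partial [] \<eta> (?A z))"
    by (intro substitution_op.atom real_polynomial_function_intros)
  have eq: "parameter_average (\<lambda>\<eta> z. (1 * exp (- ?b z)) *\<^sub>R iterated_partial [] \<eta> (?A z)) = (\<lambda>\<phi> y. \<phi> (V y))"
    by (intro ext parameter_average_const) simp
  from parameter_average_schwartz[OF op conf, unfolded eq]
  show "\<phi> \<in> schwartz \<Longrightarrow> (\<lambda>y. \<phi> (V y)) \<in> schwartz"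
    and "continuous_map schwartz_topology schwartz_topology (\<lambda>\<phi> y. \<phi> (V y))" by auto
qed

lemma schwartz_mult_inner:
  fixes u :: "real^'n::finite"
  shows "\<phi> \<in> schwartz \<Longrightarrow> (\<lambda>x. (u \<bullet> x) *\<^sub>R \<phi> x) \<in> schwartz"
    and "continuous_map schwartz_topology schwartz_topology (\<lambda>\<phi> x. (u \<bullet> x) *\<^sub>R \<phi> x)"
proof -
  let ?A = "\<lambda>z::real \<times> (real^'n). snd z" and ?b = "\<lambda>z::real \<times> (real^'n). 0::real"
  have conf: "confining_substitution ?A ?b"
    unfolding confining_substitution_def
    by (auto intro: real_polynomial_function_intros real_polynomial_function_coordinates)
  have op: "substitution_op ?A ?b (\<lambda>\<eta> z. ((u \<bullet> snd z) * exp (- ?b z)) *\<^sub>R iterated_partial [] \<eta> (?A z))"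
    by (intro substitution_op.atom real_polynomial_function_coordinates)
  have eq: "parameter_average (\<lambda>\<eta> z. ((u \<bullet> snd z) * exp (- ?b z)) *\<^sub>R iterated_partial [] \<eta> (?A z))
      = (\<lambda>\<phi> x. (u \<bullet> x) *\<^sub>R \<phi> x)"
    by (intro ext parameter_average_const) simp
  from parameter_average_schwartz[OF op conf, unfolded eq]
  show "\<phi> \<in> schwartz \<Longrightarrow> (\<lambda>x. (u \<bullet> x) *\<^sub>R \<phi> x) \<in> schwartz"
    and "continuous_map schwartz_topology schwartz_topology (\<lambda>\<phi> x. (u \<bullet> x) *\<^sub>R \<phi> x)" by auto
qed

lemma schwartz_mult_component: "\<phi> \<in> schwartz \<Longrightarrow> (\<lambda>x. x $ i *\<^sub>R \<phi> x) \<in> schwartz"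
  using schwartz_mult_inner(1)[of \<phi> "axis i 1"] by (simp add: inner_axis')

lemma embed_coords_nth:
  assumes "inj \<iota>"
  shows "embed_coords \<iota> y $ \<iota> i = y $ i" and "j \<notin> range \<iota> \<Longrightarrow> embed_coords \<iota> y $ j = 0"
  using assms by (auto simp: embed_coords_def)

lemma linear_embed_coords: "linear (embed_coords \<iota>)"
  by (rule linearI) (auto simp: embed_coords_def vec_eq_iff)

lemma sum_split_range:
  fixes \<iota> :: "'k::finite \<Rightarrow> 'n::finite" and f :: "'n \<Rightarrow> 'a::comm_monoid_add"
  assumes "inj \<iota>"
  shows "(\<Sum>j\<in>UNIV. f j) = (\<Sum>i\<in>UNIV. f (\<iota> i)) + (\<Sum>j\<in>- range \<iota>. f j)"
proof -
  have "(\<Sum>j\<in>UNIV. f j) = (\<Sum>j\<in>range \<iota>. f j) + (\<Sum>j\<in>- range \<iota>. f j)"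
    by (subst sum.union_disjoint[symmetric]) auto
  also have "(\<Sum>j\<in>range \<iota>. f j) = (\<Sum>i\<in>UNIV. f (\<iota> i))"
    using assms by (simp add: sum.reindex)
  finally show ?thesis .
qed

lemma norm_square_vec: "(norm (x::real^'n::finite))\<^sup>2 = (\<Sum>j\<in>UNIV. (x $ j)\<^sup>2)"
  by (simp add: norm_vec_def L2_set_def sum_nonneg)

lemma norm_embed_coords:
  assumes "inj \<iota>" shows "norm (embed_coords \<iota> y) = norm y"
proof -
  have "(norm (embed_coords \<iota> y))\<^sup>2 = (norm y)\<^sup>2"
    unfolding norm_square_vec sum_split_range[OF assms] by (simp add: embed_coords_nth[OF assms])
  then show ?thesis by simp
qed

definition gaussian_extension :: "('k::finite \<Rightarrow> 'n::finite) \<Rightarrow> (real^'k \<Rightarrow> complex) \<Rightarrow> real^'n \<Rightarrow> complex" where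
  "gaussian_extension \<iota> \<eta> x = exp (- (\<Sum>j\<in>- range \<iota>. (x $ j)\<^sup>2)) *\<^sub>R \<eta> (\<chi> i. x $ \<iota> i)"

lemma gaussian_extension_schwartz:
  fixes \<iota> :: "'k::finite \<Rightarrow> 'n::finite"
  assumes "inj \<iota>"
  shows "\<eta> \<in> schwartz \<Longrightarrow> gaussian_extension \<iota> \<eta> \<in> schwartz"
    and "continuous_map schwartz_topology schwartz_topology (gaussian_extension \<iota>)"
proof -
  let ?A = "\<lambda>z::real \<times> (real^'n). \<chi> i. snd z $ \<iota> i"
    and ?b = "\<lambda>z::real \<times> (real^'n). \<Sum>j\<in>- range \<iota>. (snd z $ j)\<^sup>2"
  have "norm x \<le> norm (?A (s, x)) + sqrt (?b (s, x))" for s x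
  proof (rule power2_le_imp_le)
    have b: "?b (s, x) \<ge> 0" by (simp add: sum_nonneg)
    have "(norm x)\<^sup>2 = (norm (?A (s, x)))\<^sup>2 + (sqrt (?b (s, x)))\<^sup>2"
      using b unfolding norm_square_vec sum_split_range[OF assms, of "\<lambda>j. (x $ j)\<^sup>2"] by simp
    also have "\<dots> \<le> (norm (?A (s, x)) + sqrt (?b (s, x)))\<^sup>2"
      using b by (simp add: power2_sum)
    finally show "(norm x)\<^sup>2 \<le> \<dots>" .
  qed (simp add: sum_nonneg)
  then have conf: "confining_substitution ?A ?b"
    unfolding confining_substitution_def
    by (auto intro!: real_polynomial_function_intros real_polynomial_function_coordinates sum_nonneg)
  have op: "substitution_op ?A ?b (\<lambda>\<eta> z. (1 * exp (- ?b z)) *\<^sub>R iterated_partial [] \<eta> (?A z))"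
    by (intro substitution_op.atom real_polynomial_function_intros)
  have eq: "parameter_average (\<lambda>\<eta> z. (1 * exp (- ?b z)) *\<^sub>R iterated_partial [] \<eta> (?A z)) = gaussian_extension \<iota>"
    by (intro ext parameter_average_const) (simp add: gaussian_extension_def)
  from parameter_average_schwartz[OF op conf, unfolded eq]
  show "\<eta> \<in> schwartz \<Longrightarrow> gaussian_extension \<iota> \<eta> \<in> schwartz"
    and "continuous_map schwartz_topology schwartz_topology (gaussian_extension \<iota>)" by auto
qed

text \<open>A Hadamard-type division with remainder: the path
  \<open>F\<^sub>s(x) = e\<^bsup>-s\<bar>x''\<bar>\<^sup>2\<^esup> \<phi>(x', (1-s) x'')\<close> joins \<open>\<phi>\<close> to the Gaussian extension of its restriction to
  \<open>x'' = 0\<close>, and every term of \<open>\<partial>\<^sub>s F\<^sub>s\<close> carries one of the coordinates \<open>x''\<^sub>j\<close> as a factor.  The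
  Gaussian takes over the decay in \<open>x''\<close> which the argument \<open>(1-s) x''\<close> loses as \<open>s \<rightarrow> 1\<close>, which is
  why the quotients are Schwartz functions.\<close>

lemma schwartz_hadamard:
  fixes \<iota> :: "'k::finite \<Rightarrow> 'n::finite"
  assumes inj: "inj \<iota>" and \<phi>: "\<phi> \<in> schwartz"
  obtains \<psi> where "\<And>j. \<psi> j \<in> schwartz"
    "\<And>x. \<phi> x - gaussian_extension \<iota> (\<lambda>y. \<phi> (embed_coords \<iota> y)) x = (\<Sum>j\<in>- range \<iota>. x $ j *\<^sub>R \<psi> j x)"
proof -
  define J where "J = - range \<iota>"
  define c where "c j s = (if j \<in> J then 1 - s else 1::real)" for j s
  define A where "A z = (\<chi> j. c j (fst z) * snd z $ j)" for z :: "real \<times> (real^'n)"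
  define B where "B x = (\<Sum>j\<in>J. (x $ j)\<^sup>2)" for x :: "real^'n"
  define b where "b z = fst z * B (snd z)" for z :: "real \<times> (real^'n)"
  have B: "B x \<ge> 0" for x by (simp add: B_def sum_nonneg)
  have confine: "norm x \<le> norm (A (s, x)) + sqrt (b (s, x))" if s: "s \<in> {0..1}" for s x
  proof -
    have "norm (x - A (s, x)) \<le> sqrt (b (s, x))"
    proof (rule real_le_rsqrt)
      have "(norm (x - A (s, x)))\<^sup>2 = (\<Sum>j\<in>UNIV. if j \<in> J then s\<^sup>2 * (x $ j)\<^sup>2 else 0)"
        unfolding norm_square_vec by (intro sum.cong) (auto simp: A_def c_def algebra_simps power2_eq_square)
      also have "\<dots> = s\<^sup>2 * B x"
        by (simp add: B_def sum_distrib_left flip: sum.inter_filter)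
      also have "\<dots> \<le> s * B x"
        using s B[of x] by (intro mult_right_mono) (auto simp: power2_eq_square mult_left_le)
      finally show "(norm (x - A (s, x)))\<^sup>2 \<le> b (s, x)" by (simp add: b_def)
    qed
    moreover have "norm x \<le> norm (A (s, x)) + norm (x - A (s, x))"
      using norm_triangle_ineq[of "A (s, x)" "x - A (s, x)"] by simp
    ultimately show ?thesis by linarith
  qed
  have polyA: "real_polynomial_function (\<lambda>z. A z $ j)" for j
    by (cases "j \<in> J")
       (auto simp: A_def c_def intro!: real_polynomial_function_intros real_polynomial_function_coordinates)
  have polyb: "real_polynomial_function b"
    unfolding b_def[abs_def] B_def
    by (intro real_polynomial_function_intros real_polynomial_function_coordinates) simp
  have conf: "confining_substitution A b"
    using confine polyA polyb B by (auto simp: confining_substitution_def b_def)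
  define L where "L j \<eta> z = (snd z $ j * exp (- b z)) *\<^sub>R iterated_partial [] \<eta> (A z)
      + (1 * exp (- b z)) *\<^sub>R iterated_partial [j] \<eta> (A z)" for j \<eta> z
  have op: "substitution_op A b (L j)" for j
    unfolding L_def[abs_def]
    by (intro substitution_op.add substitution_op.atom real_polynomial_function_coordinates real_polynomial_function_intros)
  have eq: "\<phi> x - gaussian_extension \<iota> (\<lambda>y. \<phi> (embed_coords \<iota> y)) x = (\<Sum>j\<in>J. x $ j *\<^sub>R parameter_average (L j) \<phi> x)" for x
  proof -
    define F where "F s = exp (- b (s, x)) *\<^sub>R \<phi> (A (s, x))" for s
    have F': "(F has_vector_derivative (- (\<Sum>j\<in>J. x $ j *\<^sub>R L j \<phi> (s, x)))) (at s within {0..1})" for s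
    proof -
      have dA: "((\<lambda>s. A (s, x)) has_derivative (\<lambda>h. \<chi> j. h * (if j \<in> J then - (x $ j) else 0))) (at s within {0..1})"
      proof -
        let ?v = "\<chi> j. if j \<in> J then - (x $ j) else 0"
        have "A (s, x) = x + s *\<^sub>R ?v" for s
          by (auto simp: A_def c_def vec_eq_iff algebra_simps)
        moreover have "((\<lambda>s. x + s *\<^sub>R ?v) has_derivative (\<lambda>h. h *\<^sub>R ?v)) (at s within {0..1})"
          by (auto intro!: derivative_eq_intros)
        moreover have "(\<lambda>h. h *\<^sub>R ?v) = (\<lambda>h. \<chi> j. h * (if j \<in> J then - (x $ j) else 0))"
          by (auto simp: vec_eq_iff)
        ultimately show ?thesis by simp
      qed
      have "(\<phi> has_derivative (\<lambda>h. \<Sum>j\<in>UNIV. h $ j *\<^sub>R partial_derivative j \<phi> (A (s, x)))) (at (A (s, x)))"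
        by (intro has_derivative_partials schwartz_differentiable' \<phi>)
      from has_derivative_compose[OF dA this]
      have d\<phi>: "((\<lambda>s. \<phi> (A (s, x))) has_derivative
         (\<lambda>h. \<Sum>j\<in>UNIV. (h * (if j \<in> J then - (x $ j) else 0)) *\<^sub>R partial_derivative j \<phi> (A (s, x)))) (at s within {0..1})"
        by simp
      have db: "((\<lambda>s. exp (- b (s, x))) has_derivative (\<lambda>h. exp (- b (s, x)) * - (h * B x))) (at s within {0..1})"
        unfolding b_def by (auto intro!: derivative_eq_intros)
      show ?thesis
        unfolding has_vector_derivative_def F_def
      proof (rule has_derivative_eq_rhs[OF has_derivative_scaleR[OF db d\<phi>]], rule ext)
        fix h
        let ?e = "exp (- b (s, x))" and ?\<phi> = "\<phi> (A (s, x))" and ?d = "\<lambda>j. partial_derivative j \<phi> (A (s, x))"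
        have 1: "(\<Sum>j\<in>UNIV. (h * (if j \<in> J then - (x $ j) else 0)) *\<^sub>R ?d j)
            = - (h *\<^sub>R (\<Sum>j\<in>J. x $ j *\<^sub>R ?d j))"
        proof -
          have "(\<Sum>j\<in>UNIV. (h * (if j \<in> J then - (x $ j) else 0)) *\<^sub>R ?d j)
              = (\<Sum>j\<in>UNIV. if j \<in> J then - (h *\<^sub>R x $ j *\<^sub>R ?d j) else 0)"
            by (intro sum.cong) auto
          then show ?thesis
            by (simp add: scaleR_sum_right sum_negf flip: sum.inter_filter)
        qed
        have 2: "(\<Sum>j\<in>J. x $ j *\<^sub>R L j \<phi> (s, x)) = (B x * ?e) *\<^sub>R ?\<phi> + ?e *\<^sub>R (\<Sum>j\<in>J. x $ j *\<^sub>R ?d j)"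
          by (simp add: L_def B_def scaleR_add_right sum.distrib scaleR_sum_right sum_distrib_right
              power2_eq_square mult.assoc flip: scaleR_sum_left) (simp add: mult_ac)
        show "?e *\<^sub>R (\<Sum>j\<in>UNIV. (h * (if j \<in> J then - (x $ j) else 0)) *\<^sub>R ?d j) + (?e * - (h * B x)) *\<^sub>R ?\<phi>
            = h *\<^sub>R - (\<Sum>j\<in>J. x $ j *\<^sub>R L j \<phi> (s, x))"
          unfolding 1 2 by (simp add: scaleR_add_right scaleR_diff_right mult_ac)
      qed
    qed
    have "((\<lambda>s. - (\<Sum>j\<in>J. x $ j *\<^sub>R L j \<phi> (s, x))) has_integral (F 1 - F 0)) {0..1}"
      by (rule fundamental_theorem_of_calculus) (auto intro: F')
    then have "integral {0..1} (\<lambda>s. - (\<Sum>j\<in>J. x $ j *\<^sub>R L j \<phi> (s, x))) = F 1 - F 0"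
      by (rule integral_unique)
    moreover have "integral {0..1} (\<lambda>s. - (\<Sum>j\<in>J. x $ j *\<^sub>R L j \<phi> (s, x)))
        = - (\<Sum>j\<in>J. x $ j *\<^sub>R parameter_average (L j) \<phi> x)"
      unfolding parameter_average_def
      using substitution_op_integrable[OF op conf \<phi>]
      by (simp add: integral_sum integrable_cmul)
    moreover have "F 0 = \<phi> x"
      by (simp add: F_def b_def A_def c_def vec_lambda_eta cong: if_cong)
    moreover have "A (1, x) = embed_coords \<iota> (\<chi> i. x $ \<iota> i)"
      by (auto simp: vec_eq_iff A_def c_def J_def embed_coords_nth[OF inj])
    then have "F 1 = gaussian_extension \<iota> (\<lambda>y. \<phi> (embed_coords \<iota> y)) x"
      by (simp add: F_def b_def gaussian_extension_def B_def J_def)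
    ultimately show ?thesis by (simp add: algebra_simps)
  qed
  show thesis
    by (rule that[of "\<lambda>j. parameter_average (L j) \<phi>"])
       (use parameter_average_schwartz(1)[OF op conf \<phi>] eq in \<open>auto simp: J_def\<close>)
qed

lemma tempered_add: "T \<in> tempered \<Longrightarrow> f \<in> schwartz \<Longrightarrow> g \<in> schwartz \<Longrightarrow> T (\<lambda>x. f x + g x) = T f + T g"
  and tempered_cmult: "T \<in> tempered \<Longrightarrow> f \<in> schwartz \<Longrightarrow> T (\<lambda>x. c * f x) = c * T f"
  and tempered_continuous: "T \<in> tempered \<Longrightarrow> continuous_map schwartz_topology euclidean T"
  and tempered_extensional: "T \<in> tempered \<Longrightarrow> T \<in> extensional schwartz"
  by (auto simp: tempered_def)

lemma tempered_zero: "T \<in> tempered \<Longrightarrow> T (\<lambda>x. 0) = 0"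
  using tempered_cmult[of T "\<lambda>x. 0" 0] schwartz_zero by simp

lemma tempered_sum:
  assumes "T \<in> tempered" "\<And>a. a \<in> A \<Longrightarrow> f a \<in> schwartz"
  shows "T (\<lambda>x. \<Sum>a\<in>A. f a x) = (\<Sum>a\<in>A. T (f a))"
  using assms(2)
  by (induction A rule: infinite_finite_induct)
     (auto simp: tempered_zero[OF assms(1)] tempered_add[OF assms(1)] schwartz_sum)

lemma tempered_diff:
  assumes "T \<in> tempered" "f \<in> schwartz" "g \<in> schwartz"
  shows "T (\<lambda>x. f x - g x) = T f - T g"
  using tempered_add[OF assms(1,2) schwartz_cmult[OF assms(3), of "-1"]] tempered_cmult[OF assms(1,3), of "-1"]
  by simp

lemma tempered_compose:
  assumes T: "T \<in> tempered"
    and maps: "\<And>\<eta>. \<eta> \<in> schwartz \<Longrightarrow> L \<eta> \<in> schwartz"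
    and cont: "continuous_map schwartz_topology schwartz_topology L"
    and add: "\<And>f g x. L (\<lambda>x. f x + g x) x = L f x + L g x"
    and cmult: "\<And>c f x. L (\<lambda>x. c * f x) x = c * L f x"
  shows "(\<lambda>\<eta>\<in>schwartz. T (L \<eta>)) \<in> tempered"
proof -
  have "L (\<lambda>x. f x + g x) = (\<lambda>x. L f x + L g x)" "L (\<lambda>x. c * f x) = (\<lambda>x. c * L f x)" for f g c
    using add cmult by auto
  moreover have "continuous_map schwartz_topology euclidean (\<lambda>\<eta>\<in>schwartz. T (L \<eta>))"
    using continuous_map_compose[OF cont tempered_continuous[OF T]]
    by (rule continuous_map_eq) simp
  ultimately show ?thesis
    using maps by (simp add: tempered_def schwartz_add schwartz_cmult tempered_add[OF T] tempered_cmult[OF T])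
qed

text \<open>By the division with remainder \<open>T\<close> does not distinguish \<open>\<phi>\<close> from the Gaussian extension of its
  restriction to the subspace; hence \<open>g \<eta> = T (gaussian_extension \<iota> \<eta>)\<close> works.\<close>

lemma tempered_annihilated_by_coordinates:
  fixes \<iota> :: "'k::finite \<Rightarrow> 'n::finite"
  assumes inj: "inj \<iota>" and T: "T \<in> tempered"
    and ann: "\<And>j \<psi>. j \<notin> range \<iota> \<Longrightarrow> \<psi> \<in> schwartz \<Longrightarrow> T (\<lambda>x. x $ j *\<^sub>R \<psi> x) = 0"
  obtains g where "g \<in> tempered" "T = tensor_delta \<iota> g"
proof -
  define g where "g = (\<lambda>\<eta>\<in>schwartz. T (gaussian_extension \<iota> \<eta>))"
  have "g \<in> tempered"
    unfolding g_def
    by (rule tempered_compose[OF T gaussian_extension_schwartz[OF inj]])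
       (auto simp: gaussian_extension_def scaleR_add_right)
  moreover have "T = tensor_delta \<iota> g"
  proof (rule extensionalityI[OF tempered_extensional[OF T]])
    fix \<phi> :: "real^'n \<Rightarrow> complex" assume \<phi>: "\<phi> \<in> schwartz"
    have res: "(\<lambda>y. \<phi> (embed_coords \<iota> y)) \<in> schwartz"
      by (rule schwartz_pullback_isometry(1)[OF linear_embed_coords norm_embed_coords[OF inj] \<phi>])
    let ?E = "gaussian_extension \<iota> (\<lambda>y. \<phi> (embed_coords \<iota> y))"
    have E: "?E \<in> schwartz" by (rule gaussian_extension_schwartz(1)[OF inj res])
    obtain \<psi> where \<psi>: "\<And>j. \<psi> j \<in> schwartz" "\<And>x. \<phi> x - ?E x = (\<Sum>j\<in>- range \<iota>. x $ j *\<^sub>R \<psi> j x)"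
      using schwartz_hadamard[OF inj \<phi>] by blast
    have "T \<phi> - T ?E = T (\<lambda>x. \<Sum>j\<in>- range \<iota>. x $ j *\<^sub>R \<psi> j x)"
      using tempered_diff[OF T \<phi> E] \<psi>(2) by simp
    also have "\<dots> = (\<Sum>j\<in>- range \<iota>. T (\<lambda>x. x $ j *\<^sub>R \<psi> j x))"
      by (rule tempered_sum[OF T]) (intro schwartz_mult_component \<psi>(1))
    also have "\<dots> = 0" using ann \<psi>(1) by simp
    finally show "T \<phi> = tensor_delta \<iota> g \<phi>"
      using \<phi> res by (simp add: tensor_delta_def g_def)
  qed (simp add: tensor_delta_def)
  ultimately show thesis by (rule that)
qed

lemma norm_orthogonal_matrix_vector_mult:
  fixes U :: "real^'n::finite^'n"
  assumes "transpose U ** U = mat 1"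
  shows "norm (U *v x) = norm x"
  using assms orthogonal_matrix orthogonal_transformation_matrix orthogonal_transformation_norm
  by (metis matrix_of_matrix_vector_mul matrix_vector_mul_linear)

text \<open>The rows of \<open>U\<close> outside \<open>range \<iota>\<close> span the normal directions; rotating by \<open>U\<close> turns them into
  coordinates.\<close>

theorem tempered_annihilated_by_rows:
  fixes \<iota> :: "'k::finite \<Rightarrow> 'n::finite" and U :: "real^'n^'n"
  assumes inj: "inj \<iota>" and T: "T \<in> tempered" and U: "transpose U ** U = mat 1"
    and ann: "\<And>j \<psi>. j \<notin> range \<iota> \<Longrightarrow> \<psi> \<in> schwartz \<Longrightarrow> T (\<lambda>x. ((U *v x) $ j) *\<^sub>R \<psi> x) = 0"
  shows "T \<in> low_dim_distribs \<iota>"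
proof -
  have U': "transpose (transpose U) ** transpose U = mat 1"
    using U by (simp add: matrix_left_right_inverse)
  note pull = schwartz_pullback_isometry[OF matrix_vector_mul_linear norm_orthogonal_matrix_vector_mult]
  define T' where "T' = (\<lambda>\<eta>\<in>schwartz. T (\<lambda>x. \<eta> (U *v x)))"
  have "T' \<in> tempered"
    unfolding T'_def by (rule tempered_compose[OF T pull(1)[OF U] pull(2)[OF U]]) auto
  moreover have "T' (\<lambda>x. x $ j *\<^sub>R \<psi> x) = 0" if "j \<notin> range \<iota>" "\<psi> \<in> schwartz" for j \<psi>
    using ann[OF that(1) pull(1)[OF U that(2)]] schwartz_mult_component[OF that(2)] by (simp add: T'_def)
  ultimately obtain g where g: "g \<in> tempered" "T' = tensor_delta \<iota> g"
    using tempered_annihilated_by_coordinates[OF inj] by blast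
  have "T = rotate_distrib U T'"
  proof (rule extensionalityI[OF tempered_extensional[OF T]])
    fix \<phi> :: "real^'n \<Rightarrow> complex" assume \<phi>: "\<phi> \<in> schwartz"
    have "transpose U *v (U *v x) = x" for x
      using U by (simp add: matrix_vector_mul_assoc)
    then show "T \<phi> = rotate_distrib U T' \<phi>"
      using \<phi> pull(1)[OF U' \<phi>] by (simp add: rotate_distrib_def T'_def)
  qed (simp add: rotate_distrib_def)
  with g U show ?thesis unfolding low_dim_distribs_def by blast
qed

section \<open>Approximation of tempered distributions by point masses\<close>

subsection \<open>Splitting off finitely many functionals\<close>

definition real_subspace :: "('a \<Rightarrow> complex) set \<Rightarrow> bool" where
  "real_subspace V \<longleftrightarrow> (\<forall>f\<in>V. \<forall>h\<in>V. (\<lambda>x. f x + h x) \<in> V) \<and> (\<forall>t::real. \<forall>f\<in>V. (\<lambda>x. t *\<^sub>R f x) \<in> V)"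

definition real_linear_on :: "('a \<Rightarrow> complex) set \<Rightarrow> (('a \<Rightarrow> complex) \<Rightarrow> real) \<Rightarrow> bool" where
  "real_linear_on V g \<longleftrightarrow> (\<forall>f\<in>V. \<forall>h\<in>V. g (\<lambda>x. f x + h x) = g f + g h) \<and>
     (\<forall>t. \<forall>f\<in>V. g (\<lambda>x. t *\<^sub>R f x) = t * g f)"

definition sublinear_on :: "('a \<Rightarrow> complex) set \<Rightarrow> (('a \<Rightarrow> complex) \<Rightarrow> real) \<Rightarrow> bool" where
  "sublinear_on V q \<longleftrightarrow> (\<forall>f\<in>V. \<forall>h\<in>V. q (\<lambda>x. f x + h x) \<le> q f + q h) \<and>
     (\<forall>t>0. \<forall>f\<in>V. q (\<lambda>x. t *\<^sub>R f x) \<le> t * q f)"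

text \<open>This is the extension step of the Hahn--Banach theorem, read dually: the admissible \<open>c\<close> are
  those between the values of \<open>g - q\<close> where \<open>l = 1\<close> and the values of \<open>q - g\<close> where \<open>l = -1\<close>, and
  the hypothesis on \<open>ker l\<close> separates these two sets of numbers.\<close>

lemma dominated_split_functional:
  assumes V: "real_subspace V" and g: "real_linear_on V g" and l: "real_linear_on V l" and q: "sublinear_on V q"
    and dom: "\<And>f. f \<in> V \<Longrightarrow> g f \<le> q f + C * \<bar>l f\<bar>"
  shows "\<exists>c. \<forall>f\<in>V. g f - c * l f \<le> q f"
proof (cases "\<exists>f\<in>V. l f \<noteq> 0")
  case False
  then show ?thesis using dom by (intro exI[of _ 0]) fastforce
next
  case True
  have scaled: "(\<lambda>x. t *\<^sub>R f x) \<in> V" "g (\<lambda>x. t *\<^sub>R f x) = t * g f" "l (\<lambda>x. t *\<^sub>R f x) = t * l f" if "f \<in> V" for t f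
    using V g l that by (auto simp: real_subspace_def real_linear_on_def)
  define lo where "lo = {g f - q f | f. f \<in> V \<and> l f = 1}"
  have sep: "g f - q f \<le> q h - g h" if f: "f \<in> V" "l f = 1" and h: "h \<in> V" "l h = -1" for f h
  proof -
    have "(\<lambda>x. f x + h x) \<in> V" "l (\<lambda>x. f x + h x) = 0" "g (\<lambda>x. f x + h x) = g f + g h"
      "q (\<lambda>x. f x + h x) \<le> q f + q h"
      using f h V g l q by (auto simp: real_subspace_def real_linear_on_def sublinear_on_def)
    with dom[of "\<lambda>x. f x + h x"] show ?thesis by simp
  qed
  obtain f0 where f0: "f0 \<in> V" "l f0 \<noteq> 0" using True by blast
  let ?f1 = "\<lambda>x. (1 / l f0) *\<^sub>R f0 x" and ?h1 = "\<lambda>x. (- 1 / l f0) *\<^sub>R f0 x"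
  have f1: "?f1 \<in> V" "l ?f1 = 1" and h1: "?h1 \<in> V" "l ?h1 = -1"
    using f0 scaled[OF f0(1), of "1 / l f0"] scaled[OF f0(1), of "- 1 / l f0"] by simp_all
  have ne: "lo \<noteq> {}" using f1 unfolding lo_def by blast
  have bdd: "bdd_above lo" using sep[OF _ _ h1] by (auto simp: lo_def intro!: bdd_aboveI)
  have "g f - Sup lo * l f \<le> q f" if f: "f \<in> V" for f
  proof (cases "l f = 0")
    case True
    then show ?thesis using dom[OF f] by simp
  next
    case False
    define t where "t = \<bar>l f\<bar>"
    have t: "t > 0" using False by (simp add: t_def)
    let ?h = "\<lambda>x. (1 / t) *\<^sub>R f x"
    have qh: "q ?h \<le> q f / t"
      using q f t unfolding sublinear_on_def by (metis divide_inverse inverse_eq_divide mult.commute zero_less_divide_1_iff)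
    have h: "?h \<in> V" "g ?h = g f / t" "l ?h = l f / t" using scaled[OF f, of "1/t"] by auto
    show ?thesis
    proof (cases "l f > 0")
      case True
      then have "l ?h = 1" using h(3) t by (simp add: t_def)
      then have "g ?h - q ?h \<in> lo" using h(1) unfolding lo_def by blast
      then have "g f / t - q f / t \<le> Sup lo" using cSup_upper[OF _ bdd] qh h by fastforce
      then show ?thesis using t True by (simp add: t_def field_simps)
    next
      case neg: False
      then have "l ?h = -1" using h t False by (simp add: t_def field_simps)
      then have "Sup lo \<le> q ?h - g ?h"
        using sep h(1) by (intro cSup_least[OF ne]) (auto simp: lo_def)
      then have "Sup lo \<le> q f / t - g f / t" using qh h by linarith
      then show ?thesis using t neg False by (simp add: t_def field_simps)
    qed
  qed
  then show ?thesis by blast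
qed

text \<open>The functionals are split off one at a time; those that remain count as part of the
  dominating sublinear functional.\<close>

lemma dominated_split_functionals:
  assumes V: "real_subspace V" and q: "sublinear_on V q" and C: "C \<ge> 0" and A: "finite A"
    and l: "\<And>a. a \<in> A \<Longrightarrow> real_linear_on V (l a)"
    and g: "real_linear_on V g"
    and dom: "\<And>f. f \<in> V \<Longrightarrow> g f \<le> q f + C * (\<Sum>a\<in>A. \<bar>l a f\<bar>)"
  shows "\<exists>c. \<forall>f\<in>V. g f - (\<Sum>a\<in>A. c a * l a f) \<le> q f"
  using A l g dom
proof (induction A arbitrary: g rule: finite_induct)
  case empty
  then show ?case by simp
next
  case (insert a A)
  let ?q = "\<lambda>f. q f + C * (\<Sum>a\<in>A. \<bar>l a f\<bar>)"
  have "sublinear_on V ?q"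
    unfolding sublinear_on_def
  proof (intro conjI ballI allI impI)
    fix f h assume fh: "f \<in> V" "h \<in> V"
    have "(\<Sum>a\<in>A. \<bar>l a (\<lambda>x. f x + h x)\<bar>) \<le> (\<Sum>a\<in>A. \<bar>l a f\<bar>) + (\<Sum>a\<in>A. \<bar>l a h\<bar>)"
      unfolding sum.distrib[symmetric] using fh insert.prems(1)
      by (intro sum_mono) (auto simp: real_linear_on_def)
    from mult_left_mono[OF this C]
    have "C * (\<Sum>a\<in>A. \<bar>l a (\<lambda>x. f x + h x)\<bar>) \<le> C * (\<Sum>a\<in>A. \<bar>l a f\<bar>) + C * (\<Sum>a\<in>A. \<bar>l a h\<bar>)"
      by (simp add: distrib_left)
    moreover have "q (\<lambda>x. f x + h x) \<le> q f + q h" using q fh unfolding sublinear_on_def by blast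
    ultimately show "?q (\<lambda>x. f x + h x) \<le> ?q f + ?q h" by linarith
  next
    fix t :: real and f assume t: "t > 0" and f: "f \<in> V"
    have "(\<Sum>a\<in>A. \<bar>l a (\<lambda>x. t *\<^sub>R f x)\<bar>) = t * (\<Sum>a\<in>A. \<bar>l a f\<bar>)"
      unfolding sum_distrib_left using f t insert.prems(1)
      by (intro sum.cong) (auto simp: real_linear_on_def abs_mult)
    moreover have "q (\<lambda>x. t *\<^sub>R f x) \<le> t * q f" using q t f unfolding sublinear_on_def by blast
    ultimately show "?q (\<lambda>x. t *\<^sub>R f x) \<le> t * ?q f" by (simp add: algebra_simps)
  qed
  moreover have "g f \<le> ?q f + C * \<bar>l a f\<bar>" if "f \<in> V" for f
    using insert.prems(3)[OF that] insert.hyps by (simp add: distrib_left)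
  ultimately obtain c where c: "\<And>f. f \<in> V \<Longrightarrow> g f - c * l a f \<le> ?q f"
    using dominated_split_functional[OF V insert.prems(2) insert.prems(1)[of a], of ?q C] by auto
  have "real_linear_on V (\<lambda>f. g f - c * l a f)"
    using insert.prems(1)[of a] insert.prems(2) by (auto simp: real_linear_on_def algebra_simps)
  from insert.IH[OF _ this c] insert.prems(1)
  obtain d where d: "\<And>f. f \<in> V \<Longrightarrow> g f - c * l a f - (\<Sum>a\<in>A. d a * l a f) \<le> q f" by auto
  have "(\<Sum>b\<in>insert a A. (d(a := c)) b * l b f) = c * l a f + (\<Sum>b\<in>A. d b * l b f)" for f
    using insert.hyps by (auto intro: sum.cong)
  with d show ?case by (intro exI[of _ "d(a := c)"]) (auto simp: algebra_simps)
qed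

subsection \<open>Seminorms are almost determined by finitely many values\<close>

lemma has_vector_derivative_along_axis:
  assumes "\<psi> \<in> schwartz"
  shows "((\<lambda>t. \<psi> (x + t *\<^sub>R axis i 1)) has_vector_derivative partial_derivative i \<psi> (x + t *\<^sub>R axis i 1)) (at t within S)"
proof -
  have "((\<lambda>t. x + t *\<^sub>R axis i 1) has_derivative (\<lambda>h. h *\<^sub>R axis i 1)) (at t within S)"
    by (auto intro!: derivative_eq_intros)
  from has_derivative_compose[OF this has_derivative_partials[OF schwartz_differentiable'[OF assms]]]
  show ?thesis
    unfolding has_vector_derivative_def
    by (simp add: axis_def if_distrib[of "\<lambda>c. c *\<^sub>R _"] if_distrib[of "\<lambda>c. _ * c"] cong: if_cong)
qed

text \<open>An inequality of Landau type: a derivative is controlled by the function and, with a small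
  factor, by the second derivatives.\<close>

lemma partial_derivative_interpolation:
  assumes \<psi>: "\<psi> \<in> schwartz" and h: "h > 0"
  shows "norm (partial_derivative i \<psi> x)
    \<le> (norm (\<psi> (x + h *\<^sub>R axis i 1)) + norm (\<psi> x)) / h + h * gradient_bound (partial_derivative i \<psi>)"
proof -
  let ?G = "gradient_bound (partial_derivative i \<psi>)"
  have G: "?G \<ge> 0" by (intro gradient_bound_nonneg schwartz_partial \<psi>)
  define D where "D t = \<psi> (x + t *\<^sub>R axis i 1) - t *\<^sub>R partial_derivative i \<psi> x" for t
  have "norm (D h - D 0) \<le> (?G * h) * norm (h - 0)"
  proof (rule differentiable_bound[of "{0..h}" D "\<lambda>t s. s *\<^sub>R (partial_derivative i \<psi> (x + t *\<^sub>R axis i 1) - partial_derivative i \<psi> x)"])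
    show "(D has_derivative (\<lambda>s. s *\<^sub>R (partial_derivative i \<psi> (x + t *\<^sub>R axis i 1) - partial_derivative i \<psi> x))) (at t within {0..h})" for t
      using has_vector_derivative_diff[OF has_vector_derivative_along_axis[OF \<psi>]
          has_vector_derivative_scaleR[OF DERIV_ident has_vector_derivative_const]]
      unfolding has_vector_derivative_def D_def by simp
    show "onorm (\<lambda>s. s *\<^sub>R (partial_derivative i \<psi> (x + t *\<^sub>R axis i 1) - partial_derivative i \<psi> x)) \<le> ?G * h"
      if t: "t \<in> {0..h}" for t
    proof (rule onorm_bound)
      fix s :: real
      have "norm (partial_derivative i \<psi> (x + t *\<^sub>R axis i 1) - partial_derivative i \<psi> x) \<le> ?G * norm (t *\<^sub>R (axis i 1 :: real^'a))"
        using schwartz_lipschitz[OF schwartz_partial[OF \<psi>], of i "x + t *\<^sub>R axis i 1" x] by simp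
      also have "\<dots> \<le> ?G * h" using t G by (intro mult_left_mono) (auto simp: norm_axis_1)
      finally have "\<bar>s\<bar> * norm (partial_derivative i \<psi> (x + t *\<^sub>R axis i 1) - partial_derivative i \<psi> x) \<le> \<bar>s\<bar> * (?G * h)"
        by (intro mult_left_mono) auto
      then show "norm (s *\<^sub>R (partial_derivative i \<psi> (x + t *\<^sub>R axis i 1) - partial_derivative i \<psi> x)) \<le> ?G * h * norm s"
        by (simp only: norm_scaleR real_norm_def mult.commute[of "?G * h"])
    qed (use G h in auto)
  qed (use h in auto)
  then have 1: "norm (D h - D 0) \<le> ?G * h * h" using h by simp
  have "h * norm (partial_derivative i \<psi> x) = norm ((\<psi> (x + h *\<^sub>R axis i 1) - \<psi> x) - (D h - D 0))"
    using h by (simp add: D_def)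
  also have "\<dots> \<le> (norm (\<psi> (x + h *\<^sub>R axis i 1)) + norm (\<psi> x)) + norm (D h - D 0)"
    by (meson norm_triangle_ineq4 order_trans add_mono order_refl)
  finally show ?thesis using h 1 by (simp add: field_simps)
qed

lemma gradient_bound_le_seminorm_sum:
  fixes \<phi> :: "real^'n::finite \<Rightarrow> complex"
  assumes "finite K" "\<And>j. (\<lambda>_. 0, j # is) \<in> K" "\<phi> \<in> schwartz"
  shows "gradient_bound (iterated_partial is \<phi>) \<le> real CARD('n) * seminorm_sum K \<phi>"
proof -
  have "schwartz_seminorm (\<lambda>_. 0) [j] (iterated_partial is \<phi>) \<le> seminorm_sum K \<phi>" for j
    using schwartz_seminorm_le_sum[OF assms(1) assms(2)[of j] assms(3)]
    by (simp add: schwartz_seminorm_def)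
  then have "gradient_bound (iterated_partial is \<phi>) \<le> (\<Sum>j\<in>(UNIV :: 'n set). seminorm_sum K \<phi>)"
    unfolding gradient_bound_def by (intro sum_mono)
  then show ?thesis by simp
qed

text \<open>On a compact set a function is controlled by its values on a fine net and its gradient; the interpolation
  inequality passes from a function to its derivatives.  It matters for the convergence later on that \<open>K\<close> is chosen before \<open>\<epsilon>\<close>.\<close>

lemma iterated_partial_sampling:
  fixes js :: "'n::finite list"
  shows "\<exists>K. finite K \<and> (\<forall>R. \<forall>\<epsilon>>0. \<exists>C P. C \<ge> 0 \<and> finite P \<and>
    (\<forall>\<phi>\<in>schwartz. \<forall>x. norm x \<le> R \<longrightarrow>
       norm (iterated_partial js \<phi> x) \<le> \<epsilon> * seminorm_sum K \<phi> + C * (\<Sum>p\<in>P. norm (\<phi> p))))"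
proof (induction js)
  case Nil
  define K where "K = range (\<lambda>i::'n. (\<lambda>_::'n. 0::nat, [i]))"
  define n where "n = real CARD('n)"
  have n: "n > 0" by (simp add: n_def)
  have K: "finite K" by (simp add: K_def)
  have "\<exists>C P. C \<ge> 0 \<and> finite P \<and> (\<forall>\<phi>\<in>schwartz. \<forall>x::real^'n. norm x \<le> R \<longrightarrow>
       norm (iterated_partial [] \<phi> x) \<le> \<epsilon> * seminorm_sum K \<phi> + C * (\<Sum>p\<in>P. norm (\<phi> p)))" if \<epsilon>: "\<epsilon> > 0" for R \<epsilon>
  proof -
    have "seq_compact (cball (0::real^'n) R)" by (simp add: compact_imp_seq_compact)
    then obtain P where P: "finite P" "cball 0 R \<subseteq> (\<Union>p\<in>P. ball (p::real^'n) (\<epsilon> / n))"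
      using seq_compact_imp_totally_bounded \<epsilon> n by (metis divide_pos_pos)
    have "norm (\<phi> x) \<le> \<epsilon> * seminorm_sum K \<phi> + 1 * (\<Sum>p\<in>P. norm (\<phi> p))" if \<phi>: "\<phi> \<in> schwartz" and x: "norm x \<le> R" for \<phi> x
    proof -
      obtain p where p: "p \<in> P" "dist p x < \<epsilon> / n" using P x by (force simp: subset_iff)
      have "norm (\<phi> x) \<le> norm (\<phi> p) + norm (\<phi> x - \<phi> p)" using norm_triangle_ineq[of "\<phi> p" "\<phi> x - \<phi> p"] by simp
      also have "norm (\<phi> x - \<phi> p) \<le> gradient_bound \<phi> * norm (x - p)" by (rule schwartz_lipschitz[OF \<phi>])
      also have "\<dots> \<le> (n * seminorm_sum K \<phi>) * (\<epsilon> / n)"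
        using gradient_bound_le_seminorm_sum[OF K _ \<phi>, of "[]"] gradient_bound_nonneg[OF \<phi>] p n seminorm_sum_nonneg[OF \<phi>]
        by (intro mult_mono) (auto simp: n_def K_def dist_norm norm_minus_commute)
      also have "norm (\<phi> p) \<le> (\<Sum>p\<in>P. norm (\<phi> p))" using P p by (intro member_le_sum) auto
      finally show ?thesis using n by (simp add: algebra_simps)
    qed
    with P show ?thesis by (intro exI[of _ 1] exI[of _ P]) auto
  qed
  with K show ?case by blast
next
  case (Cons i "is")
  then obtain K0 where K0: "finite K0" "\<And>R \<epsilon>. \<epsilon> > 0 \<Longrightarrow> \<exists>C P. C \<ge> 0 \<and> finite P \<and>
    (\<forall>\<phi>\<in>schwartz. \<forall>x. norm x \<le> R \<longrightarrow>
       norm (iterated_partial is \<phi> x) \<le> \<epsilon> * seminorm_sum K0 \<phi> + C * (\<Sum>p\<in>P. norm (\<phi> p)))" by blast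
  define K where "K = K0 \<union> range (\<lambda>j. (\<lambda>_. 0, j # i # is))"
  define n where "n = real CARD('n)"
  have n: "n > 0" by (simp add: n_def)
  have K: "finite K" using K0 by (simp add: K_def)
  have "\<exists>C P. C \<ge> 0 \<and> finite P \<and> (\<forall>\<phi>\<in>schwartz. \<forall>x. norm x \<le> R \<longrightarrow>
       norm (iterated_partial (i # is) \<phi> x) \<le> \<epsilon> * seminorm_sum K \<phi> + C * (\<Sum>p\<in>P. norm (\<phi> p)))" if \<epsilon>: "\<epsilon> > 0" for R \<epsilon>
  proof -
    define h where "h = \<epsilon> / (2 * n)"
    have h: "h > 0" using \<epsilon> n by (simp add: h_def)
    obtain C P where CP: "C \<ge> 0" "finite P" "\<forall>\<phi>\<in>schwartz. \<forall>x. norm x \<le> R + h \<longrightarrow>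
       norm (iterated_partial is \<phi> x) \<le> (h * \<epsilon> / 4) * seminorm_sum K0 \<phi> + C * (\<Sum>p\<in>P. norm (\<phi> p))"
      using K0(2)[of "h * \<epsilon> / 4" "R + h"] h \<epsilon> by auto
    have "norm (iterated_partial (i # is) \<phi> x) \<le> \<epsilon> * seminorm_sum K \<phi> + (2 * C / h) * (\<Sum>p\<in>P. norm (\<phi> p))"
      if \<phi>: "\<phi> \<in> schwartz" and x: "norm x \<le> R" for \<phi> x
    proof -
      let ?\<psi> = "iterated_partial is \<phi>" and ?q = "seminorm_sum K \<phi>" and ?v = "\<Sum>p\<in>P. norm (\<phi> p)"
      have q0: "seminorm_sum K0 \<phi> \<le> ?q" by (rule seminorm_sum_mono[OF K _ \<phi>]) (simp add: K_def)
      have near: "norm (x + h *\<^sub>R axis i 1) \<le> R + h"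
        using norm_triangle_ineq[of x "h *\<^sub>R axis i 1"] x h by (simp add: norm_axis_1)
      have bound: "norm (?\<psi> y) \<le> (h * \<epsilon> / 4) * ?q + C * ?v" if "norm y \<le> R + h" for y
      proof -
        have "norm (?\<psi> y) \<le> (h * \<epsilon> / 4) * seminorm_sum K0 \<phi> + C * ?v" using CP(3) \<phi> that by blast
        also have "\<dots> \<le> (h * \<epsilon> / 4) * ?q + C * ?v" using q0 h \<epsilon> by (intro add_right_mono mult_left_mono) auto
        finally show ?thesis .
      qed
      have "(norm (?\<psi> (x + h *\<^sub>R axis i 1)) + norm (?\<psi> x)) / h \<le> (2 * ((h * \<epsilon> / 4) * ?q + C * ?v)) / h"
      proof (rule divide_right_mono)
        have "norm x \<le> R + h" using x h by simp
        from add_mono[OF bound[OF near] bound[OF this]]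
        show "norm (?\<psi> (x + h *\<^sub>R axis i 1)) + norm (?\<psi> x) \<le> 2 * ((h * \<epsilon> / 4) * ?q + C * ?v)" by (simp only: mult_2)
      qed (use h in simp)
      also have "\<dots> = \<epsilon> / 2 * ?q + (2 * C / h) * ?v" using h by (simp add: field_simps)
      finally have 1: "(norm (?\<psi> (x + h *\<^sub>R axis i 1)) + norm (?\<psi> x)) / h \<le> \<epsilon> / 2 * ?q + (2 * C / h) * ?v" .
      have "h * gradient_bound (partial_derivative i ?\<psi>) \<le> h * (n * ?q)"
        using gradient_bound_le_seminorm_sum[OF K _ \<phi>, of "i # is"] h by (intro mult_left_mono) (auto simp: n_def K_def)
      also have "\<dots> = \<epsilon> / 2 * ?q" using n by (simp add: h_def)
      finally show ?thesis
        using 1 partial_derivative_interpolation[OF schwartz_iterated_partial[OF \<phi>, of "is"] h, of i x] by simp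
    qed
    with CP h show ?thesis by (intro exI[of _ "2 * C / h"] exI[of _ P]) auto
  qed
  with K show ?case by blast
qed

text \<open>Far out the weight \<open>x\<^sup>\<alpha>\<close> is beaten by the weights with one more factor \<open>x\<^sub>i\<close>, so
  that only a compact set has to be sampled.\<close>

lemma schwartz_seminorm_sampling:
  fixes js :: "'n::finite list"
  shows "\<exists>K. finite K \<and> (\<forall>\<epsilon>>0. \<exists>C P. C \<ge> 0 \<and> finite P \<and>
    (\<forall>\<phi>\<in>schwartz. schwartz_seminorm \<alpha> js \<phi> \<le> \<epsilon> * seminorm_sum K \<phi> + C * (\<Sum>p\<in>P. norm (\<phi> p))))"
proof -
  obtain K0 where K0: "finite K0" "\<And>R \<epsilon>. \<epsilon> > 0 \<Longrightarrow> \<exists>C P. C \<ge> 0 \<and> finite P \<and>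
    (\<forall>\<phi>\<in>schwartz. \<forall>x. norm x \<le> R \<longrightarrow>
       norm (iterated_partial js \<phi> x) \<le> \<epsilon> * seminorm_sum K0 \<phi> + C * (\<Sum>p\<in>P. norm (\<phi> p)))"
    using iterated_partial_sampling[of js] by blast
  define K where "K = K0 \<union> range (\<lambda>i. (\<alpha>(i := Suc (\<alpha> i)), js))"
  define n where "n = real CARD('n)"
  have n: "n > 0" by (simp add: n_def)
  have K: "finite K" using K0 by (simp add: K_def)
  have "\<exists>C P. C \<ge> 0 \<and> finite P \<and>
    (\<forall>\<phi>\<in>schwartz. schwartz_seminorm \<alpha> js \<phi> \<le> \<epsilon> * seminorm_sum K \<phi> + C * (\<Sum>p\<in>P. norm (\<phi> p)))" if \<epsilon>: "\<epsilon> > 0" for \<epsilon>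
  proof -
    define R where "R = n / \<epsilon>"
    define m where "m = R ^ (\<Sum>i\<in>UNIV. \<alpha> i)"
    have R: "R > 0" and m: "m > 0" using n \<epsilon> by (auto simp: R_def m_def)
    obtain C P where CP: "C \<ge> 0" "finite P" "\<forall>\<phi>\<in>schwartz. \<forall>x. norm x \<le> R \<longrightarrow>
       norm (iterated_partial js \<phi> x) \<le> (\<epsilon> / m) * seminorm_sum K0 \<phi> + C * (\<Sum>p\<in>P. norm (\<phi> p))"
      using K0(2)[of "\<epsilon> / m" R] m \<epsilon> by auto
    have "schwartz_seminorm \<alpha> js \<phi> \<le> \<epsilon> * seminorm_sum K \<phi> + (m * C) * (\<Sum>p\<in>P. norm (\<phi> p))" if \<phi>: "\<phi> \<in> schwartz" for \<phi>
    proof (rule schwartz_seminorm_leI)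
      fix x :: "real^'n"
      let ?v = "\<Sum>p\<in>P. norm (\<phi> p)" and ?d = "norm (iterated_partial js \<phi> x)"
      have q0: "seminorm_sum K0 \<phi> \<le> seminorm_sum K \<phi>" by (rule seminorm_sum_mono[OF K _ \<phi>]) (simp add: K_def)
      have v: "?v \<ge> 0" by (simp add: sum_nonneg)
      show "\<bar>monomial_fun \<alpha> x\<bar> * ?d \<le> \<epsilon> * seminorm_sum K \<phi> + (m * C) * ?v"
      proof (cases "norm x \<le> R")
        case True
        have "\<bar>monomial_fun \<alpha> x\<bar> \<le> m"
          using monomial_fun_le_norm_power[of \<alpha> x] power_mono[OF True, of "\<Sum>i\<in>UNIV. \<alpha> i"] by (simp add: m_def)
        then have "\<bar>monomial_fun \<alpha> x\<bar> * ?d \<le> m * ((\<epsilon> / m) * seminorm_sum K0 \<phi> + C * ?v)"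
          using CP(3) \<phi> True m by (intro mult_mono) auto
        also have "\<dots> = \<epsilon> * seminorm_sum K0 \<phi> + (m * C) * ?v" using m by (simp add: field_simps)
        also have "\<dots> \<le> \<epsilon> * seminorm_sum K \<phi> + (m * C) * ?v"
          using q0 \<epsilon> by (intro add_right_mono mult_left_mono) auto
        finally show ?thesis .
      next
        case False
        have each: "\<bar>x $ i\<bar> * (\<bar>monomial_fun \<alpha> x\<bar> * ?d) \<le> seminorm_sum K \<phi>" for i
        proof -
          have "monomial_fun (\<alpha>(i := Suc (\<alpha> i))) x = x $ i * monomial_fun \<alpha> x"
          proof -
            have "monomial_fun (\<alpha>(i := Suc (\<alpha> i))) x = (\<Prod>j\<in>UNIV. (if j = i then x $ i else 1) * (x $ j) ^ \<alpha> j)"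
              unfolding monomial_fun_def by (intro prod.cong) auto
            then show ?thesis by (simp add: prod.distrib monomial_fun_def)
          qed
          with schwartz_seminorm_bound[OF \<phi>, of "\<alpha>(i := Suc (\<alpha> i))" x js]
            schwartz_seminorm_le_sum[OF K _ \<phi>, of "\<alpha>(i := Suc (\<alpha> i))" js]
          show ?thesis by (auto simp: K_def abs_mult mult_ac)
        qed
        have "R * (\<bar>monomial_fun \<alpha> x\<bar> * ?d) \<le> (\<Sum>i\<in>UNIV. \<bar>x $ i\<bar>) * (\<bar>monomial_fun \<alpha> x\<bar> * ?d)"
          using False norm_le_l1_cart[of x] by (intro mult_right_mono) auto
        also have "\<dots> \<le> (\<Sum>i\<in>(UNIV::'n set). seminorm_sum K \<phi>)"
          unfolding sum_distrib_right by (intro sum_mono each)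
        also have "\<dots> = R * (\<epsilon> * seminorm_sum K \<phi>)" using \<epsilon> by (simp add: R_def n_def)
        finally have "\<bar>monomial_fun \<alpha> x\<bar> * ?d \<le> \<epsilon> * seminorm_sum K \<phi>" using R by simp
        then show ?thesis using v m CP(1) by (simp add: add_increasing2)
      qed
    qed
    with CP m show ?thesis by (intro exI[of _ "m * C"] exI[of _ P]) auto
  qed
  with K show ?thesis by blast
qed

lemma seminorm_sum_sampling:
  fixes F :: "(('n::finite \<Rightarrow> nat) \<times> 'n list) set"
  assumes "finite F"
  shows "\<exists>K. finite K \<and> (\<forall>\<epsilon>>0. \<exists>C P. C \<ge> 0 \<and> finite P \<and>
    (\<forall>\<phi>\<in>schwartz. seminorm_sum F \<phi> \<le> \<epsilon> * seminorm_sum K \<phi> + C * (\<Sum>p\<in>P. norm (\<phi> p))))"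
  using assms
proof (induction F rule: finite_induct)
  case empty
  show ?case
  proof (intro exI[of _ "{}"] conjI allI impI)
    fix \<epsilon> :: real
    show "\<exists>C P. C \<ge> 0 \<and> finite P \<and> (\<forall>\<phi>\<in>schwartz. seminorm_sum {} \<phi> \<le> \<epsilon> * seminorm_sum {} \<phi> + C * (\<Sum>p\<in>P. norm (\<phi> p)))"
      by (intro exI[of _ 0] exI[of _ "{}"]) (simp add: seminorm_sum_def)
  qed simp
next
  case (insert a F)
  obtain \<alpha> js where a: "a = (\<alpha>, js)" by (cases a)
  obtain K1 where K1: "finite K1" "\<And>\<epsilon>. \<epsilon> > 0 \<Longrightarrow> \<exists>C P. C \<ge> 0 \<and> finite P \<and>
    (\<forall>\<phi>\<in>schwartz. schwartz_seminorm \<alpha> js \<phi> \<le> \<epsilon> * seminorm_sum K1 \<phi> + C * (\<Sum>p\<in>P. norm (\<phi> p)))"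
    using schwartz_seminorm_sampling[of \<alpha> js] by blast
  obtain K2 where K2: "finite K2" "\<And>\<epsilon>. \<epsilon> > 0 \<Longrightarrow> \<exists>C P. C \<ge> 0 \<and> finite P \<and>
    (\<forall>\<phi>\<in>schwartz. seminorm_sum F \<phi> \<le> \<epsilon> * seminorm_sum K2 \<phi> + C * (\<Sum>p\<in>P. norm (\<phi> p)))"
    using insert.IH by blast
  have "\<exists>C P. C \<ge> 0 \<and> finite P \<and> (\<forall>\<phi>\<in>schwartz. seminorm_sum (insert a F) \<phi>
      \<le> \<epsilon> * seminorm_sum (K1 \<union> K2) \<phi> + C * (\<Sum>p\<in>P. norm (\<phi> p)))" if \<epsilon>: "\<epsilon> > 0" for \<epsilon>
  proof -
    obtain C1 P1 where 1: "C1 \<ge> 0" "finite P1" "\<forall>\<phi>\<in>schwartz. schwartz_seminorm \<alpha> js \<phi> \<le> (\<epsilon> / 2) * seminorm_sum K1 \<phi> + C1 * (\<Sum>p\<in>P1. norm (\<phi> p))"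
      using K1(2)[of "\<epsilon> / 2"] \<epsilon> by auto
    obtain C2 P2 where 2: "C2 \<ge> 0" "finite P2" "\<forall>\<phi>\<in>schwartz. seminorm_sum F \<phi> \<le> (\<epsilon> / 2) * seminorm_sum K2 \<phi> + C2 * (\<Sum>p\<in>P2. norm (\<phi> p))"
      using K2(2)[of "\<epsilon> / 2"] \<epsilon> by auto
    have "seminorm_sum (insert a F) \<phi> \<le> \<epsilon> * seminorm_sum (K1 \<union> K2) \<phi> + (C1 + C2) * (\<Sum>p\<in>P1 \<union> P2. norm (\<phi> p))"
      if \<phi>: "\<phi> \<in> schwartz" for \<phi>
    proof -
      have "seminorm_sum (insert a F) \<phi> = schwartz_seminorm \<alpha> js \<phi> + seminorm_sum F \<phi>"
        using insert.hyps by (simp add: seminorm_sum_def a)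
      moreover have "C1 * (\<Sum>p\<in>P1. norm (\<phi> p)) \<le> C1 * (\<Sum>p\<in>P1 \<union> P2. norm (\<phi> p))"
        using 1 2 by (intro mult_left_mono sum_mono2) auto
      moreover have "C2 * (\<Sum>p\<in>P2. norm (\<phi> p)) \<le> C2 * (\<Sum>p\<in>P1 \<union> P2. norm (\<phi> p))"
        using 1 2 by (intro mult_left_mono sum_mono2) auto
      moreover have "(\<epsilon> / 2) * seminorm_sum K1 \<phi> \<le> (\<epsilon> / 2) * seminorm_sum (K1 \<union> K2) \<phi>"
        "(\<epsilon> / 2) * seminorm_sum K2 \<phi> \<le> (\<epsilon> / 2) * seminorm_sum (K1 \<union> K2) \<phi>"
        using \<epsilon> K1 K2 \<phi> by (auto intro!: mult_left_mono seminorm_sum_mono)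
      moreover have "schwartz_seminorm \<alpha> js \<phi> \<le> (\<epsilon> / 2) * seminorm_sum K1 \<phi> + C1 * (\<Sum>p\<in>P1. norm (\<phi> p))"
        "seminorm_sum F \<phi> \<le> (\<epsilon> / 2) * seminorm_sum K2 \<phi> + C2 * (\<Sum>p\<in>P2. norm (\<phi> p))"
        using 1(3) 2(3) \<phi> by auto
      ultimately show ?thesis unfolding distrib_right by linarith
    qed
    with 1 2 show ?thesis by (intro exI[of _ "C1 + C2"] exI[of _ "P1 \<union> P2"]) auto
  qed
  with K1(1) K2(1) show ?case by (intro exI[of _ "K1 \<union> K2"]) auto
qed

text \<open>Since \<open>\<bar>g\<bar>\<close> is at most a small multiple of a continuous seminorm plus a multiple of finitely many point
  values, splitting off the point evaluations leaves a functional bounded by the small multiple alone.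
  The seminorm does not depend on \<open>\<epsilon>\<close>, so that the combinations of point masses converge weakly.\<close>

theorem tempered_point_mass_approximation:
  fixes g :: "'k::finite distrib"
  assumes g: "g \<in> tempered"
  shows "\<exists>K. finite K \<and> (\<forall>\<epsilon>>0. \<exists>P c. finite P \<and>
    (\<forall>\<phi>\<in>schwartz. cmod (g \<phi> - (\<Sum>p\<in>P. c p * \<phi> p)) \<le> \<epsilon> * seminorm_sum K \<phi>))"
proof -
  obtain F C0 where F: "finite F" "C0 \<ge> 0" "\<And>\<phi>. \<phi> \<in> schwartz \<Longrightarrow> cmod (g \<phi>) \<le> C0 * seminorm_sum F \<phi>"
    using tempered_bound[OF g] by blast
  obtain K where K: "finite K" "\<And>\<epsilon>. \<epsilon> > 0 \<Longrightarrow> \<exists>C P. C \<ge> 0 \<and> finite P \<and>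
    (\<forall>\<phi>\<in>schwartz. seminorm_sum F \<phi> \<le> \<epsilon> * seminorm_sum K \<phi> + C * (\<Sum>p\<in>P. norm (\<phi> p)))"
    using seminorm_sum_sampling[OF F(1)] by blast
  have scaleR_eq: "(\<lambda>x. t *\<^sub>R f x) = (\<lambda>x. complex_of_real t * f x)" for t :: real and f :: "real^'k \<Rightarrow> complex"
    by (simp add: scaleR_conv_of_real)
  have "\<exists>P c. finite P \<and> (\<forall>\<phi>\<in>schwartz. cmod (g \<phi> - (\<Sum>p\<in>P. c p * \<phi> p)) \<le> \<epsilon> * seminorm_sum K \<phi>)" if \<epsilon>: "\<epsilon> > 0" for \<epsilon>
  proof -
    obtain C P where CP: "C \<ge> 0" "finite P"
      "\<forall>\<phi>\<in>schwartz. seminorm_sum F \<phi> \<le> (\<epsilon> / (C0 + 1)) * seminorm_sum K \<phi> + C * (\<Sum>p\<in>P. norm (\<phi> p))"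
      using K(2)[of "\<epsilon> / (C0 + 1)"] \<epsilon> F(2) by auto
    define q where "q \<phi> = \<epsilon> * seminorm_sum K \<phi>" for \<phi>
    define l :: "(real^'k) \<times> bool \<Rightarrow> (real^'k \<Rightarrow> complex) \<Rightarrow> real" where "l = (\<lambda>(p, re) \<phi>. if re then Re (\<phi> p) else Im (\<phi> p))"
    have "\<exists>c. \<forall>\<phi>\<in>schwartz. Re (g \<phi>) - (\<Sum>a\<in>P \<times> UNIV. c a * l a \<phi>) \<le> q \<phi>"
    proof (rule dominated_split_functionals[where C="C0 * C"])
      show "real_subspace (schwartz :: (real^'k \<Rightarrow> complex) set)"
        unfolding real_subspace_def scaleR_eq by (blast intro: schwartz_add schwartz_cmult)
      show "sublinear_on schwartz q"
        unfolding sublinear_on_def q_def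
      proof (intro conjI ballI allI impI)
        show "\<epsilon> * seminorm_sum K (\<lambda>x. f x + h x) \<le> \<epsilon> * seminorm_sum K f + \<epsilon> * seminorm_sum K h"
          if "f \<in> schwartz" "h \<in> schwartz" for f h
          using mult_left_mono[OF seminorm_sum_add[OF that, of K], of \<epsilon>] \<epsilon> by (simp add: distrib_left)
        show "\<epsilon> * seminorm_sum K (\<lambda>x. t *\<^sub>R f x) \<le> t * (\<epsilon> * seminorm_sum K f)" if "t > 0" "f \<in> schwartz" for t f
          using mult_left_mono[OF seminorm_sum_cmult_le[OF that(2), of K "complex_of_real t"], of \<epsilon>] \<epsilon> that(1)
          unfolding scaleR_eq by (simp add: mult_ac)
      qed
      show "real_linear_on schwartz (\<lambda>\<phi>. Re (g \<phi>))"
        unfolding real_linear_on_def scaleR_eq using tempered_add[OF g] tempered_cmult[OF g] by auto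
      show "real_linear_on schwartz (l a)" for a
        unfolding real_linear_on_def l_def by (cases a) auto
      show "Re (g \<phi>) \<le> q \<phi> + C0 * C * (\<Sum>a\<in>P \<times> UNIV. \<bar>l a \<phi>\<bar>)" if \<phi>: "\<phi> \<in> schwartz" for \<phi>
      proof -
        have "(\<Sum>p\<in>P. norm (\<phi> p)) \<le> (\<Sum>p\<in>P. \<Sum>re\<in>UNIV. \<bar>l (p, re) \<phi>\<bar>)"
          by (intro sum_mono) (simp add: l_def UNIV_bool cmod_le add.commute[of "\<bar>Im _\<bar>"])
        then have le: "(\<Sum>p\<in>P. norm (\<phi> p)) \<le> (\<Sum>a\<in>P \<times> UNIV. \<bar>l a \<phi>\<bar>)"
          by (simp add: sum.cartesian_product)
        have "Re (g \<phi>) \<le> C0 * seminorm_sum F \<phi>" using F(3)[OF \<phi>] complex_Re_le_cmod order_trans by blast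
        also have "\<dots> \<le> C0 * ((\<epsilon> / (C0 + 1)) * seminorm_sum K \<phi> + C * (\<Sum>a\<in>P \<times> UNIV. \<bar>l a \<phi>\<bar>))"
          using CP(3) \<phi> F(2) mult_left_mono[OF le CP(1)] by (intro mult_left_mono) fastforce+
        also have "\<dots> = (C0 / (C0 + 1)) * q \<phi> + C0 * C * (\<Sum>a\<in>P \<times> UNIV. \<bar>l a \<phi>\<bar>)"
          by (simp add: q_def algebra_simps)
        also have "(C0 / (C0 + 1)) * q \<phi> \<le> 1 * q \<phi>"
          using F(2) \<epsilon> seminorm_sum_nonneg[OF \<phi>, of K] by (intro mult_right_mono) (auto simp: q_def)
        finally show ?thesis by simp
      qed
    qed (use CP F in auto)
    then obtain c where c: "\<And>\<phi>. \<phi> \<in> schwartz \<Longrightarrow> Re (g \<phi>) - (\<Sum>a\<in>P \<times> UNIV. c a * l a \<phi>) \<le> q \<phi>" by blast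
    define d where "d p = Complex (c (p, True)) (- c (p, False))" for p
    define D where "D \<phi> = g \<phi> - (\<Sum>p\<in>P. d p * \<phi> p)" for \<phi>
    have "(\<Sum>a\<in>P \<times> UNIV. c a * l a \<phi>) = Re (\<Sum>p\<in>P. d p * \<phi> p)" for \<phi>
    proof -
      have "(\<Sum>a\<in>P \<times> UNIV. c a * l a \<phi>) = (\<Sum>p\<in>P. \<Sum>re\<in>UNIV. c (p, re) * l (p, re) \<phi>)"
        by (simp add: sum.cartesian_product)
      also have "\<dots> = (\<Sum>p\<in>P. Re (d p * \<phi> p))"
        by (intro sum.cong) (auto simp: d_def l_def UNIV_bool)
      finally show ?thesis by simp
    qed
    with c have ReD: "Re (D \<phi>) \<le> q \<phi>" if "\<phi> \<in> schwartz" for \<phi> using that by (simp add: D_def)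
    have "cmod (D \<phi>) \<le> q \<phi>" if \<phi>: "\<phi> \<in> schwartz" for \<phi>
    proof (cases "D \<phi> = 0")
      case True
      then show ?thesis using \<epsilon> seminorm_sum_nonneg[OF \<phi>, of K] by (simp add: q_def)
    next
      case False
      \<comment> \<open>Multiplication by this phase makes the value of \<open>D\<close> real.\<close>
      define z where "z = cnj (D \<phi>) / cmod (D \<phi>)"
      have z: "cmod z = 1" using False by (simp add: z_def norm_divide)
      have "D (\<lambda>x. z * \<phi> x) = z * D \<phi>"
        using tempered_cmult[OF g \<phi>, of z]
        by (simp add: D_def right_diff_distrib sum_distrib_left mult_ac)
      also have "\<dots> = cmod (D \<phi>)"
        using False by (simp add: z_def mult.commute[of "cnj _"] complex_norm_square[symmetric] power2_eq_square)
      finally have "cmod (D \<phi>) \<le> q (\<lambda>x. z * \<phi> x)"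
        using ReD[OF schwartz_cmult[OF \<phi>, of z]] by simp
      also have "\<dots> \<le> q \<phi>"
        using mult_left_mono[OF seminorm_sum_cmult_le[OF \<phi>, of K z], of \<epsilon>] \<epsilon> z by (simp add: q_def)
      finally show ?thesis .
    qed
    with CP(2) show ?thesis by (intro exI[of _ P] exI[of _ d]) (auto simp: D_def q_def)
  qed
  with K(1) show ?thesis by blast
qed

section \<open>Approximation of low-dimensional distributions by Schwartz functions\<close>

lemma schwartz_gaussian:
  fixes a :: "real^'n::finite"
  assumes \<tau>: "\<tau> > 0"
  shows "(\<lambda>x. complex_of_real (exp (- (norm (x - a) / \<tau>)\<^sup>2))) \<in> schwartz"
proof -
  define b where "b z = (\<Sum>j\<in>UNIV. (snd z $ j - a $ j)\<^sup>2) * (1 / \<tau>\<^sup>2)" for z :: "real \<times> (real^'n)"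
  have b: "b (0, x) = (norm (x - a) / \<tau>)\<^sup>2" for x
    by (simp add: b_def power_divide norm_square_vec)
  have polyb: "real_polynomial_function b"
    unfolding b_def[abs_def]
    by (intro real_polynomial_function_intros real_polynomial_function_coordinates) simp
  define F where "F p = (\<lambda>x. complex_of_real (p (0, x) * exp (- b (0, x))))" for p :: "real \<times> (real^'n) \<Rightarrow> real"
  define \<C> where "\<C> = {F p | p. real_polynomial_function p}"
  have "F (\<lambda>_. 1) \<in> \<C>" by (auto simp: \<C>_def intro: real_polynomial_function_intros)
  then have "F (\<lambda>_. 1) \<in> schwartz"
  proof (rule schwartz_coinduct)
    have deriv: "\<exists>p'. (\<forall>i. real_polynomial_function (p' i)) \<and>
        (\<forall>x. (F p has_derivative (\<lambda>h. \<Sum>i\<in>UNIV. h $ i *\<^sub>R F (p' i) x)) (at x))" if p: "real_polynomial_function p" for p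
    proof -
      obtain p' where p': "\<And>i. real_polynomial_function (p' i)"
        "\<And>s x. ((\<lambda>x. p (s, x)) has_derivative (\<lambda>h. \<Sum>i\<in>UNIV. h $ i * p' i (s, x))) (at x)"
        using real_polynomial_function_partial[OF p] by blast
      obtain b' where b': "\<And>i. real_polynomial_function (b' i)"
        "\<And>s x. ((\<lambda>x. b (s, x)) has_derivative (\<lambda>h. \<Sum>i\<in>UNIV. h $ i * b' i (s, x))) (at x)"
        using real_polynomial_function_partial[OF polyb] by blast
      have "(F p has_derivative (\<lambda>h. \<Sum>i\<in>UNIV. h $ i *\<^sub>R F (\<lambda>z. p' i z - p z * b' i z) x)) (at x)" for x
      proof -
        let ?e = "exp (- b (0, x))"
        have "((\<lambda>x. p (0, x) * exp (- b (0, x))) has_derivative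
           (\<lambda>h. p (0, x) * (?e * - (\<Sum>i\<in>UNIV. h $ i * b' i (0, x))) + (\<Sum>i\<in>UNIV. h $ i * p' i (0, x)) * ?e)) (at x)"
          by (rule has_derivative_mult[OF p'(2)]) (auto intro!: derivative_eq_intros b'(2))
        from bounded_linear.has_derivative[OF bounded_linear_of_real this]
        show ?thesis unfolding F_def
        proof (rule has_derivative_eq_rhs, intro ext)
          fix h :: "real^'n"
          have "p (0, x) * (?e * - (\<Sum>i\<in>UNIV. h $ i * b' i (0, x))) + (\<Sum>i\<in>UNIV. h $ i * p' i (0, x)) * ?e
              = (\<Sum>i\<in>UNIV. h $ i * ((p' i (0, x) - p (0, x) * b' i (0, x)) * ?e))"
            by (simp add: sum_distrib_left sum_distrib_right sum_subtractf algebra_simps flip: sum.distrib sum_negf)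
          then show "complex_of_real (p (0, x) * (?e * - (\<Sum>i\<in>UNIV. h $ i * b' i (0, x))) + (\<Sum>i\<in>UNIV. h $ i * p' i (0, x)) * ?e)
              = (\<Sum>i\<in>UNIV. h $ i *\<^sub>R complex_of_real ((p' i (0, x) - p (0, x) * b' i (0, x)) * ?e))"
            by (simp only: of_real_sum scaleR_conv_of_real of_real_mult)
        qed
      qed
      moreover have "real_polynomial_function (\<lambda>z. p' i z - p z * b' i z)" for i
        by (intro real_polynomial_function_intros p p' b')
      ultimately show ?thesis by (intro exI[of _ "\<lambda>i z. p' i z - p z * b' i z"]) auto
    qed
    fix f assume "f \<in> \<C>"
    then obtain p where p: "real_polynomial_function p" "f = F p" by (auto simp: \<C>_def)
    obtain p' where p': "\<And>i. real_polynomial_function (p' i)"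
      "\<And>x. (f has_derivative (\<lambda>h. \<Sum>i\<in>UNIV. h $ i *\<^sub>R F (p' i) x)) (at x)"
      using deriv[OF p(1)] p(2) by blast
    show "f differentiable (at x)" for x using p'(2) by (auto simp: differentiable_def)
    show "partial_derivative i f \<in> \<C>" for i
    proof -
      have "partial_derivative i f = F (p' i)"
        using partial_derivative_eqI[OF p'(2)]
        by (simp add: fun_eq_iff axis_def if_distrib[of "\<lambda>c. c *\<^sub>R _"] cong: if_cong)
      then show ?thesis using p'(1) by (auto simp: \<C>_def)
    qed
    show "\<exists>B. \<forall>x. \<bar>monomial_fun \<alpha> x\<bar> * norm (f x) \<le> B" for \<alpha>
    proof -
      obtain C N where C: "C \<ge> 0" "\<forall>s\<in>{0..1}. \<forall>x. \<bar>p (s, x)\<bar> \<le> C * (1 + norm x) ^ N"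
        using real_polynomial_function_growth_parameter[OF p(1)] by blast
      define N' where "N' = (\<Sum>i\<in>UNIV. \<alpha> i)"
      define m where "m = N' + N"
      obtain D where D: "D \<ge> 0" "\<And>y. y \<ge> 0 \<Longrightarrow> sqrt y ^ m * exp (- y) \<le> D"
        using power_times_exp_bounded[of m] by blast
      have "\<bar>monomial_fun \<alpha> x\<bar> * norm (f x) \<le> C * (2 ^ m * ((1 + norm a) ^ m + \<tau> ^ m * D))" for x
      proof -
        let ?e = "exp (- b (0, x))"
        have x: "1 + norm x \<le> (1 + norm a) + norm (x - a)"
          using norm_triangle_ineq[of a "x - a"] by simp
        have sqrt_b: "sqrt (b (0, x)) = norm (x - a) / \<tau>" and "b (0, x) \<ge> 0" using \<tau> by (simp_all add: b)
        then have "(norm (x - a) / \<tau>) ^ m * ?e \<le> D" using D(2)[of "b (0, x)"] by simp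
        from mult_left_mono[OF this, of "\<tau> ^ m"] have 1: "norm (x - a) ^ m * ?e \<le> \<tau> ^ m * D"
          using \<tau> by (simp add: power_divide)
        have "\<bar>monomial_fun \<alpha> x\<bar> \<le> (1 + norm x) ^ N'"
          using monomial_fun_le_norm_power[of \<alpha> x] power_mono[of "norm x" "1 + norm x" N'] by (simp add: N'_def)
        then have "\<bar>monomial_fun \<alpha> x\<bar> * \<bar>p (0, x)\<bar> \<le> (1 + norm x) ^ N' * (C * (1 + norm x) ^ N)"
          using C by (intro mult_mono) auto
        also have "\<dots> = C * (1 + norm x) ^ m" by (simp add: m_def power_add)
        also have "\<dots> \<le> C * ((1 + norm a) + norm (x - a)) ^ m"
          using C x by (intro mult_left_mono power_mono) auto
        also have "\<dots> \<le> C * (2 ^ m * ((1 + norm a) ^ m + norm (x - a) ^ m))"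
          using C by (intro mult_left_mono power_add_le) auto
        finally have "(\<bar>monomial_fun \<alpha> x\<bar> * \<bar>p (0, x)\<bar>) * ?e \<le> (C * (2 ^ m * ((1 + norm a) ^ m + norm (x - a) ^ m))) * ?e"
          by (rule mult_right_mono) simp
        also have "\<dots> = C * (2 ^ m * ((1 + norm a) ^ m * ?e + norm (x - a) ^ m * ?e))" by (simp add: algebra_simps)
        also have "\<dots> \<le> C * (2 ^ m * ((1 + norm a) ^ m * 1 + \<tau> ^ m * D))"
          using C \<open>b (0, x) \<ge> 0\<close> by (intro mult_left_mono add_mono 1) auto
        finally show ?thesis by (simp add: p(2) F_def abs_mult mult_ac norm_mult)
      qed
      then show ?thesis by blast
    qed
  qed
  then show ?thesis by (simp add: F_def b)
qed

lemma lborel_integral_affine: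
  fixes f :: "real^'n::finite \<Rightarrow> real"
  assumes [measurable]: "f \<in> borel_measurable borel" and \<tau>: "\<tau> > 0"
  shows "integral\<^sup>L lborel f = \<tau> ^ CARD('n) * integral\<^sup>L lborel (\<lambda>x. f (a + \<tau> *\<^sub>R x))"
  using \<tau> by (subst lborel_affine[of \<tau> a]) (simp_all add: integral_density integral_distr)

text \<open>A Gaussian centred at \<open>a\<close> and scaled down by \<open>\<tau>\<close>: its first absolute moment about \<open>a\<close> is
  proportional to \<open>\<tau>\<close>.\<close>

lemma schwartz_mass_near_point:
  fixes a :: "real^'n::finite"
  assumes e: "e > 0"
  obtains \<gamma> where "\<gamma> \<in> schwartz" "integral\<^sup>L lebesgue \<gamma> = 1"
    "integrable lebesgue (\<lambda>x. norm (x - a) * norm (\<gamma> x))"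
    "integral\<^sup>L lebesgue (\<lambda>x. norm (x - a) * norm (\<gamma> x)) \<le> e"
proof -
  define G where "G x = exp (- (norm x)\<^sup>2)" for x :: "real^'n"
  have [measurable]: "G \<in> borel_measurable borel" unfolding G_def by measurable
  define n where "n = CARD('n)"
  define Z where "Z = integral\<^sup>L lborel G"
  define Z1 where "Z1 = integral\<^sup>L lborel (\<lambda>x. norm x * G x)"
  have "(\<lambda>x. complex_of_real (G x)) \<in> schwartz"
    using schwartz_gaussian[of 1 0] by (simp add: G_def)
  from schwartz_integrable_norm_power[OF this, of 0] have "integrable lborel G"
    by (simp add: integrable_completion G_def[abs_def])
  then have "Z \<noteq> 0"
  proof -
    assume int: "integrable lborel G"
    have "\<not> (AE x in lborel. G x = 0)"
      using emeasure_lborel_UNIV[where 'a="real^'n"] ae_filter_eq_bot_iff[of "lborel :: (real^'n) measure"]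
      by (simp add: G_def trivial_limit_def)
    then show ?thesis
      using integral_nonneg_eq_0_iff_AE[OF int] by (simp add: Z_def G_def)
  qed
  moreover have "Z \<ge> 0" unfolding Z_def by (intro integral_nonneg_AE) (simp add: G_def)
  ultimately have Z: "Z > 0" by simp
  have Z1: "Z1 \<ge> 0" unfolding Z1_def by (intro integral_nonneg_AE) (simp add: G_def)
  define \<tau> where "\<tau> = e * Z / (Z1 + 1)"
  have \<tau>: "\<tau> > 0" using e Z Z1 by (simp add: \<tau>_def)
  define k where "k x = exp (- (norm (x - a) / \<tau>)\<^sup>2) / (\<tau> ^ n * Z)" for x
  have [measurable]: "k \<in> borel_measurable borel" unfolding k_def by measurable
  have k: "k x \<ge> 0" for x using \<tau> Z by (simp add: k_def)
  have k_shift: "k (a + \<tau> *\<^sub>R x) = G x / (\<tau> ^ n * Z)" for x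
    using \<tau> by (simp add: k_def G_def)
  define \<gamma> where "\<gamma> x = complex_of_real (k x)" for x
  have "\<gamma> \<in> schwartz"
    using schwartz_cmult[OF schwartz_gaussian[OF \<tau>, of a], of "complex_of_real (1 / (\<tau> ^ n * Z))"]
    by (simp add: \<gamma>_def[abs_def] k_def)
  moreover have "integral\<^sup>L lebesgue \<gamma> = 1"
  proof -
    have "integral\<^sup>L lborel k = \<tau> ^ n * integral\<^sup>L lborel (\<lambda>x. G x / (\<tau> ^ n * Z))"
      using lborel_integral_affine[of k \<tau> a] \<tau> by (simp add: k_shift n_def)
    also have "\<dots> = 1" using \<tau> Z by (simp flip: Z_def)
    finally show ?thesis by (simp add: \<gamma>_def[abs_def] integral_completion)
  qed
  moreover have "integrable lebesgue (\<lambda>x. norm (x - a) * norm (\<gamma> x))"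
  proof -
    have "integrable lebesgue (\<lambda>x. norm x * norm (\<gamma> x) + norm a * norm (\<gamma> x))"
      using schwartz_integrable_norm_power[OF \<open>\<gamma> \<in> schwartz\<close>, of 1] schwartz_integrable_norm_power[OF \<open>\<gamma> \<in> schwartz\<close>, of 0]
      by (intro Bochner_Integration.integrable_add integrable_mult_right) simp_all
    then show ?thesis
    proof (rule Bochner_Integration.integrable_bound)
      show "(\<lambda>x. norm (x - a) * norm (\<gamma> x)) \<in> borel_measurable lebesgue"
        by (rule measurable_completion) (simp add: \<gamma>_def)
      show "AE x in lebesgue. norm (norm (x - a) * norm (\<gamma> x)) \<le> norm (norm x * norm (\<gamma> x) + norm a * norm (\<gamma> x))"
      proof (rule AE_I2)
        fix x
        have "norm (x - a) * norm (\<gamma> x) \<le> (norm x + norm a) * norm (\<gamma> x)"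
          by (intro mult_right_mono norm_triangle_ineq4) auto
        then show "norm (norm (x - a) * norm (\<gamma> x)) \<le> norm (norm x * norm (\<gamma> x) + norm a * norm (\<gamma> x))"
          by (simp add: distrib_right)
      qed
    qed
  qed
  moreover have "integral\<^sup>L lebesgue (\<lambda>x. norm (x - a) * norm (\<gamma> x)) \<le> e"
  proof -
    have "integral\<^sup>L lebesgue (\<lambda>x. norm (x - a) * norm (\<gamma> x)) = integral\<^sup>L lborel (\<lambda>x. norm (x - a) * k x)"
      using k by (simp add: \<gamma>_def integral_completion)
    also have "\<dots> = \<tau> ^ n * integral\<^sup>L lborel (\<lambda>x. (norm x * G x) * (\<tau> / (\<tau> ^ n * Z)))"
      using lborel_integral_affine[of "\<lambda>x. norm (x - a) * k x" \<tau> a] \<tau> by (simp add: k_shift n_def mult_ac)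
    also have "\<dots> = \<tau> * Z1 / Z" using \<tau> Z by (simp flip: Z1_def)
    also have "\<dots> = e * (Z1 / (Z1 + 1))" using Z by (simp add: \<tau>_def)
    also have "\<dots> \<le> e * 1" using e Z1 by (intro mult_left_mono) auto
    finally show ?thesis by simp
  qed
  ultimately show thesis by (rule that)
qed

lemma mass_near_point_integral:
  assumes \<phi>: "\<phi> \<in> schwartz" and \<gamma>: "\<gamma> \<in> schwartz" "integral\<^sup>L lebesgue \<gamma> = 1"
    "integrable lebesgue (\<lambda>x. norm (x - a) * norm (\<gamma> x))"
  shows "cmod (integral\<^sup>L lebesgue (\<lambda>x. \<gamma> x * \<phi> x) - \<phi> a)
    \<le> gradient_bound \<phi> * integral\<^sup>L lebesgue (\<lambda>x. norm (x - a) * norm (\<gamma> x))"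
proof -
  have "integral\<^sup>L lebesgue (\<lambda>x. \<gamma> x * \<phi> x) - \<phi> a = integral\<^sup>L lebesgue (\<lambda>x. \<gamma> x * \<phi> x - \<gamma> x * \<phi> a)"
    using \<gamma>(2) schwartz_integrable_mult[OF \<gamma>(1) \<phi>] schwartz_integrable[OF \<gamma>(1)] by simp
  also have "cmod \<dots> \<le> integral\<^sup>L lebesgue (\<lambda>x. gradient_bound \<phi> * (norm (x - a) * norm (\<gamma> x)))"
  proof (rule Bochner_Integration.integral_norm_bound_integral)
    show "integrable lebesgue (\<lambda>x. \<gamma> x * \<phi> x - \<gamma> x * \<phi> a)"
      using schwartz_integrable_mult[OF \<gamma>(1) \<phi>] schwartz_integrable[OF \<gamma>(1)] by simp
    show "integrable lebesgue (\<lambda>x. gradient_bound \<phi> * (norm (x - a) * norm (\<gamma> x)))"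
      using \<gamma>(3) by (intro integrable_mult_right)
    fix x
    have "norm (\<gamma> x * \<phi> x - \<gamma> x * \<phi> a) = norm (\<gamma> x) * norm (\<phi> x - \<phi> a)"
      by (simp flip: norm_mult right_diff_distrib)
    also have "\<dots> \<le> norm (\<gamma> x) * (gradient_bound \<phi> * norm (x - a))"
      by (intro mult_left_mono schwartz_lipschitz \<phi>) auto
    finally show "norm (\<gamma> x * \<phi> x - \<gamma> x * \<phi> a) \<le> gradient_bound \<phi> * (norm (x - a) * norm (\<gamma> x))"
      by (simp add: mult_ac)
  qed
  finally show ?thesis by simp
qed

text \<open>The point masses of an approximating combination sit in the subspace on which the normal coordinates vanish;
  smearing them out on a scale that is small compared to the reciprocal of their total mass costs little
  both weakly and in the first moments of the normal coordinates.\<close>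

theorem low_dim_distribs_approximation:
  fixes \<iota> :: "'k::finite \<Rightarrow> 'n::finite"
  assumes inj: "inj \<iota>" and h: "h \<in> low_dim_distribs \<iota>"
  obtains f and U :: "real^'n^'n" where "range f \<subseteq> schwartz" "weakly_converges (\<lambda>i. distrib_of (f i)) h"
    "transpose U ** U = mat 1"
    "\<And>j. j \<notin> range \<iota> \<Longrightarrow> (\<lambda>i. integral\<^sup>L lebesgue (\<lambda>x. norm (((U *v x) $ j) *\<^sub>R f i x))) \<longlonglongrightarrow> 0"
proof -
  obtain U g where U: "transpose U ** U = mat 1" and g: "g \<in> tempered"
    and h_eq: "h = rotate_distrib U (tensor_delta \<iota> g)"
    using h unfolding low_dim_distribs_def by blast
  have U': "U ** transpose U = mat 1" using U by (simp add: matrix_left_right_inverse)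
  \<comment> \<open>\<open>V\<close> parametrises the subspace that carries \<open>h\<close>.\<close>
  define V where "V y = transpose U *v embed_coords \<iota> y" for y
  have "linear V"
    unfolding V_def by (intro linear_compose[OF linear_embed_coords matrix_vector_mul_linear, unfolded o_def])
  moreover have "norm (V y) = norm y" for y
    unfolding V_def using norm_orthogonal_matrix_vector_mult[of "transpose U"] U' norm_embed_coords[OF inj] by simp
  ultimately have pullV: "(\<lambda>y. \<phi> (V y)) \<in> schwartz" if "\<phi> \<in> schwartz" for \<phi>
    using schwartz_pullback_isometry(1) that by blast
  have h_apply: "h \<phi> = g (\<lambda>y. \<phi> (V y))" if \<phi>: "\<phi> \<in> schwartz" for \<phi>
  proof -
    have "(\<lambda>x. \<phi> (transpose U *v x)) \<in> schwartz"
      by (rule schwartz_pullback_isometry(1)[OF matrix_vector_mul_linear norm_orthogonal_matrix_vector_mult \<phi>]) (simp add: U')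
    then show ?thesis using \<phi> by (simp add: h_eq rotate_distrib_def tensor_delta_def V_def)
  qed
  obtain K where K: "finite K" "\<And>\<epsilon>. \<epsilon> > 0 \<Longrightarrow> \<exists>P c. finite P \<and>
    (\<forall>\<phi>\<in>schwartz. cmod (g \<phi> - (\<Sum>p\<in>P. c p * \<phi> p)) \<le> \<epsilon> * seminorm_sum K \<phi>)"
    using tempered_point_mass_approximation[OF g] by blast
  have "\<forall>i. \<exists>P c. finite P \<and>
    (\<forall>\<phi>\<in>schwartz. cmod (g \<phi> - (\<Sum>p\<in>P. c p * \<phi> p)) \<le> (1 / real (Suc i)) * seminorm_sum K \<phi>)"
    by (intro allI K(2)) simp
  then obtain P c where Pc: "\<And>i. finite (P i)" "\<And>i \<phi>. \<phi> \<in> schwartz \<Longrightarrow>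
      cmod (g \<phi> - (\<Sum>p\<in>P i. c i p * \<phi> p)) \<le> (1 / real (Suc i)) * seminorm_sum K \<phi>"
    by metis
  define mass where "mass i = 1 + (\<Sum>p\<in>P i. cmod (c i p))" for i
  have mass: "mass i > 0" for i by (simp add: mass_def add_pos_nonneg sum_nonneg)
  define e where "e i = 1 / (real (Suc i) * mass i)" for i
  have e: "e i > 0" for i using mass by (simp add: e_def)
  have small: "(\<Sum>p\<in>P i. cmod (c i p)) * e i \<le> 1 / real (Suc i)" for i
  proof -
    have "(\<Sum>p\<in>P i. cmod (c i p)) * e i \<le> mass i * e i"
      using e[of i] by (intro mult_right_mono) (auto simp: mass_def)
    also have "\<dots> = 1 / real (Suc i)" using mass[of i] by (simp add: e_def)
    finally show ?thesis .
  qed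
  define near where "near i p \<gamma> \<longleftrightarrow> \<gamma> \<in> schwartz \<and> integral\<^sup>L lebesgue \<gamma> = 1 \<and>
    integrable lebesgue (\<lambda>x. norm (x - V p) * norm (\<gamma> x)) \<and>
    integral\<^sup>L lebesgue (\<lambda>x. norm (x - V p) * norm (\<gamma> x)) \<le> e i" for i p and \<gamma> :: "real^'n \<Rightarrow> complex"
  have "\<exists>\<gamma>. near i p \<gamma>" for i p
    unfolding near_def by (rule schwartz_mass_near_point[OF e[of i], of "V p"]) blast
  then have "\<exists>\<gamma>. \<forall>i p. near i p (\<gamma> i p)" by metis
  then obtain \<gamma> where "\<And>i p. near i p (\<gamma> i p)" by blast
  then have \<gamma>: "\<And>i p. \<gamma> i p \<in> schwartz" "\<And>i p. integral\<^sup>L lebesgue (\<gamma> i p) = 1"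
    "\<And>i p. integrable lebesgue (\<lambda>x. norm (x - V p) * norm (\<gamma> i p x))"
    "\<And>i p. integral\<^sup>L lebesgue (\<lambda>x. norm (x - V p) * norm (\<gamma> i p x)) \<le> e i"
    unfolding near_def by blast+
  define f where "f i x = (\<Sum>p\<in>P i. c i p * \<gamma> i p x)" for i x
  have f: "f i \<in> schwartz" for i
    unfolding f_def by (intro schwartz_sum schwartz_cmult \<gamma>)
  have "weakly_converges (\<lambda>i. distrib_of (f i)) h"
    unfolding weakly_converges_def
  proof
    fix \<phi> :: "real^'n \<Rightarrow> complex" assume \<phi>: "\<phi> \<in> schwartz"
    define q where "q = gradient_bound \<phi> + seminorm_sum K (\<lambda>y. \<phi> (V y))"
    have bound: "norm (distrib_of (f i) \<phi> - h \<phi>) \<le> q * (1 / real (Suc i))" for i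
    proof -
      let ?I = "\<lambda>p. integral\<^sup>L lebesgue (\<lambda>x. \<gamma> i p x * \<phi> x)"
      have "distrib_of (f i) \<phi> = integral\<^sup>L lebesgue (\<lambda>x. \<Sum>p\<in>P i. c i p * (\<gamma> i p x * \<phi> x))"
        using \<phi> by (simp add: distrib_of_def f_def sum_distrib_right mult.assoc)
      also have "\<dots> = (\<Sum>p\<in>P i. c i p * ?I p)"
        using schwartz_integrable_mult[OF \<gamma>(1) \<phi>] by (subst Bochner_Integration.integral_sum) auto
      finally have "distrib_of (f i) \<phi> - h \<phi> = (\<Sum>p\<in>P i. c i p * (?I p - \<phi> (V p)))
          - (g (\<lambda>y. \<phi> (V y)) - (\<Sum>p\<in>P i. c i p * \<phi> (V p)))"
        using h_apply[OF \<phi>] by (simp add: right_diff_distrib sum_subtractf)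
      then have "norm (distrib_of (f i) \<phi> - h \<phi>) \<le> norm (\<Sum>p\<in>P i. c i p * (?I p - \<phi> (V p)))
          + norm (g (\<lambda>y. \<phi> (V y)) - (\<Sum>p\<in>P i. c i p * \<phi> (V p)))"
        by (simp add: norm_triangle_ineq4)
      also have "norm (\<Sum>p\<in>P i. c i p * (?I p - \<phi> (V p))) \<le> (\<Sum>p\<in>P i. cmod (c i p) * (gradient_bound \<phi> * e i))"
      proof (rule sum_norm_le)
        fix p
        have "norm (?I p - \<phi> (V p)) \<le> gradient_bound \<phi> * integral\<^sup>L lebesgue (\<lambda>x. norm (x - V p) * norm (\<gamma> i p x))"
          by (rule mass_near_point_integral[OF \<phi> \<gamma>(1,2,3)])
        also have "\<dots> \<le> gradient_bound \<phi> * e i"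
          by (intro mult_left_mono \<gamma> gradient_bound_nonneg \<phi>)
        finally show "norm (c i p * (?I p - \<phi> (V p))) \<le> cmod (c i p) * (gradient_bound \<phi> * e i)"
          by (simp add: norm_mult mult_left_mono)
      qed
      also have "\<dots> = gradient_bound \<phi> * ((\<Sum>p\<in>P i. cmod (c i p)) * e i)"
        by (simp add: sum_distrib_left sum_distrib_right mult_ac)
      also have "\<dots> \<le> gradient_bound \<phi> * (1 / real (Suc i))"
        by (intro mult_left_mono small gradient_bound_nonneg \<phi>)
      also have "norm (g (\<lambda>y. \<phi> (V y)) - (\<Sum>p\<in>P i. c i p * \<phi> (V p))) \<le> (1 / real (Suc i)) * seminorm_sum K (\<lambda>y. \<phi> (V y))"
        by (rule Pc(2)[OF pullV[OF \<phi>]])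
      finally show ?thesis by (simp add: q_def algebra_simps add_divide_distrib)
    qed
    have "(\<lambda>i. q * (1 / real (Suc i))) \<longlonglongrightarrow> q * 0"
      by (intro tendsto_mult tendsto_const lim_1_over_n[THEN LIMSEQ_Suc])
    then have "(\<lambda>i. q * (1 / real (Suc i))) \<longlonglongrightarrow> 0" unfolding mult_zero_right .
    then have "(\<lambda>i. distrib_of (f i) \<phi> - h \<phi>) \<longlonglongrightarrow> 0"
      by (rule Lim_null_comparison[OF always_eventually[OF allI[OF bound]]])
    then show "(\<lambda>i. distrib_of (f i) \<phi>) \<longlonglongrightarrow> h \<phi>" by (simp add: LIM_zero_iff)
  qed
  moreover have "(\<lambda>i. integral\<^sup>L lebesgue (\<lambda>x. norm (((U *v x) $ j) *\<^sub>R f i x))) \<longlonglongrightarrow> 0" if j: "j \<notin> range \<iota>" for j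
  proof (rule Lim_null_comparison[OF _ lim_1_over_n[THEN LIMSEQ_Suc]], intro always_eventually allI)
    fix i
    have UV: "(U *v V p) $ j = 0" for p
    proof -
      have "U *v V p = embed_coords \<iota> p"
        unfolding V_def matrix_vector_mul_assoc U' by (rule matrix_vector_mul_lid)
      then show ?thesis using embed_coords_nth(2)[OF inj j] by simp
    qed
    have int: "integrable lebesgue (\<lambda>x. cmod (c i p) * (norm (x - V p) * norm (\<gamma> i p x)))" for p
      by (intro integrable_mult_right \<gamma>)
    have "norm (integral\<^sup>L lebesgue (\<lambda>x. norm (((U *v x) $ j) *\<^sub>R f i x)))
        \<le> integral\<^sup>L lebesgue (\<lambda>x. \<Sum>p\<in>P i. cmod (c i p) * (norm (x - V p) * norm (\<gamma> i p x)))"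
    proof (rule Bochner_Integration.integral_norm_bound_integral)
      have "(U *v x) $ j = row j U \<bullet> x" for x by (simp add: matrix_vector_mul_component row_def vec_lambda_eta)
      then have "(\<lambda>x. ((U *v x) $ j) *\<^sub>R f i x) \<in> schwartz"
        using schwartz_mult_inner(1)[OF f] by simp
      then show "integrable lebesgue (\<lambda>x. norm (((U *v x) $ j) *\<^sub>R f i x))"
        by (intro integrable_norm schwartz_integrable)
      show "integrable lebesgue (\<lambda>x. \<Sum>p\<in>P i. cmod (c i p) * (norm (x - V p) * norm (\<gamma> i p x)))"
        by (intro Bochner_Integration.integrable_sum int)
      fix x
      have "((U *v x) $ j) *\<^sub>R f i x = (\<Sum>p\<in>P i. ((U *v (x - V p)) $ j) *\<^sub>R (c i p * \<gamma> i p x))"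
        by (simp add: f_def scaleR_sum_right matrix_vector_mult_diff_distrib UV)
      also have "norm \<dots> \<le> (\<Sum>p\<in>P i. cmod (c i p) * (norm (x - V p) * norm (\<gamma> i p x)))"
      proof (rule sum_norm_le)
        fix p
        have "\<bar>(U *v (x - V p)) $ j\<bar> \<le> norm (x - V p)"
          using component_le_norm_cart[of "U *v (x - V p)" j] norm_orthogonal_matrix_vector_mult[OF U] by simp
        then have "\<bar>(U *v (x - V p)) $ j\<bar> * (cmod (c i p) * norm (\<gamma> i p x)) \<le> norm (x - V p) * (cmod (c i p) * norm (\<gamma> i p x))"
          by (rule mult_right_mono) auto
        then show "norm (((U *v (x - V p)) $ j) *\<^sub>R (c i p * \<gamma> i p x)) \<le> cmod (c i p) * (norm (x - V p) * norm (\<gamma> i p x))"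
          by (simp add: norm_mult mult_ac)
      qed
      finally show "norm (norm (((U *v x) $ j) *\<^sub>R f i x)) \<le> (\<Sum>p\<in>P i. cmod (c i p) * (norm (x - V p) * norm (\<gamma> i p x)))"
        by simp
    qed
    also have "\<dots> = (\<Sum>p\<in>P i. cmod (c i p) * integral\<^sup>L lebesgue (\<lambda>x. norm (x - V p) * norm (\<gamma> i p x)))"
      using int by (subst Bochner_Integration.integral_sum) auto
    also have "\<dots> \<le> (\<Sum>p\<in>P i. cmod (c i p) * e i)"
      by (intro sum_mono mult_left_mono \<gamma>) auto
    also have "\<dots> \<le> 1 / real (Suc i)" using small[of i] by (simp add: sum_distrib_right)
    finally show "norm (integral\<^sup>L lebesgue (\<lambda>x. norm (((U *v x) $ j) *\<^sub>R f i x))) \<le> 1 / real (Suc i)" .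
  qed
  ultimately show thesis using f U by (intro that[of f U]) auto
qed

section \<open>The Ky Fan anti-norm\<close>

lemma matrix_orthonormal_rows:
  fixes Q :: "real^'n::finite^'n"
  shows "transpose Q ** Q = mat 1 \<longleftrightarrow> (\<forall>i j. Q $ i \<bullet> Q $ j = (if i = j then 1 else 0))"
proof -
  have "(Q ** transpose Q) $ i $ j = Q $ i \<bullet> Q $ j" for i j
    by (simp add: matrix_matrix_mult_def transpose_def inner_vec_def)
  then have "Q ** transpose Q = mat 1 \<longleftrightarrow> (\<forall>i j. Q $ i \<bullet> Q $ j = (if i = j then 1 else 0))"
    by (simp add: vec_eq_iff mat_def)
  then show ?thesis by (simp add: matrix_left_right_inverse)
qed

lemma symmetric_inner:
  fixes A :: "real^'n::finite^'n"
  assumes "transpose A = A"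
  shows "x \<bullet> (A *v y) = (A *v x) \<bullet> y"
  by (metis assms dot_lmul_matrix vector_transpose_matrix)

text \<open>A maximum point of \<open>x \<bullet> A x\<close> on the unit sphere of the orthogonal complement of the known
  eigenvectors is a further eigenvector.\<close>

lemma symmetric_next_eigenvector:
  fixes A :: "real^'n::finite^'n"
  assumes A: "transpose A = A" and B: "finite B" "card B < CARD('n)"
    and eig: "\<And>b. b \<in> B \<Longrightarrow> \<exists>\<mu>. A *v b = \<mu> *\<^sub>R b"
  shows "\<exists>v \<mu>. norm v = 1 \<and> (\<forall>b\<in>B. b \<bullet> v = 0) \<and> A *v v = \<mu> *\<^sub>R v"
proof -
  define W where "W = {x. \<forall>b\<in>B. b \<bullet> x = 0}"
  have W_lin: "x + t *\<^sub>R y \<in> W" "t *\<^sub>R y \<in> W" if "x \<in> W" "y \<in> W" for x y t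
    using that by (auto simp: W_def inner_add_right)
  have "W = (\<Inter>b\<in>B. {x. b \<bullet> x = 0})" by (auto simp: W_def)
  then have "closed W" by (auto intro: closed_hyperplane)
  then have "compact (W \<inter> sphere 0 1)" by (intro closed_Int_compact) auto
  moreover have "W \<inter> sphere 0 1 \<noteq> {}"
  proof -
    have "dim B < DIM(real^'n)" using B dim_le_card'[of B] by simp
    then obtain x where x: "x \<noteq> 0" "\<And>y. y \<in> span B \<Longrightarrow> orthogonal x y"
      using orthogonal_to_subspace_exists by blast
    then have "x \<in> W" by (auto simp: W_def orthogonal_def inner_commute span_base)
    then have "(1 / norm x) *\<^sub>R x \<in> W \<inter> sphere 0 1" using x(1) W_lin by auto
    then show ?thesis by blast
  qed
  moreover have "continuous_on (W \<inter> sphere 0 1) (\<lambda>x. x \<bullet> (A *v x))"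
    by (intro continuous_intros linear_continuous_on_compose[of _ "\<lambda>x. x", simplified] matrix_vector_mul_linear)
  ultimately have "\<exists>v\<in>W \<inter> sphere 0 1. \<forall>x\<in>W \<inter> sphere 0 1. x \<bullet> (A *v x) \<le> v \<bullet> (A *v v)"
    by (rule continuous_attains_sup)
  then obtain v where v0: "v \<in> W \<inter> sphere 0 1" and max0: "\<forall>x\<in>W \<inter> sphere 0 1. x \<bullet> (A *v x) \<le> v \<bullet> (A *v v)"
    by (rule bexE)
  then have v: "v \<in> W" "norm v = 1" by simp_all
  have max: "x \<bullet> (A *v x) \<le> v \<bullet> (A *v v)" if "x \<in> W" "norm x = 1" for x
    using max0 that by simp
  define \<mu> where "\<mu> = v \<bullet> (A *v v)"
  have bound: "x \<bullet> (A *v x) \<le> \<mu> * (norm x)\<^sup>2" if "x \<in> W" for x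
  proof (cases "x = 0")
    case False
    have "(1 / norm x) *\<^sub>R x \<bullet> (A *v ((1 / norm x) *\<^sub>R x)) \<le> \<mu>"
      unfolding \<mu>_def using False that W_lin by (intro max) auto
    then show ?thesis using False by (simp add: matrix_vector_mult_scaleR field_simps power2_eq_square)
  qed simp
  have ortho: "w \<bullet> (A *v v) = 0" if w: "w \<in> W" "w \<bullet> v = 0" for w
  proof -
    define s where "s = w \<bullet> (A *v v)"
    define r where "r = \<mu> * (norm w)\<^sup>2 - w \<bullet> (A *v w)"
    have quad: "2 * t * s \<le> t\<^sup>2 * r" for t
    proof -
      have "(v + t *\<^sub>R w) \<bullet> (A *v (v + t *\<^sub>R w)) \<le> \<mu> * (norm (v + t *\<^sub>R w))\<^sup>2"
        by (intro bound W_lin v w)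
      moreover have "(v + t *\<^sub>R w) \<bullet> (A *v (v + t *\<^sub>R w)) = \<mu> + 2 * t * s + t\<^sup>2 * (w \<bullet> (A *v w))"
        using symmetric_inner[OF A, of v w]
        by (simp add: matrix_vector_right_distrib matrix_vector_mult_scaleR inner_add_left inner_add_right
            \<mu>_def s_def inner_commute power2_eq_square algebra_simps)
      moreover have "(norm (v + t *\<^sub>R w))\<^sup>2 = 1 + t\<^sup>2 * (norm w)\<^sup>2"
        using v(2) w(2) unfolding power2_norm_eq_inner norm_eq_1
        by (simp add: inner_add_left inner_add_right inner_commute power2_eq_square)
      ultimately show ?thesis by (simp add: r_def algebra_simps)
    qed
    have "r \<ge> 0" using bound[OF w(1)] by (simp add: r_def)
    show ?thesis
    proof (rule ccontr)
      assume "w \<bullet> (A *v v) \<noteq> 0"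
      then have s: "s \<noteq> 0" by (simp add: s_def)
      define c where "c = s / (r + 1)"
      have c: "c \<noteq> 0" "s = c * (r + 1)" using s \<open>r \<ge> 0\<close> by (simp_all add: c_def)
      have "c\<^sup>2 * (2 * (r + 1)) \<le> c\<^sup>2 * r"
        using quad[of c] unfolding c(2) by (simp add: power2_eq_square algebra_simps)
      then have "2 * (r + 1) \<le> r" using c(1) by (subst (asm) mult_le_cancel_left_pos) simp_all
      with \<open>r \<ge> 0\<close> show False by simp
    qed
  qed
  define z where "z = A *v v - \<mu> *\<^sub>R v"
  have "A *v v \<in> W"
    unfolding W_def
  proof (intro CollectI ballI)
    fix b assume b: "b \<in> B"
    then obtain \<nu> where "A *v b = \<nu> *\<^sub>R b" using eig by blast
    then show "b \<bullet> (A *v v) = 0" using symmetric_inner[OF A, of b v] v(1) b by (simp add: W_def)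
  qed
  then have "z \<in> W" using W_lin(1)[of "A *v v" v "- \<mu>"] v(1) by (simp add: z_def)
  moreover have "z \<bullet> v = 0" using v(2) by (simp add: z_def inner_diff_left inner_diff_right \<mu>_def inner_commute norm_eq_1)
  ultimately have "z \<bullet> z = 0" using ortho[of z] by (simp add: z_def inner_diff_right)
  then have "A *v v = \<mu> *\<^sub>R v" by (simp add: z_def)
  with v show ?thesis unfolding W_def by blast
qed

lemma symmetric_orthonormal_eigenvectors:
  fixes A :: "real^'n::finite^'n"
  assumes A: "transpose A = A"
  shows "\<exists>(Q :: real^'n^'n) d. transpose Q ** Q = mat 1 \<and> (\<forall>i. A *v (Q $ i) = d i *\<^sub>R (Q $ i))"
proof -
  have "\<exists>B. finite B \<and> card B = m \<and> (\<forall>b\<in>B. norm b = 1 \<and> (\<exists>\<mu>. A *v b = \<mu> *\<^sub>R b)) \<and>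
      (\<forall>b\<in>B. \<forall>c\<in>B. b \<noteq> c \<longrightarrow> b \<bullet> c = 0)" if "m \<le> CARD('n)" for m
    using that
  proof (induction m)
    case 0
    show ?case by (intro exI[of _ "{}"]) auto
  next
    case (Suc m)
    then obtain B where B: "finite B" "card B = m" "\<forall>b\<in>B. norm b = 1 \<and> (\<exists>\<mu>. A *v b = \<mu> *\<^sub>R b)"
      "\<forall>b\<in>B. \<forall>c\<in>B. b \<noteq> c \<longrightarrow> b \<bullet> c = 0" by auto
    obtain v \<mu> where v: "norm v = 1" "\<forall>b\<in>B. b \<bullet> v = 0" "A *v v = \<mu> *\<^sub>R v"
      using symmetric_next_eigenvector[OF A B(1)] B Suc.prems by auto
    have "v \<notin> B" using v by (metis inner_eq_zero_iff norm_zero zero_neq_one)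
    then show ?case
      using B v by (intro exI[of _ "insert v B"]) (auto simp: inner_commute)
  qed
  from this[of "CARD('n)"] obtain B where B: "finite B" "card B = CARD('n)"
    "\<forall>b\<in>B. norm b = 1 \<and> (\<exists>\<mu>. A *v b = \<mu> *\<^sub>R b)" "\<forall>b\<in>B. \<forall>c\<in>B. b \<noteq> c \<longrightarrow> b \<bullet> c = 0" by auto
  obtain q where q: "bij_betw q (UNIV :: 'n set) B"
    using finite_same_card_bij[of "UNIV :: 'n set" B] B by auto
  then have qB: "q i \<in> B" for i by (auto simp: bij_betw_def)
  have "\<forall>i. \<exists>\<mu>. A *v q i = \<mu> *\<^sub>R q i" using B(3) qB by blast
  from choice[OF this] obtain d where d: "\<And>i. A *v q i = d i *\<^sub>R q i" by blast
  have "q i \<bullet> q j = (if i = j then 1 else 0)" for i j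
  proof (cases "i = j")
    case True
    then show ?thesis using B(3) qB[of i] by (simp add: norm_eq_1)
  next
    case False
    then have "q i \<noteq> q j" using q by (auto simp: bij_betw_def inj_on_def)
    then show ?thesis using B(4) qB False by simp
  qed
  then have "transpose (\<chi> i. q i) ** (\<chi> i. q i) = mat 1" by (simp add: matrix_orthonormal_rows)
  then show ?thesis using d by (intro exI[of _ "\<chi> i. q i"] exI[of _ d]) simp
qed

lemma poly_det: "poly (det M) x = det (\<chi> i j. poly (M $ i $ j) x)"
  by (simp add: det_def poly_sum poly_mult poly_prod)

text \<open>Compared pointwise, where \<open>charpoly A\<close> takes the value \<open>det (x I - A)\<close> and the eigenbasis \<open>Q\<close> diagonalises the matrix.\<close>

lemma charpoly_eigenvectors:
  fixes A :: "real^'n::finite^'n" and d :: "'n \<Rightarrow> real"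
  assumes A: "transpose A = A" and Q: "transpose Q ** Q = mat 1" and eig: "\<And>i. A *v (Q $ i) = d i *\<^sub>R (Q $ i)"
  shows "charpoly A = (\<Prod>i\<in>UNIV. [:- d i, 1:])"
proof (rule poly_ext)
  fix x :: real
  define D :: "real^'n^'n" where "D = (\<chi> i j. if i = j then x - d i else 0)"
  have "(Q ** (mat x - A)) $ i $ j = (D ** Q) $ i $ j" for i j
  proof -
    have "(Q ** (mat x - A)) $ i $ j = (\<Sum>k\<in>UNIV. Q $ i $ k * (if k = j then x else 0)) - (\<Sum>k\<in>UNIV. A $ k $ j * Q $ i $ k)"
      by (simp add: matrix_matrix_mult_def mat_def right_diff_distrib sum_subtractf mult_ac)
    also have "(\<Sum>k\<in>UNIV. A $ k $ j * Q $ i $ k) = (transpose A *v (Q $ i)) $ j"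
      by (simp add: matrix_vector_mult_def transpose_def)
    also have "\<dots> = d i * Q $ i $ j" using A eig[of i] by simp
    also have "(\<Sum>k\<in>UNIV. Q $ i $ k * (if k = j then x else 0)) - d i * Q $ i $ j = (x - d i) * Q $ i $ j"
      by (simp add: if_distrib[of "\<lambda>c. _ * c"] algebra_simps cong: if_cong)
    also have "\<dots> = (D ** Q) $ i $ j"
      by (simp add: D_def matrix_matrix_mult_def if_distrib[of "\<lambda>c. c * _"] cong: if_cong)
    finally show ?thesis .
  qed
  then have "Q ** (mat x - A) = D ** Q" by (simp add: vec_eq_iff)
  then have "det Q * det (mat x - A) = det D * det Q" by (metis det_mul)
  moreover have "det Q \<noteq> 0" using Q invertible_det_nz[of Q] invertible_left_inverse by blast
  ultimately have "det (mat x - A) = det D" by simp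
  also have "\<dots> = (\<Prod>i\<in>UNIV. x - d i)" by (subst det_diagonal) (auto simp: D_def)
  finally have 1: "det (mat x - A) = (\<Prod>i\<in>UNIV. x - d i)" .
  have "poly (charpoly A) x = det (mat x - A)"
    unfolding charpoly_def poly_det
    by (rule arg_cong[of _ _ det]) (simp add: vec_eq_iff mat_def)
  with 1 show "poly (charpoly A) x = poly (\<Prod>i\<in>UNIV. [:- d i, 1:]) x" by (simp add: poly_prod)
qed

lemma ky_fan_antinorm_eigenvectors:
  fixes A :: "real^'n::finite^'n" and d :: "'n \<Rightarrow> real"
  assumes A: "transpose A = A" and Q: "transpose Q ** Q = mat 1" and eig: "\<And>i. A *v (Q $ i) = d i *\<^sub>R (Q $ i)"
    and m: "m \<le> CARD('n)"
  shows "\<exists>J. card J = m \<and> (\<forall>i\<in>J. \<forall>k. k \<notin> J \<longrightarrow> d i \<le> d k) \<and> ky_fan_antinorm m A = (\<Sum>i\<in>J. d i)"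
proof -
  obtain ys where ys: "set ys = (UNIV :: 'n set)" "distinct ys"
    using finite_distinct_list[of "UNIV :: 'n set"] by auto
  define xs where "xs = sort_key d ys"
  have xs: "set xs = UNIV" "distinct xs" "sorted (map d xs)" using ys by (auto simp: xs_def)
  have len: "length xs = CARD('n)" using xs distinct_card by metis
  have "proots (charpoly A) = (\<Sum>i\<in>UNIV. {#d i#})"
    unfolding charpoly_eigenvectors[OF A Q eig] by (subst proots_prod) auto
  also have "\<dots> = image_mset d (mset xs)"
  proof -
    have "mset xs = mset_set UNIV" using xs by (metis mset_set_set)
    then show ?thesis by (simp add: sum_unfold_sum_mset)
  qed
  finally have "proots (charpoly A) = mset (map d xs)" by simp
  then have "sorted_eigenvalues A = sort (map d xs)"
    unfolding sorted_eigenvalues_def by (simp only: sorted_list_of_multiset_mset)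
  with xs(3) have se: "sorted_eigenvalues A = map d xs" by (simp add: sorted_sort_id)
  define J where "J = set (take m xs)"
  have "ky_fan_antinorm m A = (\<Sum>i\<in>J. d i)"
    unfolding ky_fan_antinorm_def se J_def take_map using xs
    by (simp add: sum_list_distinct_conv_sum_set)
  moreover have "card J = m" using xs m len by (simp add: J_def distinct_card)
  moreover have "d i \<le> d k" if "i \<in> J" "k \<notin> J" for i k
  proof -
    have "k \<in> set (drop m xs)" using that xs by (metis J_def UNIV_I Un_iff append_take_drop_id set_append)
    moreover have "sorted (map d (take m xs) @ map d (drop m xs))" using xs(3) by (metis append_take_drop_id map_append)
    ultimately show ?thesis using that by (auto simp: sorted_append J_def)
  qed
  ultimately show ?thesis by blast
qed

text \<open>The eigenvectors of the smallest eigenvalues are permuted into the rows with index in \<open>J\<close>.\<close>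

lemma ky_fan_antinorm_attained:
  fixes A :: "real^'n::finite^'n" and J :: "'n set"
  assumes A: "transpose A = A"
  obtains U where "transpose U ** U = mat 1" "ky_fan_antinorm (card J) A = (\<Sum>j\<in>J. U $ j \<bullet> (A *v (U $ j)))"
proof -
  obtain Q :: "real^'n^'n" and d where Q: "transpose Q ** Q = mat 1" and "\<forall>i. A *v (Q $ i) = d i *\<^sub>R (Q $ i)"
    using symmetric_orthonormal_eigenvectors[OF A] by (elim exE conjE)
  then have eig: "A *v (Q $ i) = d i *\<^sub>R (Q $ i)" for i by simp
  have "card J \<le> CARD('n)" by (simp add: card_mono)
  from ky_fan_antinorm_eigenvectors[OF A Q eig this]
  obtain J0 where J0: "card J0 = card J" "ky_fan_antinorm (card J) A = (\<Sum>i\<in>J0. d i)" by blast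
  obtain \<sigma>1 where \<sigma>1: "bij_betw \<sigma>1 J J0" using J0 finite_same_card_bij[of J J0] by auto
  have "card (- J) = card (- J0)" using J0 by (simp add: Compl_eq_Diff_UNIV card_Diff_subset)
  then obtain \<sigma>2 where \<sigma>2: "bij_betw \<sigma>2 (- J) (- J0)" using finite_same_card_bij[of "- J" "- J0"] by auto
  define \<sigma> where "\<sigma> j = (if j \<in> J then \<sigma>1 j else \<sigma>2 j)" for j
  have \<sigma>: "bij_betw \<sigma> J J0"
    using \<sigma>1 by (subst bij_betw_cong[of J \<sigma> \<sigma>1]) (simp_all add: \<sigma>_def)
  have "bij_betw \<sigma> (- J) (- J0)"
    using \<sigma>2 by (subst bij_betw_cong[of "- J" \<sigma> \<sigma>2]) (simp_all add: \<sigma>_def)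
  from bij_betw_combine[OF \<sigma> this] have inj: "inj \<sigma>" by (simp add: bij_betw_def)
  define U where "U = (\<chi> j. Q $ \<sigma> j)"
  have orth: "Q $ i \<bullet> Q $ j = (if i = j then 1 else 0)" for i j
    using Q unfolding matrix_orthonormal_rows by blast
  have "transpose U ** U = mat 1"
    using inj by (simp add: matrix_orthonormal_rows U_def orth inj_eq)
  moreover have "(\<Sum>j\<in>J. U $ j \<bullet> (A *v (U $ j))) = (\<Sum>j\<in>J. d (\<sigma> j))"
    by (simp add: U_def eig orth)
  moreover have "\<dots> = (\<Sum>i\<in>J0. d i)" by (rule sum.reindex_bij_betw[OF \<sigma>])
  ultimately show thesis using J0 by (intro that[of U]) auto
qed

text \<open>In the eigenbasis the right-hand side is a weighted sum of the eigenvalues with weights between \<open>0\<close> and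
  \<open>1\<close> and total weight \<open>card J\<close>; such a sum is least when all weight is on the smallest eigenvalues.\<close>

lemma ky_fan_antinorm_le:
  fixes A :: "real^'n::finite^'n" and J :: "'n set"
  assumes A: "transpose A = A" and U: "transpose U ** U = mat 1"
  shows "ky_fan_antinorm (card J) A \<le> (\<Sum>j\<in>J. U $ j \<bullet> (A *v (U $ j)))"
proof -
  obtain Q :: "real^'n^'n" and d where Q: "transpose Q ** Q = mat 1" and "\<forall>i. A *v (Q $ i) = d i *\<^sub>R (Q $ i)"
    using symmetric_orthonormal_eigenvectors[OF A] by (elim exE conjE)
  then have eig: "A *v (Q $ i) = d i *\<^sub>R (Q $ i)" for i by simp
  have "card J \<le> CARD('n)" by (simp add: card_mono)
  from ky_fan_antinorm_eigenvectors[OF A Q eig this]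
  obtain J0 where J0: "card J0 = card J" "\<And>i k. i \<in> J0 \<Longrightarrow> k \<notin> J0 \<Longrightarrow> d i \<le> d k"
    "ky_fan_antinorm (card J) A = (\<Sum>i\<in>J0. d i)" by blast
  define w where "w i = (\<Sum>j\<in>J. (Q $ i \<bullet> U $ j)\<^sup>2)" for i
  have unit: "norm (U $ j) = 1" "norm (Q $ j) = 1" for j
    using U Q unfolding matrix_orthonormal_rows by (simp_all add: norm_eq_1)
  have parseval: "(\<Sum>i\<in>UNIV. (O' $ i \<bullet> x)\<^sup>2) = (norm x)\<^sup>2" if "transpose O' ** O' = mat 1" for O' :: "real^'n^'n" and x
    using norm_orthogonal_matrix_vector_mult[OF that, of x] norm_square_vec[of "O' *v x"]
    by (simp add: matrix_vector_mul_component)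
  have w0: "0 \<le> w i" for i by (simp add: w_def sum_nonneg)
  have w1: "w i \<le> 1" for i
  proof -
    have "w i \<le> (\<Sum>j\<in>UNIV. (U $ j \<bullet> Q $ i)\<^sup>2)"
      unfolding w_def inner_commute[of "Q $ i"] by (intro sum_mono2) auto
    then show ?thesis using parseval[OF U, of "Q $ i"] unit by simp
  qed
  have w_sum: "(\<Sum>i\<in>UNIV. w i) = card J"
    unfolding w_def by (subst sum.swap) (simp add: parseval[OF Q] unit)
  have "(\<Sum>j\<in>J. U $ j \<bullet> (A *v (U $ j))) = (\<Sum>i\<in>UNIV. w i * d i)"
  proof -
    have "u \<bullet> (A *v u) = (\<Sum>i\<in>UNIV. (Q $ i \<bullet> u)\<^sup>2 * d i)" for u
    proof -
      have "u = (\<Sum>i\<in>UNIV. (Q $ i \<bullet> u) *\<^sub>R (Q $ i))"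
      proof -
        have "transpose Q *v (Q *v u) = u" using Q by (simp only: matrix_vector_mul_assoc matrix_vector_mul_lid)
        moreover have "transpose Q *v (Q *v u) = (\<Sum>i\<in>UNIV. (Q $ i \<bullet> u) *\<^sub>R (Q $ i))"
          by (simp add: vec_eq_iff matrix_vector_mult_def transpose_def inner_vec_def mult_ac)
        ultimately show ?thesis by simp
      qed
      then have "u \<bullet> (A *v u) = (A *v u) \<bullet> (\<Sum>i\<in>UNIV. (Q $ i \<bullet> u) *\<^sub>R (Q $ i))"
        by (metis inner_commute)
      also have "\<dots> = (\<Sum>i\<in>UNIV. (Q $ i \<bullet> u) * ((A *v u) \<bullet> (Q $ i)))"
        by (simp add: inner_sum_right)
      also have "\<dots> = (\<Sum>i\<in>UNIV. (Q $ i \<bullet> u)\<^sup>2 * d i)"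
      proof (intro sum.cong refl)
        fix i
        have "(A *v u) \<bullet> (Q $ i) = d i * (Q $ i \<bullet> u)"
          using symmetric_inner[OF A, of u "Q $ i"] eig[of i] by (simp add: inner_commute)
        then show "(Q $ i \<bullet> u) * ((A *v u) \<bullet> (Q $ i)) = (Q $ i \<bullet> u)\<^sup>2 * d i"
          by (simp add: power2_eq_square)
      qed
      finally show ?thesis .
    qed
    then have "(\<Sum>j\<in>J. U $ j \<bullet> (A *v (U $ j))) = (\<Sum>j\<in>J. \<Sum>i\<in>UNIV. (Q $ i \<bullet> U $ j)\<^sup>2 * d i)" by simp
    also have "\<dots> = (\<Sum>i\<in>UNIV. w i * d i)" unfolding w_def sum_distrib_right by (rule sum.swap)
    finally show ?thesis .
  qed
  moreover have "(\<Sum>i\<in>J0. d i) \<le> (\<Sum>i\<in>UNIV. w i * d i)"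
  proof -
    have split: "(\<Sum>i\<in>UNIV. h i) = (\<Sum>i\<in>J0. h i) + (\<Sum>i\<in>- J0. h i)" for h :: "'n \<Rightarrow> real"
      by (subst sum.union_disjoint[symmetric]) auto
    obtain t where t: "\<And>i. i \<in> J0 \<Longrightarrow> d i \<le> t" "\<And>k. k \<notin> J0 \<Longrightarrow> t \<le> d k"
    proof (cases "J0 = {}")
      case True
      then show thesis by (intro that[of "Min (range d)"]) auto
    next
      case False
      then show thesis using J0(2) by (intro that[of "Max (d ` J0)"]) auto
    qed
    have "(\<Sum>i\<in>J0. (1 - w i) * d i) \<le> (\<Sum>i\<in>J0. (1 - w i) * t)"
      by (intro sum_mono mult_left_mono t) (auto simp: w1)
    also have "\<dots> = t * (card J0 - (\<Sum>i\<in>J0. w i))" by (simp add: sum_subtractf flip: sum_distrib_right)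
    also have "\<dots> = t * (\<Sum>i\<in>- J0. w i)" using w_sum split[of w] J0(1) by simp
    also have "\<dots> \<le> (\<Sum>i\<in>- J0. w i * d i)"
      unfolding sum_distrib_left by (intro sum_mono) (auto simp: mult.commute[of t] intro!: mult_left_mono t w0)
    finally show ?thesis unfolding split[of "\<lambda>i. w i * d i"] by (simp add: left_diff_distrib sum_subtractf)
  qed
  ultimately show ?thesis using J0 by simp
qed

section \<open>The form of a proper kernel\<close>

lemma L2_measurable: "f \<in> L2_funs \<Longrightarrow> f \<in> borel_measurable lebesgue"
  by (simp add: L2_funs_def)

lemma L2_integrable_square: "f \<in> L2_funs \<Longrightarrow> integrable lebesgue (\<lambda>x. (cmod (f x))\<^sup>2)"
  by (simp add: L2_funs_def)

lemma L2_cmult: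
  assumes "f \<in> L2_funs" shows "(\<lambda>x. c * f x) \<in> L2_funs"
  using assms by (auto simp: L2_funs_def norm_mult power_mult_distrib)

lemma L2_scaleR: "f \<in> L2_funs \<Longrightarrow> (\<lambda>x. c *\<^sub>R f x) \<in> L2_funs"
  using L2_cmult[of f "of_real c"] by (simp add: scaleR_conv_of_real)

lemma L2_add:
  assumes "f \<in> L2_funs" "g \<in> L2_funs"
  shows "(\<lambda>x. f x + g x) \<in> L2_funs"
proof -
  have m: "(\<lambda>x. f x + g x) \<in> borel_measurable lebesgue"
    using assms by (intro borel_measurable_add L2_measurable)
  have "integrable lebesgue (\<lambda>x. 2 * (cmod (f x))\<^sup>2 + 2 * (cmod (g x))\<^sup>2)"
    using assms by (intro Bochner_Integration.integrable_add integrable_mult_right L2_integrable_square)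
  then have "integrable lebesgue (\<lambda>x. (cmod (f x + g x))\<^sup>2)"
  proof (rule Bochner_Integration.integrable_bound)
    show "AE x in lebesgue. norm ((cmod (f x + g x))\<^sup>2) \<le> norm (2 * (cmod (f x))\<^sup>2 + 2 * (cmod (g x))\<^sup>2)"
    proof (rule AE_I2)
      fix x
      have "(cmod (f x + g x))\<^sup>2 \<le> (cmod (f x) + cmod (g x))\<^sup>2"
        by (intro power_mono norm_triangle_ineq) auto
      also have "\<dots> \<le> 2 * (cmod (f x))\<^sup>2 + 2 * (cmod (g x))\<^sup>2"
        using zero_le_power2[of "cmod (f x) - cmod (g x)"] by (simp add: power2_sum power2_diff)
      finally show "norm ((cmod (f x + g x))\<^sup>2) \<le> norm (2 * (cmod (f x))\<^sup>2 + 2 * (cmod (g x))\<^sup>2)" by simp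
    qed
  qed (use m in measurable)
  with m show ?thesis by (simp add: L2_funs_def)
qed

lemma borel_measurable_cnj_comp:
  "f \<in> borel_measurable N \<Longrightarrow> (\<lambda>x. cnj (f x)) \<in> borel_measurable N"
  by (rule borel_measurable_continuous_on[of cnj]) (auto intro: continuous_intros)

lemma L2_integrable_product:
  assumes "f \<in> L2_funs" "g \<in> L2_funs"
  shows "integrable lebesgue (\<lambda>x. cnj (f x) * g x)"
proof -
  have "integrable lebesgue (\<lambda>x. (cmod (f x))\<^sup>2 + (cmod (g x))\<^sup>2)"
    using assms by (intro Bochner_Integration.integrable_add L2_integrable_square)
  then show ?thesis
  proof (rule Bochner_Integration.integrable_bound)
    show "(\<lambda>x. cnj (f x) * g x) \<in> borel_measurable lebesgue"
      by (intro borel_measurable_times borel_measurable_cnj_comp L2_measurable assms)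
    show "AE x in lebesgue. norm (cnj (f x) * g x) \<le> norm ((cmod (f x))\<^sup>2 + (cmod (g x))\<^sup>2)"
    proof (rule AE_I2)
      fix x
      have "0 \<le> cmod (f x) * cmod (g x)" by simp
      then have "cmod (f x) * cmod (g x) \<le> (cmod (f x))\<^sup>2 + (cmod (g x))\<^sup>2"
        using zero_le_power2[of "cmod (f x) - cmod (g x)"] unfolding power2_diff by linarith
      then show "norm (cnj (f x) * g x) \<le> norm ((cmod (f x))\<^sup>2 + (cmod (g x))\<^sup>2)"
        by (simp add: norm_mult)
    qed
  qed
qed

lemma L2_inner_cnj: "cnj (L2_inner f g) = L2_inner g f"
  unfolding L2_inner_def by (subst Bochner_Integration.integral_cnj[symmetric]) (simp add: mult.commute)

definition op_form :: "(real^'n::finite \<Rightarrow> real^'n \<Rightarrow> complex) \<Rightarrow> (real^'n \<Rightarrow> complex) \<Rightarrow> (real^'n \<Rightarrow> complex) \<Rightarrow> complex" where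
  "op_form M f g = L2_inner f (kernel_op M g)"

lemma kernel_form_eq_op_form: "kernel_form f M g = op_form M f g"
  unfolding kernel_form_def op_form_def L2_inner_def kernel_op_def
  by (simp add: mult.assoc)

context
  fixes M :: "real^'n::finite \<Rightarrow> real^'n \<Rightarrow> complex"
  assumes M: "proper_kernel M"
begin

lemma kernel_op_L2: "f \<in> L2_funs \<Longrightarrow> kernel_op M f \<in> L2_funs"
  and kernel_op_integrable: "f \<in> L2_funs \<Longrightarrow> AE x in lebesgue. integrable lebesgue (\<lambda>y. M x y * f y)"
  and kernel_op_selfadjoint: "f \<in> L2_funs \<Longrightarrow> g \<in> L2_funs \<Longrightarrow> op_form M f g = L2_inner (kernel_op M f) g"
  using M unfolding proper_kernel_def op_form_def by blast+

lemma op_form_add_right: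
  assumes "f \<in> L2_funs" "g \<in> L2_funs" "h \<in> L2_funs"
  shows "op_form M f (\<lambda>x. g x + h x) = op_form M f g + op_form M f h"
proof -
  have "AE x in lebesgue. kernel_op M (\<lambda>x. g x + h x) x = kernel_op M g x + kernel_op M h x"
    using kernel_op_integrable[OF assms(2)] kernel_op_integrable[OF assms(3)]
    by eventually_elim (simp add: kernel_op_def distrib_left)
  then have AE_eq: "AE x in lebesgue. cnj (f x) * kernel_op M (\<lambda>x. g x + h x) x
      = cnj (f x) * kernel_op M g x + cnj (f x) * kernel_op M h x"
    by (auto simp: distrib_left elim!: eventually_mono)
  have "op_form M f (\<lambda>x. g x + h x) = integral\<^sup>L lebesgue (\<lambda>x. cnj (f x) * kernel_op M g x + cnj (f x) * kernel_op M h x)"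
    unfolding op_form_def L2_inner_def
  proof (rule integral_cong_AE[OF _ _ AE_eq])
    show "(\<lambda>x. cnj (f x) * kernel_op M (\<lambda>x. g x + h x) x) \<in> borel_measurable lebesgue"
      "(\<lambda>x. cnj (f x) * kernel_op M g x + cnj (f x) * kernel_op M h x) \<in> borel_measurable lebesgue"
      by (intro borel_measurable_add borel_measurable_times borel_measurable_cnj_comp L2_measurable
          kernel_op_L2 L2_add assms)+
  qed
  also have "\<dots> = op_form M f g + op_form M f h"
    unfolding op_form_def L2_inner_def
    by (intro Bochner_Integration.integral_add L2_integrable_product kernel_op_L2 assms)
  finally show ?thesis .
qed

lemma op_form_cmult_right: "op_form M f (\<lambda>x. c * g x) = c * op_form M f g"
proof -
  have "kernel_op M (\<lambda>x. c * g x) = (\<lambda>x. c * kernel_op M g x)"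
    by (simp add: kernel_op_def fun_eq_iff mult.left_commute[of _ c])
  then show ?thesis by (simp add: op_form_def L2_inner_def mult.left_commute[of _ c])
qed

lemma op_form_hermitian:
  assumes "f \<in> L2_funs" "g \<in> L2_funs"
  shows "cnj (op_form M f g) = op_form M g f"
  using kernel_op_selfadjoint[OF assms] by (simp add: L2_inner_cnj op_form_def)

lemma op_form_add_left:
  assumes "f \<in> L2_funs" "g \<in> L2_funs" "h \<in> L2_funs"
  shows "op_form M (\<lambda>x. g x + h x) f = op_form M g f + op_form M h f"
  using op_form_hermitian[OF assms(1) L2_add[OF assms(2,3)]] op_form_hermitian[OF assms(1,2)] op_form_hermitian[OF assms(1,3)]
    op_form_add_right[OF assms] by (metis complex_cnj_add)

lemma op_form_cmult_left:
  assumes "f \<in> L2_funs" "g \<in> L2_funs"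
  shows "op_form M (\<lambda>x. c * g x) f = cnj c * op_form M g f"
  using op_form_hermitian[OF assms(1) L2_cmult[OF assms(2), of c]] op_form_hermitian[OF assms]
    op_form_cmult_right[of f c g] by (metis complex_cnj_mult)

lemma op_form_nonneg:
  assumes "f \<in> L2_funs" shows "0 \<le> Re (op_form M f f)"
proof (cases "AE x in lebesgue. f x = 0")
  case True
  then have "L2_inner f (kernel_op M f) = 0"
    unfolding L2_inner_def by (intro integral_eq_zero_AE) (auto elim: eventually_mono)
  then show ?thesis by (simp add: op_form_def)
next
  case False
  then show ?thesis using M assms unfolding proper_kernel_def op_form_def by force
qed

text \<open>The Cauchy--Schwarz inequality in a form that needs no case distinction on \<open>\<langle>\<phi>, O\<^sub>M \<phi>\<rangle> = 0\<close>.\<close>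

lemma op_form_cauchy_schwarz:
  assumes \<phi>: "\<phi> \<in> L2_funs" and F: "F \<in> L2_funs"
  shows "(cmod (op_form M \<phi> F))\<^sup>2 \<le> (Re (op_form M \<phi> \<phi>) + 1) * Re (op_form M F F)"
proof -
  define b where "b = op_form M \<phi> F"
  define p where "p = Re (op_form M \<phi> \<phi>)"
  define q where "q = Re (op_form M F F)"
  define t where "t = 1 / (p + 1)"
  define z where "z = - complex_of_real t * b"
  have p: "p \<ge> 0" using op_form_nonneg[OF \<phi>] by (simp add: p_def)
  have z\<phi>: "(\<lambda>x. z * \<phi> x) \<in> L2_funs" by (intro L2_cmult \<phi>)
  have "0 \<le> Re (op_form M (\<lambda>x. F x + z * \<phi> x) (\<lambda>x. F x + z * \<phi> x))"
    by (intro op_form_nonneg L2_add F z\<phi>)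
  also have "op_form M (\<lambda>x. F x + z * \<phi> x) (\<lambda>x. F x + z * \<phi> x)
      = op_form M F F + z * op_form M F \<phi> + cnj z * (op_form M \<phi> F + z * op_form M \<phi> \<phi>)"
    using F \<phi> z\<phi> L2_add[OF F z\<phi>]
    by (simp add: op_form_add_left op_form_add_right op_form_cmult_left op_form_cmult_right distrib_left)
  also have "op_form M F \<phi> = cnj b" using op_form_hermitian[OF \<phi> F] by (simp add: b_def)
  also have "Re (op_form M F F + z * cnj b + cnj z * (op_form M \<phi> F + z * op_form M \<phi> \<phi>))
      = q - 2 * t * (cmod b)\<^sup>2 + t\<^sup>2 * (cmod b)\<^sup>2 * p"
  proof -
    have sq: "b * cnj b = complex_of_real ((cmod b)\<^sup>2)" using complex_norm_square[of b] by simp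
    have "z * cnj b = - complex_of_real (t * (cmod b)\<^sup>2)"
      by (simp add: z_def mult.assoc flip: complex_norm_square)
    moreover have "cnj z * b = - complex_of_real (t * (cmod b)\<^sup>2)"
      by (simp add: z_def mult.assoc mult.commute[of "cnj b"] flip: complex_norm_square)
    moreover have "cnj z * z = complex_of_real (t\<^sup>2 * (cmod b)\<^sup>2)"
    proof -
      have "cnj z * z = complex_of_real (t * t) * (b * cnj b)" by (simp add: z_def mult_ac)
      then show ?thesis unfolding sq by (simp add: power2_eq_square)
    qed
    ultimately show ?thesis
      by (simp add: distrib_left b_def[symmetric] mult.assoc[symmetric] q_def p_def)
  qed
  finally have "0 \<le> q - 2 * t * (cmod b)\<^sup>2 + t\<^sup>2 * (cmod b)\<^sup>2 * p" .
  moreover have "t\<^sup>2 * (cmod b)\<^sup>2 * p \<le> t * (cmod b)\<^sup>2"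
  proof -
    have "t * p \<le> 1" using p by (simp add: t_def)
    then have "(t * (cmod b)\<^sup>2) * (t * p) \<le> (t * (cmod b)\<^sup>2) * 1"
      using p by (intro mult_left_mono) (auto simp: t_def)
    then show ?thesis by (simp add: power2_eq_square mult_ac)
  qed
  ultimately have "t * (cmod b)\<^sup>2 \<le> q" by linarith
  then show ?thesis using p by (simp add: t_def b_def p_def q_def field_simps)
qed

text \<open>Boundedness of the kernel makes concentrated functions cheap, however large
  their \<open>L\<^sub>2\<close> norm is.\<close>

lemma op_form_L1_bound:
  obtains C where "C \<ge> 0" "\<And>F. F \<in> schwartz \<Longrightarrow> Re (op_form M F F) \<le> C * (integral\<^sup>L lebesgue (\<lambda>x. norm (F x)))\<^sup>2"
proof -
  obtain C0 where C0: "\<And>x y. cmod (M x y) \<le> C0" using M unfolding proper_kernel_def by blast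
  define C where "C = \<bar>C0\<bar>"
  have C: "cmod (M x y) \<le> C" for x y using C0[of x y] by (simp add: C_def)
  have "Re (op_form M F F) \<le> C * (integral\<^sup>L lebesgue (\<lambda>x. norm (F x)))\<^sup>2" if F: "F \<in> schwartz" for F
  proof -
    let ?N = "integral\<^sup>L lebesgue (\<lambda>x. norm (F x))"
    have intF: "integrable lebesgue (\<lambda>x. norm (F x))" by (intro integrable_norm schwartz_integrable F)
    have N: "?N \<ge> 0" by simp
    have K: "cmod (kernel_op M F x) \<le> C * ?N" for x
    proof (cases "integrable lebesgue (\<lambda>y. M x y * F y)")
      case True
      have "cmod (kernel_op M F x) \<le> integral\<^sup>L lebesgue (\<lambda>y. C * norm (F y))"
        unfolding kernel_op_def using True intF C
        by (intro Bochner_Integration.integral_norm_bound_integral) (auto simp: norm_mult mult_right_mono)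
      then show ?thesis by simp
    next
      case False
      then show ?thesis using N by (simp add: kernel_op_def not_integrable_integral_eq C_def)
    qed
    have "cmod (op_form M F F) \<le> integral\<^sup>L lebesgue (\<lambda>x. norm (F x) * (C * ?N))"
      unfolding op_form_def L2_inner_def
      using L2_integrable_product[OF schwartz_L2[OF F] kernel_op_L2[OF schwartz_L2[OF F]]] intF K
      by (intro Bochner_Integration.integral_norm_bound_integral) (auto simp: norm_mult mult_left_mono)
    also have "\<dots> = C * ?N\<^sup>2" by (simp add: power2_eq_square)
    finally show ?thesis using complex_Re_le_cmod order_trans by blast
  qed
  then show thesis by (intro that[of C]) (auto simp: C_def)
qed

lemma op_form_sum_right:
  assumes "f \<in> L2_funs" "finite A" "\<And>a. a \<in> A \<Longrightarrow> g a \<in> L2_funs"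
  shows "op_form M f (\<lambda>x. \<Sum>a\<in>A. c a *\<^sub>R g a x) = (\<Sum>a\<in>A. c a *\<^sub>R op_form M f (g a)) \<and>
    (\<lambda>x. \<Sum>a\<in>A. c a *\<^sub>R g a x) \<in> L2_funs"
  using assms(2,3)
proof (induction A rule: finite_induct)
  case empty
  have "(\<lambda>x::real^'n. 0) \<in> L2_funs" using schwartz_L2[OF schwartz_zero] .
  then show ?case using op_form_cmult_right[of f 0 "\<lambda>x. 0"] by simp
next
  case (insert a A)
  have "op_form M f (\<lambda>x. c a *\<^sub>R g a x) = c a *\<^sub>R op_form M f (g a)"
    using op_form_cmult_right[of f "of_real (c a)" "g a"] by (simp add: scaleR_conv_of_real)
  with insert show ?case
    using op_form_add_right[OF assms(1) L2_scaleR[of "g a" "c a"]] L2_add[OF L2_scaleR[of "g a" "c a"]] by auto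
qed

context
  fixes f :: "real^'n \<Rightarrow> complex"
  assumes f: "f \<in> schwartz"
begin

lemma coordinate_L2: "(\<lambda>x. x $ i *\<^sub>R f x) \<in> L2_funs"
  by (intro schwartz_L2 schwartz_mult_component f)

lemma directional_L2: "(\<lambda>x. (u \<bullet> x) *\<^sub>R f x) \<in> L2_funs"
  by (intro schwartz_L2 schwartz_mult_inner f)

lemma moment_matrix_symmetric: "transpose (moment_matrix M f) = moment_matrix M f"
proof -
  have "Re (op_form M (\<lambda>x. x $ j *\<^sub>R f x) (\<lambda>x. x $ i *\<^sub>R f x)) = Re (op_form M (\<lambda>x. x $ i *\<^sub>R f x) (\<lambda>x. x $ j *\<^sub>R f x))" for i j
    using arg_cong[OF op_form_hermitian[OF coordinate_L2[of j] coordinate_L2[of i]], of Re] by simp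
  then show ?thesis by (simp add: vec_eq_iff transpose_def moment_matrix_def kernel_form_eq_op_form)
qed

text \<open>The moment matrix in the direction \<open>u\<close> measures how far \<open>f\<close> is from being annihilated by the linear form \<open>u \<bullet> x\<close>.\<close>

lemma moment_matrix_quadratic_form:
  "u \<bullet> (moment_matrix M f *v u) = Re (op_form M (\<lambda>x. (u \<bullet> x) *\<^sub>R f x) (\<lambda>x. (u \<bullet> x) *\<^sub>R f x))"
proof -
  let ?g = "\<lambda>i x. x $ i *\<^sub>R f x" and ?F = "\<lambda>x. (u \<bullet> x) *\<^sub>R f x"
  have F: "?F = (\<lambda>x. \<Sum>i\<in>UNIV. u $ i *\<^sub>R ?g i x)"
    by (simp add: inner_vec_def scaleR_sum_left fun_eq_iff)
  have left: "op_form M ?F h = (\<Sum>i\<in>UNIV. u $ i *\<^sub>R op_form M (?g i) h)" if h: "h \<in> L2_funs" for h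
  proof -
    have "op_form M ?F h = cnj (op_form M h ?F)" by (rule op_form_hermitian[OF h directional_L2, symmetric])
    also have "op_form M h ?F = (\<Sum>i\<in>UNIV. u $ i *\<^sub>R op_form M h (?g i))"
      unfolding F using op_form_sum_right[OF h, of UNIV ?g] coordinate_L2 by simp
    also have "cnj \<dots> = (\<Sum>i\<in>UNIV. u $ i *\<^sub>R op_form M (?g i) h)"
      by (simp add: op_form_hermitian[OF h coordinate_L2])
    finally show ?thesis .
  qed
  have "op_form M ?F ?F = (\<Sum>i\<in>UNIV. u $ i *\<^sub>R op_form M (?g i) ?F)" by (rule left[OF directional_L2])
  also have "\<dots> = (\<Sum>i\<in>UNIV. u $ i *\<^sub>R (\<Sum>j\<in>UNIV. u $ j *\<^sub>R op_form M (?g i) (?g j)))"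
    unfolding F using op_form_sum_right[OF coordinate_L2, of UNIV ?g] coordinate_L2 by simp
  finally have "Re (op_form M ?F ?F) = (\<Sum>i\<in>UNIV. u $ i * (\<Sum>j\<in>UNIV. u $ j * Re (op_form M (?g i) (?g j))))"
    by simp
  then show ?thesis
    by (simp add: inner_vec_def matrix_vector_mult_def moment_matrix_def kernel_form_eq_op_form mult_ac)
qed

lemma moment_matrix_psd: "0 \<le> u \<bullet> (moment_matrix M f *v u)"
  unfolding moment_matrix_quadratic_form by (intro op_form_nonneg directional_L2)

text \<open>For positive semidefinite matrices \<open>2 \<bar>a\<^sub>i\<^sub>j\<bar> \<le> a\<^sub>i\<^sub>i + a\<^sub>j\<^sub>j\<close>; so the trace bound for regular sequences bounds
  the whole matrices.\<close>

lemma moment_matrix_entry_bound: "\<bar>moment_matrix M f $ i $ j\<bar> \<le> trace (moment_matrix M f)"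
proof -
  let ?A = "moment_matrix M f"
  have entry: "axis i 1 \<bullet> (?A *v axis j 1) = ?A $ i $ j" for i j
    by (simp add: matrix_vector_mult_basis column_def inner_axis')
  have diag: "0 \<le> ?A $ i $ i" for i using moment_matrix_psd[of "axis i 1"] by (simp add: entry)
  have diag_le: "?A $ i $ i \<le> trace ?A" for i
    unfolding trace_def by (rule member_le_sum) (auto simp: diag)
  have sym: "?A $ j $ i = ?A $ i $ j"
    using arg_cong[OF moment_matrix_symmetric, of "\<lambda>A. A $ i $ j"] by (simp add: transpose_def)
  have "0 \<le> (axis i 1 + axis j 1) \<bullet> (?A *v (axis i 1 + axis j 1))"
    "0 \<le> (axis i 1 - axis j 1) \<bullet> (?A *v (axis i 1 - axis j 1))" by (rule moment_matrix_psd)+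
  then have "2 * \<bar>?A $ i $ j\<bar> \<le> ?A $ i $ i + ?A $ j $ j"
    by (simp add: matrix_vector_right_distrib matrix_vector_mult_diff_distrib inner_add_left inner_add_right
        inner_diff_left inner_diff_right entry sym)
  with diag_le[of i] diag_le[of j] show ?thesis by linarith
qed

lemma moment_matrix_norm_bound:
  "u \<bullet> (moment_matrix M f *v u) \<le> (real CARD('n))\<^sup>2 * trace (moment_matrix M f) * (norm u)\<^sup>2"
proof -
  let ?A = "moment_matrix M f"
  have "u $ i * (?A $ i $ j * u $ j) \<le> trace ?A * (norm u)\<^sup>2" for i j
  proof -
    have "u $ i * (?A $ i $ j * u $ j) \<le> \<bar>?A $ i $ j\<bar> * (\<bar>u $ i\<bar> * \<bar>u $ j\<bar>)"
      using abs_ge_self[of "u $ i * (?A $ i $ j * u $ j)"] by (simp add: abs_mult mult_ac)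
    also have "\<dots> \<le> trace ?A * (norm u * norm u)"
      using moment_matrix_entry_bound[of i j]
      by (intro mult_mono component_le_norm_cart) auto
    finally show ?thesis by (simp add: power2_eq_square)
  qed
  then have "(\<Sum>i\<in>UNIV. \<Sum>j\<in>UNIV. u $ i * (?A $ i $ j * u $ j)) \<le> (\<Sum>i\<in>(UNIV::'n set). \<Sum>j\<in>(UNIV::'n set). trace ?A * (norm u)\<^sup>2)"
    by (intro sum_mono)
  then show ?thesis
    by (simp add: inner_vec_def matrix_vector_mult_def sum_distrib_left power2_eq_square mult_ac)
qed

text \<open>Weak convergence tests \<open>f\<close> against Schwartz functions, smallness of the moment matrix tests it
  against the range of \<open>O\<^sub>M\<close>; on functions that are of both kinds the two pairings agree.\<close>

lemma distrib_of_range_pairing: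
  assumes \<psi>: "\<psi> \<in> schwartz" and \<phi>: "\<phi> \<in> L2_funs" and eq: "AE x in lebesgue. \<psi> x = kernel_op M \<phi> x"
  shows "distrib_of f (\<lambda>x. (u \<bullet> x) *\<^sub>R cnj (\<psi> x)) = op_form M \<phi> (\<lambda>x. (u \<bullet> x) *\<^sub>R f x)"
proof -
  have "(\<lambda>x. (u \<bullet> x) *\<^sub>R cnj (\<psi> x)) \<in> schwartz" by (intro schwartz_mult_inner schwartz_cnj \<psi>)
  then have "distrib_of f (\<lambda>x. (u \<bullet> x) *\<^sub>R cnj (\<psi> x)) = integral\<^sup>L lebesgue (\<lambda>x. cnj (\<psi> x) * ((u \<bullet> x) *\<^sub>R f x))"
    by (simp add: distrib_of_def mult.commute)
  also have "\<dots> = integral\<^sup>L lebesgue (\<lambda>x. cnj (kernel_op M \<phi> x) * ((u \<bullet> x) *\<^sub>R f x))"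
  proof (rule integral_cong_AE)
    show "(\<lambda>x. cnj (\<psi> x) * ((u \<bullet> x) *\<^sub>R f x)) \<in> borel_measurable lebesgue"
      using L2_integrable_product[OF schwartz_L2[OF \<psi>] directional_L2] by (rule borel_measurable_integrable)
    show "(\<lambda>x. cnj (kernel_op M \<phi> x) * ((u \<bullet> x) *\<^sub>R f x)) \<in> borel_measurable lebesgue"
      using L2_integrable_product[OF kernel_op_L2[OF \<phi>] directional_L2] by (rule borel_measurable_integrable)
  qed (use eq in \<open>auto elim: eventually_mono\<close>)
  also have "\<dots> = op_form M \<phi> (\<lambda>x. (u \<bullet> x) *\<^sub>R f x)"
    by (simp add: kernel_op_selfadjoint[OF \<phi> directional_L2] L2_inner_def)
  finally show ?thesis .
qed

end

end

section \<open>Regular solutions\<close>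

lemma low_dim_distribs_nonempty: "\<exists>h. h \<in> low_dim_distribs \<iota>"
proof -
  have "continuous_map schwartz_topology euclidean (\<lambda>_\<in>schwartz. 0::complex)"
    by (rule continuous_map_eq[of _ _ "\<lambda>_. 0"]) auto
  then have "(\<lambda>_\<in>schwartz. 0) \<in> tempered"
    by (simp add: tempered_def schwartz_add schwartz_cmult)
  moreover have "transpose (mat 1) ** mat 1 = (mat 1 :: real^'a^'a)" by simp
  ultimately show ?thesis unfolding low_dim_distribs_def by blast
qed

lemma matrix_vector_mult_row_inner: "((U :: real^'n::finite^'m) *v x) $ j = U $ j \<bullet> x"
  by (simp add: matrix_vector_mul_component)

lemma compact_orthogonal_matrices: "compact {U :: real^'n::finite^'n. transpose U ** U = mat 1}" (is "compact ?O")
proof -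
  have "closed ?O"
    unfolding matrix_orthonormal_rows
    by (intro closed_Collect_all closed_Collect_eq continuous_intros)
  moreover have "bounded ?O"
  proof (rule boundedI)
    fix U :: "real^'n^'n" assume "U \<in> ?O"
    then have "norm (U $ i) = 1" for i by (simp add: matrix_orthonormal_rows norm_eq_1)
    then show "norm U \<le> real CARD('n)"
      using L2_set_le_sum[of UNIV "\<lambda>i. norm (U $ i)"] by (simp add: norm_vec_def)
  qed
  ultimately show ?thesis by (simp add: compact_eq_bounded_closed)
qed

text \<open>The parallelogram law for the semi-norm of \<open>A\<close>, with one of its terms dropped.\<close>

lemma quadratic_form_perturbation:
  fixes A :: "real^'n::finite^'n"
  assumes "\<And>w. 0 \<le> w \<bullet> (A *v w)"
  shows "u \<bullet> (A *v u) \<le> 2 * (v \<bullet> (A *v v)) + 2 * ((u - v) \<bullet> (A *v (u - v)))"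
  using assms[of "u - 2 *\<^sub>R v"]
  by (simp add: matrix_vector_mult_diff_distrib matrix_vector_mult_scaleR inner_diff_left inner_diff_right)

text \<open>By the variational inequality the penalty is at most the form in the normal directions, which the
  boundedness of the kernel controls by the first moments of the normal coordinates.\<close>

lemma low_dim_recovery_sequence:
  fixes \<iota> :: "'k::finite \<Rightarrow> 'n::finite"
  assumes inj: "inj \<iota>" and M: "proper_kernel M" and h: "h \<in> low_dim_distribs \<iota>"
  obtains f where "range f \<subseteq> schwartz" "weakly_converges (\<lambda>i. distrib_of (f i)) h"
    "(\<lambda>i. ky_fan_antinorm (card (- range \<iota>)) (moment_matrix M (f i))) \<longlonglongrightarrow> 0"
proof -
  obtain f and U :: "real^'n^'n" where f: "range f \<subseteq> schwartz" and conv: "weakly_converges (\<lambda>i. distrib_of (f i)) h"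
    and U: "transpose U ** U = mat 1"
    and small: "\<And>j. j \<notin> range \<iota> \<Longrightarrow> (\<lambda>i. integral\<^sup>L lebesgue (\<lambda>x. norm (((U *v x) $ j) *\<^sub>R f i x))) \<longlonglongrightarrow> 0"
    using low_dim_distribs_approximation[OF inj h] by blast
  have fS: "f i \<in> schwartz" for i using f by auto
  obtain C where C: "C \<ge> 0" "\<And>F. F \<in> schwartz \<Longrightarrow> Re (op_form M F F) \<le> C * (integral\<^sup>L lebesgue (\<lambda>x. norm (F x)))\<^sup>2"
    using op_form_L1_bound[OF M] by blast
  let ?A = "\<lambda>i. moment_matrix M (f i)" and ?J = "- range \<iota>"
  let ?N = "\<lambda>i j. integral\<^sup>L lebesgue (\<lambda>x. norm (((U *v x) $ j) *\<^sub>R f i x))"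
  have "(\<lambda>i. ky_fan_antinorm (card ?J) (?A i)) \<longlonglongrightarrow> 0"
  proof (rule tendsto_sandwich[OF always_eventually always_eventually])
    show "\<forall>i. 0 \<le> ky_fan_antinorm (card ?J) (?A i)"
    proof
      fix i
      obtain V where "ky_fan_antinorm (card ?J) (?A i) = (\<Sum>j\<in>?J. V $ j \<bullet> (?A i *v (V $ j)))"
        using ky_fan_antinorm_attained[OF moment_matrix_symmetric[OF M fS]] by blast
      then show "0 \<le> ky_fan_antinorm (card ?J) (?A i)"
        by (simp add: sum_nonneg moment_matrix_psd[OF M fS])
    qed
    show "\<forall>i. ky_fan_antinorm (card ?J) (?A i) \<le> (\<Sum>j\<in>?J. C * (?N i j)\<^sup>2)"
    proof
      fix i
      have "ky_fan_antinorm (card ?J) (?A i) \<le> (\<Sum>j\<in>?J. U $ j \<bullet> (?A i *v (U $ j)))"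
        by (rule ky_fan_antinorm_le[OF moment_matrix_symmetric[OF M fS] U])
      also have "\<dots> \<le> (\<Sum>j\<in>?J. C * (?N i j)\<^sup>2)"
        unfolding moment_matrix_quadratic_form[OF M fS] matrix_vector_mult_row_inner
        by (intro sum_mono C schwartz_mult_inner fS)
      finally show "ky_fan_antinorm (card ?J) (?A i) \<le> (\<Sum>j\<in>?J. C * (?N i j)\<^sup>2)" .
    qed
    have "(\<lambda>i. \<Sum>j\<in>?J. C * (?N i j)\<^sup>2) \<longlonglongrightarrow> (\<Sum>j\<in>?J. C * 0\<^sup>2)"
      using small by (intro tendsto_intros) auto
    then show "(\<lambda>i. \<Sum>j\<in>?J. C * (?N i j)\<^sup>2) \<longlonglongrightarrow> 0" by simp
  qed simp
  with f conv show thesis by (rule that)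
qed

text \<open>If the smallest \<open>card (- range \<iota>)\<close> eigenvalues of the moment matrices tend to zero, then in the limit of suitable
  eigenframes the form of \<open>u\<^sub>j \<bullet> x\<close> times \<open>f\<^sub>i\<close> tends to zero for the normal directions \<open>u\<^sub>j\<close>.  By
  Cauchy--Schwarz \<open>(u\<^sub>j \<bullet> x) T\<close> vanishes on the range of \<open>O\<^sub>M\<close>, which is dense.\<close>

lemma weak_limit_low_dim:
  fixes \<iota> :: "'k::finite \<Rightarrow> 'n::finite"
  assumes inj: "inj \<iota>" and M: "proper_kernel M" and T: "T \<in> tempered"
    and f: "\<And>i. f i \<in> schwartz" and conv: "weakly_converges (\<lambda>i. distrib_of (f i)) T"
    and tr: "bounded (range (\<lambda>i. trace (moment_matrix M (f i))))"
    and R: "(\<lambda>i. ky_fan_antinorm (card (- range \<iota>)) (moment_matrix M (f i))) \<longlonglongrightarrow> 0"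
  shows "T \<in> low_dim_distribs \<iota>"
proof -
  let ?A = "\<lambda>i. moment_matrix M (f i)" and ?J = "- range \<iota>"
  note psd = moment_matrix_psd[OF M f]
  obtain B where B: "\<And>i. trace (?A i) \<le> B" using tr unfolding bounded_iff by (auto dest: abs_le_D1)
  define attains where "attains i V \<longleftrightarrow> transpose V ** V = mat 1 \<and>
    ky_fan_antinorm (card ?J) (?A i) = (\<Sum>j\<in>?J. V $ j \<bullet> (?A i *v (V $ j)))" for i and V :: "real^'n^'n"
  have "\<exists>V. attains i V" for i
    unfolding attains_def
    by (rule ky_fan_antinorm_attained[OF moment_matrix_symmetric[OF M f[of i]], of ?J]) blast
  then have "\<exists>V. \<forall>i. attains i (V i)" by (intro choice allI)
  then obtain V where V: "\<And>i. transpose (V i) ** V i = mat 1"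
    "\<And>i. ky_fan_antinorm (card ?J) (?A i) = (\<Sum>j\<in>?J. V i $ j \<bullet> (?A i *v (V i $ j)))"
    unfolding attains_def by blast
  obtain U s where U: "transpose U ** U = mat 1" and s: "strict_mono s" and VU: "(V \<circ> s) \<longlonglongrightarrow> U"
    using compact_orthogonal_matrices V(1) unfolding compact_def by blast
  have form0: "(\<lambda>i. U $ j \<bullet> (?A (s i) *v (U $ j))) \<longlonglongrightarrow> 0" if j: "j \<in> ?J" for j
  proof (rule tendsto_sandwich[OF always_eventually always_eventually])
    let ?w = "\<lambda>i. U $ j - V (s i) $ j" and ?c = "(real CARD('n))\<^sup>2"
    show "\<forall>i. 0 \<le> U $ j \<bullet> (?A (s i) *v (U $ j))" by (simp add: psd)
    show "\<forall>i. U $ j \<bullet> (?A (s i) *v (U $ j))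
        \<le> 2 * ky_fan_antinorm (card ?J) (?A (s i)) + 2 * (?c * B * (norm (?w i))\<^sup>2)"
    proof
      fix i
      have "V (s i) $ j \<bullet> (?A (s i) *v (V (s i) $ j)) \<le> ky_fan_antinorm (card ?J) (?A (s i))"
        unfolding V(2) using j by (intro member_le_sum) (auto simp: psd)
      moreover have "?w i \<bullet> (?A (s i) *v ?w i) \<le> ?c * trace (?A (s i)) * (norm (?w i))\<^sup>2"
        by (rule moment_matrix_norm_bound[OF M f])
      moreover have "?c * trace (?A (s i)) * (norm (?w i))\<^sup>2 \<le> ?c * B * (norm (?w i))\<^sup>2"
        by (intro mult_right_mono mult_left_mono B) auto
      ultimately show "U $ j \<bullet> (?A (s i) *v (U $ j))
          \<le> 2 * ky_fan_antinorm (card ?J) (?A (s i)) + 2 * (?c * B * (norm (?w i))\<^sup>2)"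
        using quadratic_form_perturbation[OF psd, of "U $ j" "s i" "V (s i) $ j"] by linarith
    qed
    have "(\<lambda>i. V (s i) $ j) \<longlonglongrightarrow> U $ j" using tendsto_vec_nth[OF VU, of j] by (simp add: o_def)
    moreover have "(\<lambda>i. ky_fan_antinorm (card ?J) (?A (s i))) \<longlonglongrightarrow> 0"
      using LIMSEQ_subseq_LIMSEQ[OF R s] by (simp add: o_def)
    ultimately have "(\<lambda>i. 2 * ky_fan_antinorm (card ?J) (?A (s i)) + 2 * (?c * B * (norm (?w i))\<^sup>2))
        \<longlonglongrightarrow> 2 * 0 + 2 * (?c * B * (norm (U $ j - U $ j))\<^sup>2)"
      by (intro tendsto_add tendsto_mult tendsto_const tendsto_power tendsto_norm tendsto_diff)
    then show "(\<lambda>i. 2 * ky_fan_antinorm (card ?J) (?A (s i)) + 2 * (?c * B * (norm (?w i))\<^sup>2)) \<longlonglongrightarrow> 0" by simp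
  qed simp
  have ann: "T (\<lambda>x. (u \<bullet> x) *\<^sub>R \<psi> x) = 0" if u: "u = U $ j" and j: "j \<in> ?J" and \<psi>: "\<psi> \<in> schwartz" for u j \<psi>
  proof -
    define L where "L \<psi> = (\<lambda>x. (u \<bullet> x) *\<^sub>R cnj (\<psi> x))" for \<psi> :: "real^'n \<Rightarrow> complex"
    have L: "L \<psi> \<in> schwartz" if "\<psi> \<in> schwartz" for \<psi>
      unfolding L_def by (intro schwartz_mult_inner schwartz_cnj that)
    have "continuous_map schwartz_topology schwartz_topology (\<lambda>(\<psi> :: real^'n \<Rightarrow> complex) x. cnj (\<psi> x))"
    proof (rule schwartz_continuous_map_into)
      show "\<exists>K C. finite K \<and> (\<forall>f\<in>schwartz. schwartz_seminorm \<alpha> is (\<lambda>x. cnj (f x)) \<le> C * seminorm_sum K f)" for \<alpha> and "is" :: "'n list"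
        by (intro exI[of _ "{(\<alpha>, is)}"] exI[of _ 1]) (simp add: schwartz_seminorm_cnj seminorm_sum_def)
    qed (auto intro: schwartz_cnj)
    from continuous_map_compose[OF this schwartz_mult_inner(2)[of u]]
    have contL: "continuous_map schwartz_topology schwartz_topology L" by (simp add: L_def[abs_def] o_def)
    let ?D = "{\<psi> \<in> schwartz. \<exists>\<phi>\<in>L2_funs. AE x in lebesgue. \<psi> x = kernel_op M \<phi> x}"
    let ?Z = "{\<psi> \<in> schwartz. T (L \<psi>) \<in> {0}}"
    have "closedin schwartz_topology ?Z"
      using closedin_continuous_map_preimage[OF continuous_map_compose[OF contL tempered_continuous[OF T]], of "{0}"]
      by (simp add: o_def)
    moreover have "?D \<subseteq> ?Z"
    proof
      fix \<psi> assume "\<psi> \<in> ?D"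
      then obtain \<phi> where \<psi>: "\<psi> \<in> schwartz" and \<phi>: "\<phi> \<in> L2_funs" "AE x in lebesgue. \<psi> x = kernel_op M \<phi> x" by blast
      let ?F = "\<lambda>i x. (u \<bullet> x) *\<^sub>R f (s i) x"
      have pairing: "distrib_of (f (s i)) (L \<psi>) = op_form M \<phi> (?F i)" for i
        unfolding L_def by (rule distrib_of_range_pairing[OF M f \<psi> \<phi>])
      have "(\<lambda>i. (cmod (op_form M \<phi> (?F i)))\<^sup>2) \<longlonglongrightarrow> 0"
      proof (rule tendsto_sandwich[OF always_eventually always_eventually])
        show "\<forall>i. 0 \<le> (cmod (op_form M \<phi> (?F i)))\<^sup>2" by simp
        show "\<forall>i. (cmod (op_form M \<phi> (?F i)))\<^sup>2 \<le> (Re (op_form M \<phi> \<phi>) + 1) * (u \<bullet> (?A (s i) *v u))"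
          unfolding moment_matrix_quadratic_form[OF M f]
          using op_form_cauchy_schwarz[OF M \<phi>(1) directional_L2[OF M f]] by blast
        have "(\<lambda>i. (Re (op_form M \<phi> \<phi>) + 1) * (u \<bullet> (?A (s i) *v u))) \<longlonglongrightarrow> (Re (op_form M \<phi> \<phi>) + 1) * 0"
          using form0[OF j] u by (intro tendsto_intros) simp
        then show "(\<lambda>i. (Re (op_form M \<phi> \<phi>) + 1) * (u \<bullet> (?A (s i) *v u))) \<longlonglongrightarrow> 0" by simp
      qed auto
      then have "(\<lambda>i. sqrt ((cmod (op_form M \<phi> (?F i)))\<^sup>2)) \<longlonglongrightarrow> sqrt 0" by (rule tendsto_real_sqrt)
      then have "(\<lambda>i. distrib_of (f (s i)) (L \<psi>)) \<longlonglongrightarrow> 0"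
        unfolding pairing by (simp add: tendsto_norm_zero_iff)
      moreover have "(\<lambda>i. distrib_of (f i) (L \<psi>)) \<longlonglongrightarrow> T (L \<psi>)"
        using conv L[OF \<psi>] unfolding weakly_converges_def by blast
      from LIMSEQ_subseq_LIMSEQ[OF this s] have "(\<lambda>i. distrib_of (f (s i)) (L \<psi>)) \<longlonglongrightarrow> T (L \<psi>)"
        by (simp add: o_def)
      ultimately have "T (L \<psi>) = 0" using LIMSEQ_unique by blast
      with \<psi> show "\<psi> \<in> ?Z" by simp
    qed
    ultimately have "schwartz_topology closure_of ?D \<subseteq> ?Z" by (intro closure_of_minimal)
    then have "schwartz \<subseteq> ?Z" using M unfolding proper_kernel_def by simp
    then have "T (L (\<lambda>x. cnj (\<psi> x))) = 0" using schwartz_cnj[OF \<psi>] by blast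
    then show ?thesis by (simp add: L_def)
  qed
  show ?thesis
    by (rule tempered_annihilated_by_rows[OF inj T U]) (auto simp: matrix_vector_mult_row_inner intro: ann)
qed

theorem theorem5:
  fixes M :: "real^'n::finite \<Rightarrow> real^'n \<Rightarrow> complex"
    and \<iota> :: "'k::finite \<Rightarrow> 'n"
    and I :: "'n distrib \<Rightarrow> real"
    and R :: "(real^'n \<Rightarrow> complex) \<Rightarrow> real"
  assumes "inj \<iota>"
    and "proper_kernel M"
    and "R = (\<lambda>f. ky_fan_antinorm (CARD('n) - CARD('k)) (moment_matrix M f))"
    and "\<And>h. h \<in> low_dim_distribs \<iota> \<union> distrib_of ` schwartz \<Longrightarrow> I h \<ge> 0"
    and "\<And>f h. range f \<subseteq> schwartz \<Longrightarrow> h \<in> low_dim_distribs \<iota> \<Longrightarrow>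
           weakly_converges (\<lambda>i. distrib_of (f i)) h \<Longrightarrow> (\<lambda>i. I (distrib_of (f i))) \<longlonglongrightarrow> I h"
  shows "rsol M (\<lambda>f. I (distrib_of f)) R \<subseteq> {h. is_arg_min I (\<lambda>h. h \<in> low_dim_distribs \<iota>) h}"
proof
  fix T assume "T \<in> rsol M (\<lambda>f. I (distrib_of f)) R"
  then obtain f r where reg: "regularly_solves M (\<lambda>f. I (distrib_of f)) R f" and T: "T \<in> tempered"
    and r: "strict_mono r" and conv: "weakly_converges (\<lambda>i. distrib_of (f (r i))) T"
    unfolding rsol_def weak_limit_points_def by (auto simp: o_def)
  from reg obtain \<epsilon> \<Lambda> where fS: "range f \<subseteq> schwartz" and \<epsilon>: "filterlim \<epsilon> (at_right 0) sequentially"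
    and \<Lambda>: "filterlim \<Lambda> at_top sequentially"
    and opt: "\<And>i. ereal (I (distrib_of (f i)) + \<Lambda> i * R (f i)) \<le>
               (INF g\<in>schwartz. ereal (I (distrib_of g) + \<Lambda> i * R g)) + ereal (\<epsilon> i)"
    and tr: "bounded (range (\<lambda>i. trace (moment_matrix M (f i))))"
    unfolding regularly_solves_def by blast
  have f: "f i \<in> schwartz" for i using fS by auto
  have \<epsilon>0: "\<epsilon> \<longlonglongrightarrow> 0" using \<epsilon> unfolding filterlim_at by blast
  have "card (- range \<iota>) = CARD('n) - CARD('k)"
    using assms(1) by (simp add: Compl_eq_Diff_UNIV card_Diff_subset card_image)
  then have R_def: "R = (\<lambda>f. ky_fan_antinorm (card (- range \<iota>)) (moment_matrix M f))" using assms(3) by simp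
  have R_nonneg: "0 \<le> R g" if g: "g \<in> schwartz" for g
  proof -
    obtain V where "R g = (\<Sum>j\<in>- range \<iota>. V $ j \<bullet> (moment_matrix M g *v (V $ j)))"
      unfolding R_def using ky_fan_antinorm_attained[OF moment_matrix_symmetric[OF assms(2) g]] by blast
    then show ?thesis by (simp add: sum_nonneg moment_matrix_psd[OF assms(2) g])
  qed
  \<comment> \<open>For fixed \<open>i\<close> a recovery sequence for \<open>h\<close> shows that the infimum of the penalized problem is at most \<open>I h\<close>.\<close>
  have upper: "I (distrib_of (f i)) + \<Lambda> i * R (f i) \<le> I h + \<epsilon> i" if h: "h \<in> low_dim_distribs \<iota>" for h i
  proof -
    obtain g where g: "range g \<subseteq> schwartz" "weakly_converges (\<lambda>j. distrib_of (g j)) h" "(\<lambda>j. R (g j)) \<longlonglongrightarrow> 0"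
      unfolding R_def using low_dim_recovery_sequence[OF assms(1,2) h] by blast
    have "I (distrib_of (f i)) + \<Lambda> i * R (f i) \<le> (I (distrib_of (g j)) + \<Lambda> i * R (g j)) + \<epsilon> i" for j
    proof -
      have "(INF g\<in>schwartz. ereal (I (distrib_of g) + \<Lambda> i * R g)) \<le> ereal (I (distrib_of (g j)) + \<Lambda> i * R (g j))"
        using g(1) by (intro INF_lower) auto
      then have "ereal (I (distrib_of (f i)) + \<Lambda> i * R (f i)) \<le> ereal (I (distrib_of (g j)) + \<Lambda> i * R (g j)) + ereal (\<epsilon> i)"
        using opt[of i] by (meson add_right_mono order_trans)
      then show ?thesis by simp
    qed
    moreover have "(\<lambda>j. (I (distrib_of (g j)) + \<Lambda> i * R (g j)) + \<epsilon> i) \<longlonglongrightarrow> (I h + \<Lambda> i * 0) + \<epsilon> i"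
      by (intro tendsto_intros assms(5) g h)
    ultimately have "I (distrib_of (f i)) + \<Lambda> i * R (f i) \<le> (I h + \<Lambda> i * 0) + \<epsilon> i"
      by (intro LIMSEQ_le_const) auto
    then show ?thesis by simp
  qed
  obtain h0 where h0: "h0 \<in> low_dim_distribs \<iota>" using low_dim_distribs_nonempty by blast
  have \<Lambda>_pos: "eventually (\<lambda>i. \<Lambda> i > 0) sequentially" using \<Lambda> by (simp add: filterlim_at_top_dense)
  \<comment> \<open>\<open>\<Lambda>\<^sub>i R(f\<^sub>i)\<close> is bounded because \<open>I \<ge> 0\<close>, and \<open>\<Lambda>\<^sub>i \<rightarrow> \<infinity>\<close>.\<close>
  have "(\<lambda>i. R (f i)) \<longlonglongrightarrow> 0"
  proof (rule tendsto_sandwich[OF always_eventually])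
    show "\<forall>i. 0 \<le> R (f i)" using R_nonneg f by blast
    show "eventually (\<lambda>i. R (f i) \<le> (I h0 + \<epsilon> i) / \<Lambda> i) sequentially"
      using \<Lambda>_pos
    proof eventually_elim
      case (elim i)
      have "0 \<le> I (distrib_of (f i))" using assms(4) f by blast
      then have "\<Lambda> i * R (f i) \<le> I h0 + \<epsilon> i" using upper[OF h0, of i] by linarith
      then show ?case using elim by (simp add: field_simps)
    qed
    show "(\<lambda>i. (I h0 + \<epsilon> i) / \<Lambda> i) \<longlonglongrightarrow> 0"
      by (rule tendsto_divide_0[OF tendsto_add[OF tendsto_const \<epsilon>0] filterlim_at_top_imp_at_infinity[OF \<Lambda>]])
  qed simp
  from LIMSEQ_subseq_LIMSEQ[OF this r] have "(\<lambda>i. R (f (r i))) \<longlonglongrightarrow> 0" by (simp add: o_def)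
  moreover have "bounded (range (\<lambda>i. trace (moment_matrix M (f (r i)))))"
    using tr by (rule bounded_subset) auto
  ultimately have T_low: "T \<in> low_dim_distribs \<iota>"
    unfolding R_def by (intro weak_limit_low_dim[OF assms(1,2) T f conv])
  have "I T \<le> I h" if h: "h \<in> low_dim_distribs \<iota>" for h
  proof (rule LIMSEQ_le)
    show "(\<lambda>i. I (distrib_of (f (r i)))) \<longlonglongrightarrow> I T"
      using f by (intro assms(5) T_low conv) auto
    have "(\<lambda>i. I h + \<epsilon> i) \<longlonglongrightarrow> I h + 0" by (intro tendsto_intros \<epsilon>0)
    then have "(\<lambda>i. I h + \<epsilon> i) \<longlonglongrightarrow> I h" by simp
    from LIMSEQ_subseq_LIMSEQ[OF this r] show "(\<lambda>i. I h + \<epsilon> (r i)) \<longlonglongrightarrow> I h" by (simp add: o_def)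
    have "eventually (\<lambda>i. \<Lambda> (r i) > 0) sequentially"
      using \<Lambda>_pos filterlim_subseq[OF r] by (rule eventually_compose_filterlim)
    then have "eventually (\<lambda>i. I (distrib_of (f (r i))) \<le> I h + \<epsilon> (r i)) sequentially"
    proof eventually_elim
      case (elim i)
      then have "0 \<le> \<Lambda> (r i) * R (f (r i))" using R_nonneg[OF f] by simp
      then show ?case using upper[OF h, of "r i"] by linarith
    qed
    then show "\<exists>N. \<forall>i\<ge>N. I (distrib_of (f (r i))) \<le> I h + \<epsilon> (r i)" by (simp add: eventually_sequentially)
  qed
  then show "T \<in> {h. is_arg_min I (\<lambda>h. h \<in> low_dim_distribs \<iota>) h}"
    using T_low by (auto simp: is_arg_min_def not_less)
qed

end
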